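(* Let $\ell=(l_1,\ldots,l_r)\in(\mathbb{Z}_{\ge0})^r$ and $\theta=\rho+\sum_{k=1}^r l_k\varpi_k$. Suppose $N(\mathbf{x};\ell)=\sum_{\lambda\in\Lambda}a_\lambda\mathbf{x}^\lambda$ where $a_0=1$. Then for every $w\in W$, if $\lambda=\theta-w^{-1}\theta$, the coefficient $a_\lambda$ is given by $$a_\lambda=\prod_{\alpha\in\Phi(w^{-1})}\frac{g_1\bigl(p^{d_\theta(\alpha)-1},p^{d_\theta(\alpha)}\bigr)}{q^{d_\theta(\alpha)/2}}.$$
   Context: Let $\Phi$ be a simply-laced reduced root system of rank $r$ with Weyl group $W$, a fixed decomposition $\Phi=\Phi^+\cup\Phi^-$ into positive and negative roots, simple roots $\alpha_1,\ldots,\alpha_r$ and corresponding simple reflections $\sigma_1,\ldots,\sigma_r\in W$. Indices $i\ne j$ are adjacent if the corresponding nodes of the Dynkin diagram are adjacent. Let $\varpi_1,\ldots,\varpi_r$ be the fundamental weights (the dual basis to the simple roots with respect to the $W$-invariant scalar product $\langle\cdot,\cdot\rangle$ normalized so that $\langle\alpha,\alpha\rangle=2$ for roots $\alpha$), and $\rho=\frac12\sum_{\alpha\in\Phi^+}\alpha=\sum_i\varpi_i$. Let $\Lambda$ be the root lattice, and for $\lambda=\sum_i k_i\alpha_i\in\Lambda$ put $d(\lambda)=\sum_i k_i$ and $\mathbf{x}^\lambda=x_1^{k_1}\cdots x_r^{k_r}$. For $w\in W$, $\Phi(w)=\{\alpha\in\Phi^+\mid w\alpha\in\Phi^-\}$.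 Put $d_\theta(\lambda)=\langle\theta,\lambda\rangle$ for $\lambda\in\Lambda$. Let $p$ be a prime of norm $q$, with $\sqrt q>0$, and let $F=\mathbb{C}(x_1,\ldots,x_r)$, $\mathbf{x}=(x_1,\ldots,x_r)$. For an integer $b\ge1$, $g_1(p^{b-1},p^b)$ denotes the quadratic Gauss sum, whose value is $q^{b-1/2}$ if $b$ is odd and $-q^{b-1}$ if $b$ is even. Define $\sigma_i\mathbf{x}=\mathbf{x}'$ by $x_j'=x_ix_j\sqrt q$ if $i$ and $j$ are adjacent, $x_j'=1/(qx_j)$ if $j=i$, and $x_j'=x_j$ otherwise; this extends to an action of $W$ on $\mathbf{x}$, written $w\mathbf{x}$. Define $\epsilon_i\mathbf{x}=\mathbf{x}'$ by $x_j'=-x_j$ if $i$ and $j$ are adjacent and $x_j'=x_j$ otherwise. For $f\in F$ set $$f^{\pm}_{i,\ell}(\mathbf{x})=\frac{f(\mathbf{x})\pm(-1)^{l_i}f(\epsilon_i\mathbf{x})}{2},$$ $$(f|_\ell\sigma_i)(\mathbf{x})=-\frac{1-qx_i}{qx_i(1-x_i)}(x_i\sqrt q)^{l_i}f^+_{i,\ell}(\sigma_i\mathbf{x})+\frac{1}{x_i\sqrt q}(x_i\sqrt q)^{l_i}f^-_{i,\ell}(\sigma_i\mathbf{x}).$$ This extends to a (right) action $f\mapsto f|_\ell w$ of $W$ on $F$, i.e. $f|_\ell(ww')=(f|_\ell w)|_\ell w'$. Define $$\Delta(\mathbf{x})=\prod_{\alpha\in\Phi^+}(1-q^{d(\alpha)}\mathbf{x}^{2\alpha}),\qquad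 j(w,\mathbf{x})=\Delta(\mathbf{x})/\Delta(w\mathbf{x})=\operatorname{sgn}(w)\,q^{d(\rho-w^{-1}\rho)}\mathbf{x}^{2(\rho-w^{-1}\rho)},$$ $$f(\mathbf{x};\ell)=\Delta(\mathbf{x})^{-1}\sum_{w\in W}j(w,\mathbf{x})\,(1|_\ell w)(\mathbf{x}),\qquad D(\mathbf{x})=\prod_{\alpha\in\Phi^+}(1-q^{d(\alpha)-1}\mathbf{x}^{2\alpha}),$$ and $N(\mathbf{x};\ell)=D(\mathbf{x})f(\mathbf{x};\ell)$, which is a polynomial in $x_1,\ldots,x_r$. *)

theory Defs
  imports
    "HOL-Analysis.Analysis"
    "HOL-Library.Poly_Mapping"
    "HOL-Computational_Algebra.Polynomial_Factorial"
    "HOL-Number_Theory.Prime_Powers"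
begin

section \<open>Root systems\<close>

definition root_reflection :: "'a::euclidean_space \<Rightarrow> 'a \<Rightarrow> 'a" where
  "root_reflection \<beta> v = v - (2 * (v \<bullet> \<beta>) / (\<beta> \<bullet> \<beta>)) *\<^sub>R \<beta>"

definition root_system :: "'a::euclidean_space set \<Rightarrow> bool" where
  "root_system \<Phi> \<longleftrightarrow>
     finite \<Phi> \<and> 0 \<notin> \<Phi> \<and> span \<Phi> = UNIV \<and>
     (\<forall>\<beta>\<in>\<Phi>. root_reflection \<beta> ` \<Phi> = \<Phi>) \<and>
     (\<forall>\<beta>\<in>\<Phi>. \<forall>\<gamma>\<in>\<Phi>. 2 * (\<gamma> \<bullet> \<beta>) / (\<beta> \<bullet> \<beta>) \<in> \<int>)"

definition reduced_root_system :: "'a::euclidean_space set \<Rightarrow> bool" where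
  "reduced_root_system \<Phi> \<longleftrightarrow>
     root_system \<Phi> \<and> (\<forall>\<beta>\<in>\<Phi>. \<forall>c::real. c *\<^sub>R \<beta> \<in> \<Phi> \<longrightarrow> c = 1 \<or> c = -1)"

definition simply_laced :: "'a::euclidean_space set \<Rightarrow> bool" where
  "simply_laced \<Phi> \<longleftrightarrow>
     (\<forall>\<beta>\<in>\<Phi>. \<forall>\<gamma>\<in>\<Phi>. \<gamma> \<noteq> \<beta> \<and> \<gamma> \<noteq> - \<beta> \<longrightarrow>
        2 * (\<gamma> \<bullet> \<beta>) / (\<beta> \<bullet> \<beta>) \<in> {-1, 0, 1})"

text \<open>
  The index type of the simple roots plays the role of \<open>{1..r}\<close>; it is linearly ordered only
  because the library proves that polynomials form an integral domain under this assumption.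
\<close>

definition simple_root_base :: "'a::euclidean_space set \<Rightarrow> ('n::finite \<Rightarrow> 'a) \<Rightarrow> bool" where
  "simple_root_base \<Phi> \<alpha> \<longleftrightarrow>
     inj \<alpha> \<and> range \<alpha> \<subseteq> \<Phi> \<and> independent (range \<alpha>) \<and>
     (\<forall>\<beta>\<in>\<Phi>. \<exists>k::'n \<Rightarrow> nat.
        \<beta> = (\<Sum>i\<in>UNIV. real (k i) *\<^sub>R \<alpha> i) \<or> \<beta> = - (\<Sum>i\<in>UNIV. real (k i) *\<^sub>R \<alpha> i))"

definition positive_roots :: "'a::euclidean_space set \<Rightarrow> ('n::finite \<Rightarrow> 'a) \<Rightarrow> 'a set" where
  "positive_roots \<Phi> \<alpha> = {\<beta> \<in> \<Phi>. \<exists>k::'n \<Rightarrow> nat. \<beta> = (\<Sum>i\<in>UNIV. real (k i) *\<^sub>R \<alpha> i)}"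

definition negative_roots :: "'a::euclidean_space set \<Rightarrow> ('n::finite \<Rightarrow> 'a) \<Rightarrow> 'a set" where
  "negative_roots \<Phi> \<alpha> = uminus ` positive_roots \<Phi> \<alpha>"

definition adjacent :: "('n \<Rightarrow> 'a::euclidean_space) \<Rightarrow> 'n \<Rightarrow> 'n \<Rightarrow> bool" where
  "adjacent \<alpha> i j \<longleftrightarrow> i \<noteq> j \<and> \<alpha> i \<bullet> \<alpha> j \<noteq> 0"

inductive_set weyl_group :: "'a::euclidean_space set \<Rightarrow> ('a \<Rightarrow> 'a) set" for \<Phi> where
  "id \<in> weyl_group \<Phi>"
| "\<beta> \<in> \<Phi> \<Longrightarrow> w \<in> weyl_group \<Phi> \<Longrightarrow> root_reflection \<beta> \<circ> w \<in> weyl_group \<Phi>"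

definition inversions ::
    "'a::euclidean_space set \<Rightarrow> ('n::finite \<Rightarrow> 'a) \<Rightarrow> ('a \<Rightarrow> 'a) \<Rightarrow> 'a set" where
  "inversions \<Phi> \<alpha> w = {\<beta> \<in> positive_roots \<Phi> \<alpha>. w \<beta> \<in> negative_roots \<Phi> \<alpha>}"

definition fundamental_weight :: "('n::finite \<Rightarrow> 'a::euclidean_space) \<Rightarrow> 'n \<Rightarrow> 'a" where
  "fundamental_weight \<alpha> i = (THE v. \<forall>j. v \<bullet> \<alpha> j = (if i = j then 1 else 0))"

definition weyl_vector :: "'a::euclidean_space set \<Rightarrow> ('n::finite \<Rightarrow> 'a) \<Rightarrow> 'a" where
  "weyl_vector \<Phi> \<alpha> = (1/2) *\<^sub>R (\<Sum>\<beta>\<in>positive_roots \<Phi> \<alpha>. \<beta>)"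

definition root_lattice :: "('n::finite \<Rightarrow> 'a::euclidean_space) \<Rightarrow> 'a set" where
  "root_lattice \<alpha> = range (\<lambda>k::'n \<Rightarrow> int. \<Sum>i\<in>UNIV. real_of_int (k i) *\<^sub>R \<alpha> i)"

definition root_coords :: "('n::finite \<Rightarrow> 'a::euclidean_space) \<Rightarrow> 'a \<Rightarrow> 'n \<Rightarrow> int" where
  "root_coords \<alpha> \<mu> = (THE k. \<mu> = (\<Sum>i\<in>UNIV. real_of_int (k i) *\<^sub>R \<alpha> i))"

definition root_height :: "('n::finite \<Rightarrow> 'a::euclidean_space) \<Rightarrow> 'a \<Rightarrow> int" where
  "root_height \<alpha> \<mu> = (\<Sum>i\<in>UNIV. root_coords \<alpha> \<mu> i)"

text \<open>
  A word in the simple reflections representing \<open>w\<close>. The two actions of \<open>W\<close> defined below by their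
  values on simple reflections are evaluated along this word; as they satisfy the relations of
  \<open>W\<close>, the choice of word is immaterial.
\<close>

definition word_of :: "('n \<Rightarrow> 'a::euclidean_space) \<Rightarrow> ('a \<Rightarrow> 'a) \<Rightarrow> 'n list" where
  "word_of \<alpha> w = (SOME is. foldr (\<lambda>i u. root_reflection (\<alpha> i) \<circ> u) is id = w)"


section \<open>The field of rational functions\<close>

type_synonym 'n ratfun = "(('n \<Rightarrow>\<^sub>0 nat) \<Rightarrow>\<^sub>0 complex) fract"

definition rf_const :: "complex \<Rightarrow> 'n::linorder ratfun" where
  "rf_const c = to_fract (Poly_Mapping.single 0 c)"

definition rf_var :: "'n::linorder \<Rightarrow> 'n ratfun" where
  "rf_var i = to_fract (Poly_Mapping.single (Poly_Mapping.single i 1) 1)"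

definition poly_at ::
    "('n::{finite,linorder} \<Rightarrow> 'n ratfun) \<Rightarrow> (('n \<Rightarrow>\<^sub>0 nat) \<Rightarrow>\<^sub>0 complex) \<Rightarrow> 'n ratfun" where
  "poly_at y p =
     (\<Sum>m\<in>Poly_Mapping.keys p.
        rf_const (Poly_Mapping.lookup p m) * (\<Prod>i\<in>UNIV. y i ^ Poly_Mapping.lookup m i))"

text \<open>
  The value \<open>f(y)\<close> of a rational function \<open>f\<close> at a tuple \<open>y\<close> of rational functions, defined
  whenever \<open>f\<close> has a representation whose denominator does not vanish at \<open>y\<close>.
\<close>

definition rf_at :: "('n::{finite,linorder} \<Rightarrow> 'n ratfun) \<Rightarrow> 'n ratfun \<Rightarrow> 'n ratfun" where
  "rf_at y f = (THE g. \<exists>a b. f = Fraction_Field.Fract a b \<and> poly_at y b \<noteq> 0 \<and>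
                              g = poly_at y a / poly_at y b)"

definition monomial_at ::
    "('n::{finite,linorder} \<Rightarrow> 'a::euclidean_space) \<Rightarrow> ('n \<Rightarrow> 'n ratfun) \<Rightarrow> 'a \<Rightarrow> 'n ratfun" where
  "monomial_at \<alpha> y \<mu> = (\<Prod>i\<in>UNIV. y i powi root_coords \<alpha> \<mu> i)"

definition rf_sqrt :: "nat \<Rightarrow> 'n::linorder ratfun" where
  "rf_sqrt q = rf_const (complex_of_real (sqrt (real q)))"


section \<open>The actions of the Weyl group\<close>

definition sigma_point ::
    "('n::{finite,linorder} \<Rightarrow> 'a::euclidean_space) \<Rightarrow> nat \<Rightarrow> 'n \<Rightarrow>
      ('n \<Rightarrow> 'n ratfun) \<Rightarrow> 'n \<Rightarrow> 'n ratfun" where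
  "sigma_point \<alpha> q i y j =
     (if adjacent \<alpha> i j then y i * y j * rf_sqrt q
      else if j = i then 1 / (of_nat q * y j)
      else y j)"

definition eps_point ::
    "('n::{finite,linorder} \<Rightarrow> 'a::euclidean_space) \<Rightarrow> 'n \<Rightarrow>
      ('n \<Rightarrow> 'n ratfun) \<Rightarrow> 'n \<Rightarrow> 'n ratfun" where
  "eps_point \<alpha> i y j = (if adjacent \<alpha> i j then - y j else y j)"

text \<open>A left action: \<open>(\<sigma>\<^sub>i \<sigma>\<^sub>j) y = \<sigma>\<^sub>i (\<sigma>\<^sub>j y)\<close>.\<close>

definition weyl_point ::
    "('n::{finite,linorder} \<Rightarrow> 'a::euclidean_space) \<Rightarrow> nat \<Rightarrow> ('a \<Rightarrow> 'a) \<Rightarrow>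
      ('n \<Rightarrow> 'n ratfun) \<Rightarrow> 'n \<Rightarrow> 'n ratfun" where
  "weyl_point \<alpha> q w y = foldr (sigma_point \<alpha> q) (word_of \<alpha> w) y"

definition plus_part ::
    "('n::{finite,linorder} \<Rightarrow> 'a::euclidean_space) \<Rightarrow> ('n \<Rightarrow> nat) \<Rightarrow> 'n \<Rightarrow>
      'n ratfun \<Rightarrow> 'n ratfun" where
  "plus_part \<alpha> l i f = (f + (-1) ^ l i * rf_at (eps_point \<alpha> i rf_var) f) / 2"

definition minus_part ::
    "('n::{finite,linorder} \<Rightarrow> 'a::euclidean_space) \<Rightarrow> ('n \<Rightarrow> nat) \<Rightarrow> 'n \<Rightarrow>
      'n ratfun \<Rightarrow> 'n ratfun" where
  "minus_part \<alpha> l i f = (f - (-1) ^ l i * rf_at (eps_point \<alpha> i rf_var) f) / 2"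

definition slash_simple ::
    "('n::{finite,linorder} \<Rightarrow> 'a::euclidean_space) \<Rightarrow> nat \<Rightarrow> ('n \<Rightarrow> nat) \<Rightarrow>
      'n ratfun \<Rightarrow> 'n \<Rightarrow> 'n ratfun" where
  "slash_simple \<alpha> q l f i =
     - ((1 - of_nat q * rf_var i) / (of_nat q * rf_var i * (1 - rf_var i)))
         * (rf_var i * rf_sqrt q) ^ l i
         * rf_at (sigma_point \<alpha> q i rf_var) (plus_part \<alpha> l i f)
     + 1 / (rf_var i * rf_sqrt q)
         * (rf_var i * rf_sqrt q) ^ l i
         * rf_at (sigma_point \<alpha> q i rf_var) (minus_part \<alpha> l i f)"

text \<open>A right action: \<open>f | (\<sigma>\<^sub>i \<sigma>\<^sub>j) = (f | \<sigma>\<^sub>i) | \<sigma>\<^sub>j\<close>.\<close>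

definition slash ::
    "('n::{finite,linorder} \<Rightarrow> 'a::euclidean_space) \<Rightarrow> nat \<Rightarrow> ('n \<Rightarrow> nat) \<Rightarrow>
      'n ratfun \<Rightarrow> ('a \<Rightarrow> 'a) \<Rightarrow> 'n ratfun" where
  "slash \<alpha> q l f w = foldl (slash_simple \<alpha> q l) f (word_of \<alpha> w)"


section \<open>The invariant function and its numerator\<close>

definition Delta_at ::
    "'a::euclidean_space set \<Rightarrow> ('n::{finite,linorder} \<Rightarrow> 'a) \<Rightarrow> nat \<Rightarrow>
      ('n \<Rightarrow> 'n ratfun) \<Rightarrow> 'n ratfun" where
  "Delta_at \<Phi> \<alpha> q y =
     (\<Prod>\<beta>\<in>positive_roots \<Phi> \<alpha>.
        1 - of_nat q powi root_height \<alpha> \<beta> * monomial_at \<alpha> y (2 *\<^sub>R \<beta>))"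

definition D_fun ::
    "'a::euclidean_space set \<Rightarrow> ('n::{finite,linorder} \<Rightarrow> 'a) \<Rightarrow> nat \<Rightarrow> 'n ratfun" where
  "D_fun \<Phi> \<alpha> q =
     (\<Prod>\<beta>\<in>positive_roots \<Phi> \<alpha>.
        1 - of_nat q powi (root_height \<alpha> \<beta> - 1) * monomial_at \<alpha> rf_var (2 *\<^sub>R \<beta>))"

definition j_factor ::
    "'a::euclidean_space set \<Rightarrow> ('n::{finite,linorder} \<Rightarrow> 'a) \<Rightarrow> nat \<Rightarrow>
      ('a \<Rightarrow> 'a) \<Rightarrow> 'n ratfun" where
  "j_factor \<Phi> \<alpha> q w =
     Delta_at \<Phi> \<alpha> q rf_var / Delta_at \<Phi> \<alpha> q (weyl_point \<alpha> q w rf_var)"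

definition f_fun ::
    "'a::euclidean_space set \<Rightarrow> ('n::{finite,linorder} \<Rightarrow> 'a) \<Rightarrow> nat \<Rightarrow> ('n \<Rightarrow> nat) \<Rightarrow>
      'n ratfun" where
  "f_fun \<Phi> \<alpha> q l =
     inverse (Delta_at \<Phi> \<alpha> q rf_var)
       * (\<Sum>w\<in>weyl_group \<Phi>. j_factor \<Phi> \<alpha> q w * slash \<alpha> q l 1 w)"

definition N_fun ::
    "'a::euclidean_space set \<Rightarrow> ('n::{finite,linorder} \<Rightarrow> 'a) \<Rightarrow> nat \<Rightarrow> ('n \<Rightarrow> nat) \<Rightarrow>
      'n ratfun" where
  "N_fun \<Phi> \<alpha> q l = D_fun \<Phi> \<alpha> q * f_fun \<Phi> \<alpha> q l"

text \<open>
  The value of the quadratic Gauss sum \<open>g\<^sub>1(p\<^sup>b\<^sup>-\<^sup>1, p\<^sup>b)\<close> for a prime \<open>p\<close> of norm \<open>q\<close> and \<open>b \<ge> 1\<close>.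
\<close>

definition gauss_sum1 :: "nat \<Rightarrow> nat \<Rightarrow> real" where
  "gauss_sum1 q b = (if odd b then real q powr (real b - 1/2) else - (real q ^ (b - 1)))"

end

theory Submission
  imports Defs
begin

text \<open>
  The function \<open>f = N / D\<close> is the sum of \<open>(1 | w)(x) / \<Delta>(w x)\<close> over \<open>w\<close>, so it is invariant under every
  slash operator \<open>| \<sigma>\<^sub>i\<close>. As \<open>D(x) / D(\<sigma>\<^sub>i x)\<close> only involves the simple root \<open>\<alpha>\<^sub>i\<close>, the invariance is a
  linear relation between few coefficients of \<open>N\<close>: those at \<open>\<lambda>\<close> and \<open>\<lambda> - 2 \<alpha>\<^sub>i\<close> and those at \<open>\<lambda>' + k \<alpha>\<^sub>i\<close>
  with \<open>k = 0, 1, 2\<close>, where \<open>\<theta> - \<lambda>'\<close> is the reflection of \<open>\<theta> - \<lambda>\<close> (\<open>N_coefficient_relation\<close>). Now the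
  support of \<open>N\<close> lies in the ball \<open>\<bar>\<theta> - \<lambda>\<bar> \<le> \<bar>\<theta>\<bar>\<close> (\<open>N_support\<close>). For \<open>\<lambda> = \<theta> - w \<theta>\<close> with
  \<open>n = \<langle>w \<theta>, \<alpha>\<^sub>i\<rangle> > 0\<close> this kills all terms but those at \<open>\<lambda>\<close> and \<open>\<lambda>' = \<theta> - \<sigma>\<^sub>i w \<theta>\<close>, so the ratio of the two
  coefficients is determined (\<open>N_extremal_coefficient\<close>); by the parity of \<open>n\<close> it is the normalised
  Gauss sum \<open>g\<^sub>1(p\<^sup>n\<^sup>-\<^sup>1, p\<^sup>n) / q\<^sup>n\<^sup>/\<^sup>2\<close>. Passing from \<open>w\<close> to \<open>\<sigma>\<^sub>i w\<close> adds exactly the inversion \<open>w\<^sup>-\<^sup>1 \<alpha>\<^sub>i\<close>,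
  for which \<open>d\<^sub>\<theta>(w\<^sup>-\<^sup>1 \<alpha>\<^sub>i) = n\<close>, and the formula follows by induction along a word, starting from
  \<open>a\<^sub>0 = 1\<close>.

  Two facts carry this argument. The first is that the slash operators define an action of \<open>W\<close>, without
  which the sum over \<open>w\<close> cannot be reindexed: they are involutions and satisfy the braid relations
  (\<open>slash_simple_involution\<close>, \<open>slash_simple_commute\<close>, \<open>slash_simple_braid\<close>), and operators
  with these properties take the same value along all words for the same element
  (\<open>words_act_equally\<close>).

  The second is the bound on the support. A vector \<open>x\<close> gives the monomial with exponent \<open>\<mu>\<close> the weight
  \<open>\<langle>x, \<mu>\<rangle>\<close> and so defines an order of vanishing of rational functions. A slash operator reflects \<open>x\<close> and
  shifts the order by at least \<open>(l\<^sub>i - 1) \<langle>x, \<alpha>\<^sub>i\<rangle>\<close>, whatever the sign of \<open>\<langle>x, \<alpha>\<^sub>i\<rangle>\<close> (\<open>order_ge_slash\<close>).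
  Hence the summand of \<open>\<Delta> f\<close> for \<open>w\<close> has order at least \<open>\<langle>x, \<theta> - w\<^sup>-\<^sup>1 \<theta>\<rangle>\<close>, while \<open>D / \<Delta>\<close> has order at
  least \<open>0\<close>. So \<open>N\<close> has order at least \<open>\<langle>x, \<theta>\<rangle> - \<bar>x\<bar> \<bar>\<theta>\<bar>\<close> for every \<open>x\<close>, and \<open>x = \<theta> - \<lambda>\<close> gives the bound.

  All computations use the normalised variables \<open>\<surd>q x\<^sub>i\<close>, whose monomials \<open>Y \<mu>\<close> are permuted by \<open>W\<close>
  through its linear action on the exponents \<open>\<mu>\<close>.
\<close>

section \<open>Substitution homomorphisms on rational functions\<close>

lemma rf_const_0 [simp]: "rf_const 0 = 0"
  by (simp add: rf_const_def)

lemma rf_const_1 [simp]: "rf_const 1 = 1"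
  by (simp add: rf_const_def)

lemma rf_const_add: "rf_const (a + b) = rf_const a + rf_const b"
  by (simp add: rf_const_def single_add)

lemma rf_const_mult: "rf_const (a * b) = rf_const a * rf_const b"
  by (simp add: rf_const_def mult_single flip: to_fract_mult)

lemma rf_const_uminus: "rf_const (- a) = - rf_const a"
  by (simp add: rf_const_def single_uminus)

lemma rf_const_diff: "rf_const (a - b) = rf_const a - rf_const b"
  by (simp add: rf_const_def single_diff)

lemma rf_const_of_nat: "rf_const (of_nat n) = of_nat n"
  by (induction n) (simp_all add: rf_const_add)

lemma rf_const_eq_0_iff [simp]: "rf_const a = 0 \<longleftrightarrow> a = 0"
  by (metis rf_const_def to_fract_eq_0_iff lookup_single_eq lookup_zero single_zero)

lemma rf_const_power: "rf_const (a ^ n) = rf_const a ^ n"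
  by (induction n) (simp_all add: rf_const_mult)

lemma rf_const_prod: "rf_const (prod f A) = (\<Prod>x\<in>A. rf_const (f x))"
  by (induction A rule: infinite_finite_induct) (simp_all add: rf_const_mult)

lemma rf_const_inverse: "rf_const (inverse a) = inverse (rf_const a)"
proof (cases "a = 0")
  case False
  then have "rf_const a * rf_const (inverse a) = 1"
    by (simp flip: rf_const_mult)
  then show ?thesis
    by (metis inverse_unique)
qed simp

lemma rf_const_powi: "rf_const (a powi n) = rf_const a powi n"
  by (simp add: power_int_def rf_const_power rf_const_inverse)

lemma ratfun_of_nat_eq_0_iff [simp]: "(of_nat n :: 'n::{finite,linorder} ratfun) = 0 \<longleftrightarrow> n = 0"
  by (metis of_nat_eq_0_iff rf_const_eq_0_iff rf_const_of_nat)

lemma ratfun_2_neq_0 [simp]: "(2 :: 'n::{finite,linorder} ratfun) \<noteq> 0"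
  by (metis ratfun_of_nat_eq_0_iff of_nat_numeral zero_neq_numeral)

lemma rf_sqrt_squared: "rf_sqrt q * rf_sqrt q = of_nat q"
proof -
  have "complex_of_real (sqrt (real q)) * complex_of_real (sqrt (real q)) = of_nat q"
    by (metis of_nat_0_le_iff of_real_mult of_real_of_nat_eq real_sqrt_mult_self abs_of_nonneg)
  then show ?thesis
    by (simp add: rf_sqrt_def rf_const_of_nat flip: rf_const_mult)
qed

lemma rf_var_neq_0 [simp]: "rf_var i \<noteq> 0"
proof -
  have "Poly_Mapping.single (Poly_Mapping.single i 1) (1::complex) \<noteq> 0"
    by (metis lookup_single_eq lookup_zero zero_neq_one)
  then show ?thesis
    by (simp add: rf_var_def del: One_nat_def)
qed

lemma poly_mapping_eq_sum_single:
  "p = (\<Sum>m\<in>Poly_Mapping.keys p. Poly_Mapping.single m (Poly_Mapping.lookup p m))"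
  by (rule poly_mapping_eqI) (simp add: lookup_sum lookup_single when_def in_keys_iff)

lemma poly_at_superset:
  assumes "finite A" "Poly_Mapping.keys p \<subseteq> A"
  shows "poly_at y p =
     (\<Sum>m\<in>A. rf_const (Poly_Mapping.lookup p m) * (\<Prod>i\<in>UNIV. y i ^ Poly_Mapping.lookup m i))"
  unfolding poly_at_def by (rule sum.mono_neutral_left) (use assms in \<open>auto simp: in_keys_iff\<close>)

lemma poly_at_0 [simp]: "poly_at y 0 = 0"
  by (simp add: poly_at_def)

lemma poly_at_single:
  "poly_at y (Poly_Mapping.single m c) = rf_const c * (\<Prod>i\<in>UNIV. y i ^ Poly_Mapping.lookup m i)"
  by (subst poly_at_superset[of "{m}"]) auto

lemma poly_at_add: "poly_at y (p + r) = poly_at y p + poly_at y r"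
proof -
  let ?A = "Poly_Mapping.keys p \<union> Poly_Mapping.keys r"
  have "poly_at y (p + r) = (\<Sum>m\<in>?A. rf_const (Poly_Mapping.lookup (p + r) m)
          * (\<Prod>i\<in>UNIV. y i ^ Poly_Mapping.lookup m i))"
    by (rule poly_at_superset) (auto dest: subsetD[OF keys_add])
  also have "\<dots> = poly_at y p + poly_at y r"
    by (simp add: poly_at_superset[of ?A] lookup_add rf_const_add distrib_right sum.distrib)
  finally show ?thesis .
qed

lemma poly_at_sum: "poly_at y (sum f A) = (\<Sum>x\<in>A. poly_at y (f x))"
  by (induction A rule: infinite_finite_induct) (simp_all add: poly_at_add)

lemma poly_at_mult: "poly_at y (p * r) = poly_at y p * poly_at y r"
proof -
  have "poly_at y (Poly_Mapping.single m c * Poly_Mapping.single k d)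
        = poly_at y (Poly_Mapping.single m c) * poly_at y (Poly_Mapping.single k d)" for m k c d
    by (simp add: mult_single poly_at_single rf_const_mult lookup_add power_add prod.distrib)
  moreover have "p * r = (\<Sum>m\<in>Poly_Mapping.keys p. \<Sum>k\<in>Poly_Mapping.keys r.
      Poly_Mapping.single m (Poly_Mapping.lookup p m) * Poly_Mapping.single k (Poly_Mapping.lookup r k))"
    by (subst sum_product [symmetric]) (simp only: poly_mapping_eq_sum_single [symmetric])
  moreover have "poly_at y p * poly_at y r = (\<Sum>m\<in>Poly_Mapping.keys p. \<Sum>k\<in>Poly_Mapping.keys r.
      poly_at y (Poly_Mapping.single m (Poly_Mapping.lookup p m))
        * poly_at y (Poly_Mapping.single k (Poly_Mapping.lookup r k)))"
    by (subst sum_product [symmetric])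
       (simp only: poly_at_sum [symmetric] poly_mapping_eq_sum_single [symmetric])
  ultimately show ?thesis
    by (simp add: poly_at_sum)
qed

lemma poly_at_1 [simp]: "poly_at y 1 = 1"
  using poly_at_single[of y 0 1] by simp

text \<open>No non-zero denominator vanishes at such a point, so it may be substituted into every rational
  function.\<close>

definition alg_independent_point :: "('n::{finite,linorder} \<Rightarrow> 'n ratfun) \<Rightarrow> bool" where
  "alg_independent_point y \<longleftrightarrow> (\<forall>p. poly_at y p = 0 \<longrightarrow> p = 0)"

definition substitution_hom :: "('n::{finite,linorder} ratfun \<Rightarrow> 'n ratfun) \<Rightarrow> bool" where
  "substitution_hom h \<longleftrightarrow> (\<forall>f g. h (f + g) = h f + h g) \<and> (\<forall>f g. h (f * g) = h f * h g)
     \<and> (\<forall>c. h (rf_const c) = rf_const c)"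

lemma rf_at_Fract:
  assumes "alg_independent_point y" "b \<noteq> 0"
  shows "rf_at y (Fraction_Field.Fract a b) = poly_at y a / poly_at y b"
  unfolding rf_at_def
proof (rule the_equality)
  show "\<exists>a' b'. Fraction_Field.Fract a b = Fraction_Field.Fract a' b' \<and> poly_at y b' \<noteq> 0 \<and>
      poly_at y a / poly_at y b = poly_at y a' / poly_at y b'"
    using assms by (auto simp: alg_independent_point_def)
next
  fix g
  assume "\<exists>a' b'. Fraction_Field.Fract a b = Fraction_Field.Fract a' b' \<and> poly_at y b' \<noteq> 0 \<and>
      g = poly_at y a' / poly_at y b'"
  then obtain a' b' where *: "Fraction_Field.Fract a b = Fraction_Field.Fract a' b'" "poly_at y b' \<noteq> 0"
      "g = poly_at y a' / poly_at y b'"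
    by blast
  then have "b' \<noteq> 0"
    by auto
  with * assms have "a * b' = a' * b"
    by (simp add: eq_fract)
  then have "poly_at y a * poly_at y b' = poly_at y a' * poly_at y b"
    by (metis poly_at_mult)
  moreover have "poly_at y b \<noteq> 0"
    using assms by (auto simp: alg_independent_point_def)
  ultimately show "g = poly_at y a / poly_at y b"
    using * by (simp add: frac_eq_eq)
qed

lemma
  assumes "alg_independent_point y"
  shows rf_at_hom: "substitution_hom (rf_at y)"
    and rf_at_var: "rf_at y (rf_var i) = y i"
proof -
  note [simp] = rf_at_Fract[OF assms] poly_at_mult poly_at_add
  have nz: "poly_at y b \<noteq> 0" if "b \<noteq> 0" for b
    using assms that by (auto simp: alg_independent_point_def)
  have "rf_at y (f + g) = rf_at y f + rf_at y g" for f g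
    by (cases f; cases g) (simp add: nz add_frac_eq mult.commute)
  moreover have "rf_at y (f * g) = rf_at y f * rf_at y g" for f g
    by (cases f; cases g) simp
  moreover have "rf_at y (rf_const c) = rf_const c" for c
    by (simp add: rf_const_def to_fract_def poly_at_single)
  ultimately show "substitution_hom (rf_at y)"
    by (simp add: substitution_hom_def)
  have "(\<Prod>j\<in>UNIV. y j ^ Poly_Mapping.lookup (Poly_Mapping.single i 1) j) = (\<Prod>j\<in>UNIV. if j = i then y j else 1)"
    by (rule prod.cong) (auto simp: lookup_single when_def)
  then have "(\<Prod>j\<in>UNIV. y j ^ Poly_Mapping.lookup (Poly_Mapping.single i 1) j) = y i"
    by simp
  then show "rf_at y (rf_var i) = y i"
    by (simp add: rf_var_def to_fract_def poly_at_single)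
qed

context
  fixes h :: "'n::{finite,linorder} ratfun \<Rightarrow> 'n ratfun"
  assumes h: "substitution_hom h"
begin

lemma hom_add: "h (f + g) = h f + h g"
  and hom_mult: "h (f * g) = h f * h g"
  and hom_const: "h (rf_const c) = rf_const c"
  using h by (auto simp: substitution_hom_def)

lemma hom_0: "h 0 = 0"
  using hom_const[of 0] by simp

lemma hom_1: "h 1 = 1"
  using hom_const[of 1] by simp

lemma hom_of_nat: "h (of_nat k) = of_nat k"
  by (metis hom_const rf_const_of_nat)

lemma hom_numeral: "h (numeral k) = numeral k"
  by (metis hom_of_nat of_nat_numeral)

lemma hom_sqrt: "h (rf_sqrt k) = rf_sqrt k"
  by (simp add: rf_sqrt_def hom_const)

lemma hom_uminus: "h (- f) = - h f"
  by (metis hom_0 hom_add add.right_inverse add_eq_0_iff)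

lemma hom_diff: "h (f - g) = h f - h g"
  by (metis hom_add hom_uminus diff_conv_add_uminus)

lemma hom_power: "h (f ^ n) = h f ^ n"
  by (induction n) (simp_all add: hom_1 hom_mult)

lemma hom_inverse: "h (inverse f) = inverse (h f)"
proof (cases "f = 0")
  case False
  then have "h f * h (inverse f) = 1"
    by (metis hom_1 hom_mult right_inverse)
  then show ?thesis
    by (metis inverse_unique)
qed (simp add: hom_0)

lemma hom_eq_0_iff: "h f = 0 \<longleftrightarrow> f = 0"
  by (metis hom_0 hom_1 hom_mult mult_zero_left right_inverse zero_neq_one)

lemma hom_divide: "h (f / g) = h f / h g"
  by (simp add: divide_inverse hom_mult hom_inverse)

lemma hom_powi: "h (f powi k) = h f powi k"
  by (simp add: power_int_def hom_power hom_inverse)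

lemma hom_sum: "h (sum F A) = (\<Sum>x\<in>A. h (F x))"
  by (induction A rule: infinite_finite_induct) (simp_all add: hom_0 hom_add)

lemma hom_prod: "h (prod F A) = (\<Prod>x\<in>A. h (F x))"
  by (induction A rule: infinite_finite_induct) (simp_all add: hom_1 hom_mult)

lemmas hom_simps = hom_add hom_mult hom_const hom_0 hom_1 hom_numeral hom_of_nat hom_sqrt
  hom_uminus hom_diff hom_power hom_inverse hom_divide hom_powi hom_sum hom_prod

end

lemma to_fract_eq_poly_at: "to_fract p = poly_at rf_var p"
proof -
  have pow: "rf_var i ^ k = to_fract (Poly_Mapping.single (Poly_Mapping.single i k) 1)"
    for i :: 'a and k
    by (induction k) (simp_all add: rf_var_def mult_single flip: to_fract_mult single_add)
  have mon: "(\<Prod>i\<in>A. rf_var i ^ Poly_Mapping.lookup m i)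
      = to_fract (Poly_Mapping.single (\<Sum>i\<in>A. Poly_Mapping.single i (Poly_Mapping.lookup m i)) 1)"
    if "finite A" for A :: "'a set" and m :: "'a \<Rightarrow>\<^sub>0 nat"
    using that by (induction A) (simp_all add: pow mult_single flip: to_fract_mult)
  have eq: "(\<Sum>i\<in>UNIV. Poly_Mapping.single i (Poly_Mapping.lookup m i)) = m" for m :: "'a \<Rightarrow>\<^sub>0 nat"
    by (rule poly_mapping_eqI) (simp add: lookup_sum lookup_single when_def)
  have "to_fract p = (\<Sum>m\<in>Poly_Mapping.keys p. to_fract (Poly_Mapping.single m (Poly_Mapping.lookup p m)))"
    by (metis poly_mapping_eq_sum_single to_fract_sum)
  also have "\<dots> = poly_at rf_var p"
    unfolding poly_at_def
    by (intro sum.cong refl) (simp add: mon eq rf_const_def mult_single flip: to_fract_mult)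
  finally show ?thesis .
qed

text \<open>The field is generated by the constants and the variables.\<close>

lemma substitution_hom_eqI:
  assumes h: "substitution_hom h" and g: "substitution_hom g"
    and eq: "\<And>i. h (rf_var i) = g (rf_var i)"
  shows "h f = g f"
proof -
  have "h (to_fract p) = g (to_fract p)" for p
    by (simp add: to_fract_eq_poly_at poly_at_def hom_simps[OF h] hom_simps[OF g] eq)
  then show ?thesis
    by (cases f) (simp add: Fract_conv_to_fract hom_divide[OF h] hom_divide[OF g])
qed

lemma substitution_hom_comp:
  "substitution_hom h \<Longrightarrow> substitution_hom g \<Longrightarrow> substitution_hom (\<lambda>f. h (g f))"
  by (simp add: substitution_hom_def)

lemma substitution_hom_id: "substitution_hom (\<lambda>f. f)"
  by (simp add: substitution_hom_def)

lemma to_fract_single: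
  fixes m :: "'n::{finite,linorder} \<Rightarrow>\<^sub>0 nat"
  shows "to_fract (Poly_Mapping.single m c) = rf_const c * (\<Prod>i\<in>UNIV. rf_var i ^ Poly_Mapping.lookup m i)"
  by (simp add: to_fract_eq_poly_at poly_at_single)

text \<open>After clearing denominators this is the uniqueness of the coefficients of a polynomial.\<close>

lemma laurent_monomials_independent:
  fixes c :: "('n::{finite,linorder} \<Rightarrow> int) \<Rightarrow> complex"
  assumes "finite K" and "(\<Sum>k\<in>K. rf_const (c k) * (\<Prod>i\<in>UNIV. rf_var i powi k i)) = 0" and "k \<in> K"
  shows "c k = 0"
proof -
  define M where "M = Max ((\<lambda>(k, i). \<bar>k i\<bar>) ` (K \<times> UNIV))"
  have M: "0 \<le> k i + M" if "k \<in> K" for k i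
  proof -
    have "\<bar>k i\<bar> \<le> M"
      unfolding M_def by (rule Max_ge) (use assms(1) that in auto)
    then show ?thesis by linarith
  qed
  define m where "m k = Abs_poly_mapping (\<lambda>i. nat (k i + M))" for k :: "'n \<Rightarrow> int"
  have m: "Poly_Mapping.lookup (m k) i = nat (k i + M)" for k i
    by (simp add: m_def)
  have inj: "inj_on m K"
  proof (rule inj_onI)
    fix k k' assume "k \<in> K" "k' \<in> K" "m k = m k'"
    then have "nat (k i + M) = nat (k' i + M)" for i
      by (metis m)
    with M \<open>k \<in> K\<close> \<open>k' \<in> K\<close> have "k i = k' i" for i
      by (smt (verit) nat_eq_iff2)
    then show "k = k'" by auto
  qed
  have "to_fract (\<Sum>k\<in>K. Poly_Mapping.single (m k) (c k))
      = (\<Sum>k\<in>K. rf_const (c k) * (\<Prod>i\<in>UNIV. rf_var i powi (k i + M)))"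
    by (simp add: to_fract_single m power_int_def M)
  also have "\<dots> = (\<Sum>k\<in>K. rf_const (c k) * (\<Prod>i\<in>UNIV. rf_var i powi k i)) * (\<Prod>i::'n\<in>UNIV. rf_var i powi M)"
    by (simp add: sum_distrib_right power_int_add prod.distrib mult.assoc)
  finally have "(\<Sum>k\<in>K. Poly_Mapping.single (m k) (c k)) = 0"
    using assms(2) by (simp del: to_fract_sum)
  then have "Poly_Mapping.lookup (\<Sum>k\<in>K. Poly_Mapping.single (m k) (c k)) (m k) = 0"
    by simp
  moreover have "Poly_Mapping.lookup (\<Sum>k\<in>K. Poly_Mapping.single (m k) (c k)) (m k) = (\<Sum>k'\<in>K. if k' = k then c k' else 0)"
    unfolding lookup_sum
    by (rule sum.cong) (use inj assms(3) in \<open>auto simp: lookup_single when_def inj_on_eq_iff\<close>)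
  ultimately show ?thesis
    using assms(1,3) by simp
qed

section \<open>Simply-laced root systems\<close>

locale simply_laced_base =
  fixes \<Phi> :: "'a::euclidean_space set" and \<alpha> :: "'n::{finite,linorder} \<Rightarrow> 'a"
  assumes reduced: "reduced_root_system \<Phi>"
    and laced: "simply_laced \<Phi>"
    and norm_2: "\<forall>\<beta>\<in>\<Phi>. \<beta> \<bullet> \<beta> = 2"
    and base: "simple_root_base \<Phi> \<alpha>"
begin

abbreviation "\<s> i \<equiv> root_reflection (\<alpha> i)"
abbreviation "\<Lambda> \<equiv> root_lattice \<alpha>"
abbreviation "P \<equiv> positive_roots \<Phi> \<alpha>"

lemma simple_root [simp]: "\<alpha> i \<in> \<Phi>"
  using base by (auto simp: simple_root_base_def)

lemma inj_simple: "inj \<alpha>" and indep_simple: "independent (range \<alpha>)"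
  using base by (auto simp: simple_root_base_def)

lemma simple_norm [simp]: "\<alpha> i \<bullet> \<alpha> i = 2"
  using norm_2 by simp

lemma finite_roots: "finite \<Phi>" and zero_not_root: "0 \<notin> \<Phi>"
  using reduced by (auto simp: reduced_root_system_def root_system_def)

lemma finite_positive [simp]: "finite P"
  using finite_roots by (auto simp: positive_roots_def)

lemma reflection_root: "\<beta> \<in> \<Phi> \<Longrightarrow> root_reflection \<beta> v = v - (v \<bullet> \<beta>) *\<^sub>R \<beta>"
  using norm_2 by (simp add: root_reflection_def)

lemma reflection_root_closed: "\<beta> \<in> \<Phi> \<Longrightarrow> \<gamma> \<in> \<Phi> \<Longrightarrow> root_reflection \<beta> \<gamma> \<in> \<Phi>"
  using reduced by (auto simp: reduced_root_system_def root_system_def)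

lemma s_eq: "\<s> i v = v - (v \<bullet> \<alpha> i) *\<^sub>R \<alpha> i"
  by (simp add: reflection_root)

lemma uminus_root: "\<beta> \<in> \<Phi> \<Longrightarrow> - \<beta> \<in> \<Phi>"
  using reflection_root_closed[of \<beta> \<beta>] reflection_root[of \<beta> \<beta>] norm_2
  by (simp add: scaleR_2)

lemma s_simps [simp]:
  "\<s> i (u + v) = \<s> i u + \<s> i v"
  "\<s> i (u - v) = \<s> i u - \<s> i v"
  "\<s> i (- u) = - \<s> i u"
  "\<s> i (c *\<^sub>R u) = c *\<^sub>R \<s> i u"
  "\<s> i 0 = 0"
  "\<s> i (\<alpha> i) = - \<alpha> i"
  "\<s> i (\<s> i u) = u"
  by (simp_all add: s_eq algebra_simps flip: scaleR_2)

lemma s_isometry: "\<s> i u \<bullet> \<s> i v = u \<bullet> v"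
  by (simp add: s_eq inner_commute algebra_simps)

lemma s_inner: "\<s> i u \<bullet> v = u \<bullet> \<s> i v"
  by (metis s_isometry s_simps(7))

lemma s_root [simp]: "\<s> i \<beta> \<in> \<Phi> \<longleftrightarrow> \<beta> \<in> \<Phi>"
  by (metis reflection_root_closed s_simps(7) simple_root)

section \<open>Coordinates with respect to the simple roots\<close>

lemma simple_combination_unique:
  assumes "(\<Sum>i\<in>UNIV. c i *\<^sub>R \<alpha> i) = (\<Sum>i\<in>UNIV. d i *\<^sub>R \<alpha> i)"
  shows "c = d"
proof
  fix i
  define e where "e v = c (inv \<alpha> v) - d (inv \<alpha> v)" for v
  have "(\<Sum>v\<in>range \<alpha>. e v *\<^sub>R v) = (\<Sum>i\<in>UNIV. (c i - d i) *\<^sub>R \<alpha> i)"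
    by (subst sum.reindex[OF inj_simple]) (simp add: e_def inj_simple)
  also have "\<dots> = 0"
    using assms by (simp add: scaleR_diff_left sum_subtractf)
  finally have "(\<Sum>v\<in>range \<alpha>. e v *\<^sub>R v) = 0" .
  moreover have "finite (range \<alpha>)" by simp
  ultimately have "e (\<alpha> i) = 0"
    using indep_simple independent_explicit_finite_subsets[of "range \<alpha>"] by blast
  then show "c i = d i"
    by (simp add: e_def inj_simple)
qed

lemma root_coords_eqI:
  assumes "\<mu> = (\<Sum>i\<in>UNIV. real_of_int (k i) *\<^sub>R \<alpha> i)"
  shows "root_coords \<alpha> \<mu> = k"
  unfolding root_coords_def
proof (rule the_equality[of _ k])
  fix k' assume "\<mu> = (\<Sum>i\<in>UNIV. real_of_int (k' i) *\<^sub>R \<alpha> i)"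
  with assms have "(\<lambda>i. real_of_int (k' i)) = (\<lambda>i. real_of_int (k i))"
    by (intro simple_combination_unique) simp
  then show "k' = k"
    by (simp add: fun_eq_iff)
qed (fact assms)

lemma lattice_expansion:
  assumes "\<mu> \<in> \<Lambda>"
  shows "\<mu> = (\<Sum>i\<in>UNIV. real_of_int (root_coords \<alpha> \<mu> i) *\<^sub>R \<alpha> i)"
  using assms root_coords_eqI by (auto simp: root_lattice_def)

lemma lattice_combination [simp]: "(\<Sum>i\<in>UNIV. real_of_int (k i) *\<^sub>R \<alpha> i) \<in> \<Lambda>"
  by (auto simp: root_lattice_def)

lemma
  assumes "\<mu> \<in> \<Lambda>" "\<nu> \<in> \<Lambda>" shows lattice_add [intro]: "\<mu> + \<nu> \<in> \<Lambda>"
    and root_coords_add: "root_coords \<alpha> (\<mu> + \<nu>) i = root_coords \<alpha> \<mu> i + root_coords \<alpha> \<nu> i"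
proof -
  have *: "\<mu> + \<nu> = (\<Sum>i\<in>UNIV. real_of_int (root_coords \<alpha> \<mu> i + root_coords \<alpha> \<nu> i) *\<^sub>R \<alpha> i)"
    using lattice_expansion[OF assms(1)] lattice_expansion[OF assms(2)]
    by (simp add: scaleR_add_left sum.distrib)
  show "\<mu> + \<nu> \<in> \<Lambda>"
    by (subst *) (rule lattice_combination)
  show "root_coords \<alpha> (\<mu> + \<nu>) i = root_coords \<alpha> \<mu> i + root_coords \<alpha> \<nu> i"
    using root_coords_eqI[OF *] by simp
qed

lemma
  assumes "\<mu> \<in> \<Lambda>" shows lattice_scale: "real_of_int c *\<^sub>R \<mu> \<in> \<Lambda>"
    and root_coords_scale: "root_coords \<alpha> (real_of_int c *\<^sub>R \<mu>) i = c * root_coords \<alpha> \<mu> i"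
proof -
  have *: "real_of_int c *\<^sub>R \<mu> = (\<Sum>i\<in>UNIV. real_of_int (c * root_coords \<alpha> \<mu> i) *\<^sub>R \<alpha> i)"
    by (subst lattice_expansion[OF assms]) (simp add: scaleR_right.sum)
  show "real_of_int c *\<^sub>R \<mu> \<in> \<Lambda>"
    by (subst *) (rule lattice_combination)
  show "root_coords \<alpha> (real_of_int c *\<^sub>R \<mu>) i = c * root_coords \<alpha> \<mu> i"
    using root_coords_eqI[OF *] by simp
qed

lemma root_coords_0 [simp]: "root_coords \<alpha> 0 = (\<lambda>_. 0)"
  by (rule root_coords_eqI) simp

lemma root_coords_simple: "root_coords \<alpha> (\<alpha> i) = (\<lambda>j. if j = i then 1 else 0)"
  by (rule root_coords_eqI) (simp add: if_distrib[of real_of_int] if_distrib[of "\<lambda>c. c *\<^sub>R _"] cong: if_cong)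

lemma zero_lattice [simp]: "0 \<in> \<Lambda>"
  using lattice_combination[of "\<lambda>_. 0"] by simp

lemma simple_lattice [simp]: "\<alpha> i \<in> \<Lambda>"
  using lattice_combination[of "\<lambda>j. if j = i then 1 else 0"]
  by (simp add: if_distrib[of real_of_int] if_distrib[of "\<lambda>c. c *\<^sub>R _"] cong: if_cong)

lemma lattice_uminus: "\<mu> \<in> \<Lambda> \<Longrightarrow> - \<mu> \<in> \<Lambda>"
  using lattice_scale[of \<mu> "-1"] by simp

lemma lattice_diff: "\<mu> \<in> \<Lambda> \<Longrightarrow> \<nu> \<in> \<Lambda> \<Longrightarrow> \<mu> - \<nu> \<in> \<Lambda>"
  using lattice_add[of \<mu> "- \<nu>"] lattice_uminus[of \<nu>] by simp

lemma lattice_scale2: "\<mu> \<in> \<Lambda> \<Longrightarrow> 2 *\<^sub>R \<mu> \<in> \<Lambda>"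
  using lattice_scale[of \<mu> 2] by simp

lemma lattice_sum: "(\<And>x. x \<in> A \<Longrightarrow> F x \<in> \<Lambda>) \<Longrightarrow> sum F A \<in> \<Lambda>"
  by (induction A rule: infinite_finite_induct) auto

lemma root_lattice: "\<beta> \<in> \<Phi> \<Longrightarrow> \<beta> \<in> \<Lambda>"
proof -
  assume "\<beta> \<in> \<Phi>"
  then obtain k :: "'n \<Rightarrow> nat" where
    "\<beta> = (\<Sum>i\<in>UNIV. real (k i) *\<^sub>R \<alpha> i) \<or> \<beta> = - (\<Sum>i\<in>UNIV. real (k i) *\<^sub>R \<alpha> i)"
    using base unfolding simple_root_base_def by blast
  moreover have "(\<Sum>i\<in>UNIV. real (k i) *\<^sub>R \<alpha> i) \<in> \<Lambda>"
    using lattice_combination[of "\<lambda>i. int (k i)"] by simp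
  ultimately show ?thesis
    using lattice_uminus by blast
qed

lemma root_inner_int: "\<beta> \<in> \<Phi> \<Longrightarrow> \<gamma> \<in> \<Phi> \<Longrightarrow> \<beta> \<bullet> \<gamma> \<in> \<int>"
proof -
  assume "\<beta> \<in> \<Phi>" "\<gamma> \<in> \<Phi>"
  then have "2 * (\<beta> \<bullet> \<gamma>) / (\<gamma> \<bullet> \<gamma>) \<in> \<int>"
    using reduced by (auto simp: reduced_root_system_def root_system_def)
  with norm_2 \<open>\<gamma> \<in> \<Phi>\<close> show ?thesis by simp
qed

lemma lattice_inner_int: "\<mu> \<in> \<Lambda> \<Longrightarrow> \<mu> \<bullet> \<alpha> i \<in> \<int>"
  by (subst lattice_expansion) (auto simp: inner_sum_left intro!: Ints_mult root_inner_int)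

lemma s_lattice [simp]: "\<s> i \<mu> \<in> \<Lambda> \<longleftrightarrow> \<mu> \<in> \<Lambda>"
proof -
  have "\<s> i \<mu> \<in> \<Lambda>" if \<mu>: "\<mu> \<in> \<Lambda>" for \<mu>
  proof -
    obtain c where "\<mu> \<bullet> \<alpha> i = real_of_int c"
      using lattice_inner_int[OF \<mu>] by (auto elim: Ints_cases)
    then show ?thesis
      using lattice_diff[OF \<mu> lattice_scale[of "\<alpha> i" c]] by (simp add: s_eq)
  qed
  then show ?thesis
    by (metis s_simps(7))
qed

lemma eq_0_if_inner_simple_0:
  assumes "\<And>i. v \<bullet> \<alpha> i = 0"
  shows "v = 0"
proof -
  have "v \<bullet> u = 0" if "u \<in> \<Lambda>" for u
    by (subst lattice_expansion[OF that]) (simp add: inner_sum_right assms)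
  then have "v \<bullet> u = 0" if "u \<in> \<Phi>" for u
    using that root_lattice by blast
  moreover have "v \<in> span \<Phi>"
    using reduced by (auto simp: reduced_root_system_def root_system_def)
  ultimately have "v \<bullet> v = 0"
    using orthogonal_to_span[of v \<Phi> v] by (simp add: orthogonal_def)
  then show ?thesis by simp
qed

section \<open>Positive roots\<close>

lemma simple_positive [simp]: "\<alpha> i \<in> P"
proof -
  have "\<alpha> i = (\<Sum>j\<in>UNIV. real (if j = i then 1 else 0) *\<^sub>R \<alpha> j)"
    by (simp add: if_distrib[of real] if_distrib[of "\<lambda>c. c *\<^sub>R _"] cong: if_cong)
  then show ?thesis
    unfolding positive_roots_def using simple_root[of i]
    by (intro CollectI conjI exI[of _ "\<lambda>j. if j = i then 1 else 0"])
qed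

lemma positive_root_iff: "\<beta> \<in> P \<longleftrightarrow> \<beta> \<in> \<Phi> \<and> (\<forall>i. 0 \<le> root_coords \<alpha> \<beta> i)"
proof safe
  assume "\<beta> \<in> P"
  then obtain k :: "'n \<Rightarrow> nat" where "\<beta> \<in> \<Phi>" "\<beta> = (\<Sum>i\<in>UNIV. real (k i) *\<^sub>R \<alpha> i)"
    by (auto simp: positive_roots_def)
  moreover from this have "root_coords \<alpha> \<beta> = (\<lambda>i. int (k i))"
    by (intro root_coords_eqI) simp
  ultimately show "\<beta> \<in> \<Phi>" "0 \<le> root_coords \<alpha> \<beta> i" for i by auto
next
  assume "\<beta> \<in> \<Phi>" and pos: "\<forall>i. 0 \<le> root_coords \<alpha> \<beta> i"
  then have "\<beta> = (\<Sum>i\<in>UNIV. real (nat (root_coords \<alpha> \<beta> i)) *\<^sub>R \<alpha> i)"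
    using lattice_expansion[OF root_lattice, of \<beta>] by simp
  with \<open>\<beta> \<in> \<Phi>\<close> show "\<beta> \<in> P"
    unfolding positive_roots_def by (auto intro: exI[of _ "\<lambda>i. nat (root_coords \<alpha> \<beta> i)"])
qed

lemma positive_root: "\<beta> \<in> P \<Longrightarrow> \<beta> \<in> \<Phi>"
  by (simp add: positive_root_iff)

lemma root_positive_or_negative: "\<beta> \<in> \<Phi> \<Longrightarrow> \<beta> \<in> P \<or> - \<beta> \<in> P"
proof -
  assume "\<beta> \<in> \<Phi>"
  then obtain k :: "'n \<Rightarrow> nat" where
    "\<beta> = (\<Sum>i\<in>UNIV. real (k i) *\<^sub>R \<alpha> i) \<or> - \<beta> = (\<Sum>i\<in>UNIV. real (k i) *\<^sub>R \<alpha> i)"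
    using base unfolding simple_root_base_def by (metis minus_minus)
  with \<open>\<beta> \<in> \<Phi>\<close> uminus_root show ?thesis
    unfolding positive_roots_def by blast
qed

lemma root_coords_uminus: "\<mu> \<in> \<Lambda> \<Longrightarrow> root_coords \<alpha> (- \<mu>) i = - root_coords \<alpha> \<mu> i"
  using root_coords_scale[of \<mu> "-1" i] by simp

lemma not_positive_and_negative: "\<beta> \<in> P \<Longrightarrow> - \<beta> \<notin> P"
proof
  assume "\<beta> \<in> P" "- \<beta> \<in> P"
  then have "root_coords \<alpha> \<beta> i = 0" for i
    using root_coords_uminus[of \<beta> i] root_lattice
    by (metis neg_0_le_iff_le order.antisym positive_root_iff)
  then have "\<beta> = 0"
    using lattice_expansion[OF root_lattice[OF positive_root[OF \<open>\<beta> \<in> P\<close>]]] by simp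
  with \<open>\<beta> \<in> P\<close> zero_not_root show False
    by (simp add: positive_root_iff)
qed

lemma negative_root_iff: "\<beta> \<in> negative_roots \<Phi> \<alpha> \<longleftrightarrow> - \<beta> \<in> P"
  unfolding negative_roots_def by (metis (no_types) image_iff minus_minus)

text \<open>A positive root other than \<open>\<alpha>\<^sub>i\<close> involves another simple root, and the coordinate at
  that simple root does not change under the reflection.\<close>

lemma s_positive:
  assumes "\<beta> \<in> P" "\<beta> \<noteq> \<alpha> i"
  shows "\<s> i \<beta> \<in> P"
proof -
  have \<beta>: "\<beta> \<in> \<Phi>" "\<beta> \<in> \<Lambda>"
    using assms root_lattice positive_root by auto
  have "\<exists>j. j \<noteq> i \<and> root_coords \<alpha> \<beta> j \<noteq> 0"
  proof (rule ccontr)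
    assume "\<not> ?thesis"
    then have "\<beta> = (\<Sum>j\<in>UNIV. if j = i then real_of_int (root_coords \<alpha> \<beta> i) *\<^sub>R \<alpha> i else 0)"
      by (subst lattice_expansion[OF \<beta>(2)]) (rule sum.cong, auto)
    then have "\<beta> = real_of_int (root_coords \<alpha> \<beta> i) *\<^sub>R \<alpha> i"
      by simp
    moreover from this have "real_of_int (root_coords \<alpha> \<beta> i) \<in> {1, -1}"
      using reduced \<beta>(1) unfolding reduced_root_system_def
      by (metis insertCI simple_root)
    ultimately have "\<beta> = \<alpha> i \<or> \<beta> = - \<alpha> i"
      by auto
    then show False
      using assms not_positive_and_negative[of "\<alpha> i"] by auto
  qed
  then obtain j where j: "j \<noteq> i" "root_coords \<alpha> \<beta> j \<noteq> 0" by blast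
  obtain c where c: "\<beta> \<bullet> \<alpha> i = real_of_int c"
    using lattice_inner_int[OF \<beta>(2)] by (auto elim: Ints_cases)
  have s: "\<s> i \<beta> = \<beta> + real_of_int (- c) *\<^sub>R \<alpha> i"
    by (simp add: s_eq c)
  have "root_coords \<alpha> (\<s> i \<beta>) j = root_coords \<alpha> \<beta> j"
    unfolding s using j \<beta> by (subst root_coords_add)
      (auto simp: root_coords_scale root_coords_simple lattice_scale simp del: of_int_minus)
  moreover have "0 < root_coords \<alpha> \<beta> j"
    using assms(1) j(2) by (auto simp: positive_root_iff less_le)
  ultimately have "- \<s> i \<beta> \<notin> P"
    using \<beta> by (auto simp: positive_root_iff root_coords_uminus intro!: exI[of _ j])
  then show ?thesis
    using root_positive_or_negative[of "\<s> i \<beta>"] \<beta> by auto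
qed

lemma s_permutes_positive: "bij_betw (\<s> i) (P - {\<alpha> i}) (P - {\<alpha> i})"
proof -
  have "\<s> i \<beta> \<in> P - {\<alpha> i}" if "\<beta> \<in> P - {\<alpha> i}" for \<beta>
  proof -
    have "\<s> i \<beta> \<noteq> \<alpha> i"
    proof
      assume "\<s> i \<beta> = \<alpha> i"
      then have "\<beta> = - \<alpha> i" by (metis s_simps(6,7))
      with that show False
        using not_positive_and_negative[of "\<alpha> i"] by auto
    qed
    with that s_positive show ?thesis by auto
  qed
  then show ?thesis
    by (intro bij_betw_byWitness[of _ "\<s> i"]) auto
qed

lemma nonadjacent_inner: "i \<noteq> j \<Longrightarrow> \<not> adjacent \<alpha> i j \<Longrightarrow> \<alpha> i \<bullet> \<alpha> j = 0"
  by (simp add: adjacent_def)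

text \<open>If the inner product were \<open>1\<close>, the root \<open>\<sigma>\<^sub>i \<alpha>\<^sub>j = \<alpha>\<^sub>j - \<alpha>\<^sub>i\<close> would have coordinates of both signs.\<close>

lemma adjacent_inner:
  assumes "adjacent \<alpha> i j"
  shows "\<alpha> i \<bullet> \<alpha> j = -1"
proof -
  have ij: "i \<noteq> j" "\<alpha> i \<bullet> \<alpha> j \<noteq> 0"
    using assms by (auto simp: adjacent_def)
  then have ne: "\<alpha> j \<noteq> \<alpha> i"
    using inj_simple by (auto dest: injD)
  then have "\<alpha> j \<noteq> - \<alpha> i"
    using not_positive_and_negative[of "\<alpha> i"] by (metis simple_positive)
  with ne laced ij have "\<alpha> i \<bullet> \<alpha> j \<in> {-1, 1}"
    using simple_root[of i] simple_root[of j] unfolding simply_laced_def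
    by (force simp: inner_commute)
  moreover have "\<alpha> i \<bullet> \<alpha> j \<noteq> 1"
  proof
    assume 1: "\<alpha> i \<bullet> \<alpha> j = 1"
    have "\<s> i (\<alpha> j) = \<alpha> j + (- \<alpha> i)"
      by (simp add: s_eq 1 inner_commute[of "\<alpha> j"])
    moreover have "root_coords \<alpha> (\<alpha> j + (- \<alpha> i)) i = -1"
      using ij by (subst root_coords_add) (auto simp: root_coords_uminus root_coords_simple lattice_uminus)
    moreover have "\<s> i (\<alpha> j) \<in> P"
      by (rule s_positive) (use ne in auto)
    ultimately show False
      by (auto simp: positive_root_iff dest!: spec[of _ i])
  qed
  ultimately show ?thesis by auto
qed

lemma adjacent_sym: "adjacent \<alpha> i j \<longleftrightarrow> adjacent \<alpha> j i"
  by (auto simp: adjacent_def inner_commute)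

section \<open>Words in the simple reflections\<close>

definition word_prod :: "'n list \<Rightarrow> 'a \<Rightarrow> 'a" where
  "word_prod is = foldr (\<lambda>i u. \<s> i \<circ> u) is id"

lemma word_prod_Nil [simp]: "word_prod [] = id"
  and word_prod_Cons: "word_prod (i # is) = \<s> i \<circ> word_prod is"
  by (simp_all add: word_prod_def)

lemma word_prod_append: "word_prod (is @ js) = word_prod is \<circ> word_prod js"
  by (induction "is") (simp_all add: word_prod_Cons comp_assoc)

lemma word_prod_snoc: "word_prod (is @ [i]) = word_prod is \<circ> \<s> i"
  by (simp add: word_prod_append word_prod_Cons)

lemma word_prod_linear [simp]:
  "word_prod is (u + v) = word_prod is u + word_prod is v"
  "word_prod is (u - v) = word_prod is u - word_prod is v"
  "word_prod is (- u) = - word_prod is u"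
  "word_prod is (c *\<^sub>R u) = c *\<^sub>R word_prod is u"
  by (induction "is") (simp_all add: word_prod_Cons)

lemma word_prod_isometry: "word_prod is u \<bullet> word_prod is v = u \<bullet> v"
  by (induction "is") (simp_all add: word_prod_Cons s_isometry)

lemma word_prod_rev [simp]: "word_prod (rev is) (word_prod is v) = v" "word_prod is (word_prod (rev is) v) = v"
proof -
  have "word_prod (rev is) (word_prod is v) = v" for "is" v
    by (induction "is") (simp_all add: word_prod_Cons word_prod_snoc)
  from this[of "is"] this[of "rev is"]
  show "word_prod (rev is) (word_prod is v) = v" "word_prod is (word_prod (rev is) v) = v"
    by simp_all
qed

lemma word_prod_inner: "word_prod is u \<bullet> v = u \<bullet> word_prod (rev is) v"
  by (metis word_prod_isometry word_prod_rev(2))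

lemma inv_word_prod: "inv (word_prod is) = word_prod (rev is)"
  by (rule inv_unique_comp) (auto simp: fun_eq_iff)

lemma word_prod_root [simp]: "word_prod is \<beta> \<in> \<Phi> \<longleftrightarrow> \<beta> \<in> \<Phi>"
  by (induction "is") (simp_all add: word_prod_Cons)

lemma word_prod_lattice [simp]: "word_prod is \<mu> \<in> \<Lambda> \<longleftrightarrow> \<mu> \<in> \<Lambda>"
  by (induction "is") (simp_all add: word_prod_Cons)

lemma word_prod_weyl: "word_prod is \<in> weyl_group \<Phi>"
  by (induction "is") (simp_all add: word_prod_Cons weyl_group.intros del: comp_apply id_apply)

lemma word_prod_s_commute: "word_prod is (\<alpha> i) = \<alpha> j \<Longrightarrow> word_prod is \<circ> \<s> i = \<s> j \<circ> word_prod is"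
  by (rule ext) (metis comp_apply word_prod_isometry word_prod_linear(2,4) s_eq)

lemma reflection_conjugate: "\<beta> \<in> \<Phi> \<Longrightarrow> root_reflection (\<s> i \<beta>) = \<s> i \<circ> root_reflection \<beta> \<circ> \<s> i"
proof
  fix v assume "\<beta> \<in> \<Phi>"
  then have "root_reflection (\<s> i \<beta>) v = v - (v \<bullet> \<s> i \<beta>) *\<^sub>R \<s> i \<beta>"
    by (intro reflection_root) simp
  also have "\<dots> = \<s> i (\<s> i v - (\<s> i v \<bullet> \<beta>) *\<^sub>R \<beta>)"
    by (simp only: s_simps s_inner)
  finally show "root_reflection (\<s> i \<beta>) v = (\<s> i \<circ> root_reflection \<beta> \<circ> \<s> i) v"
    using \<open>\<beta> \<in> \<Phi>\<close> by (simp add: reflection_root[of \<beta>])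
qed

lemma root_reflection_uminus: "root_reflection (- \<beta>) = root_reflection \<beta>"
  by (rule ext) (simp add: root_reflection_def)

lemma root_height_s:
  assumes "\<mu> \<in> \<Lambda>"
  shows "real_of_int (root_height \<alpha> (\<s> i \<mu>)) = real_of_int (root_height \<alpha> \<mu>) - \<mu> \<bullet> \<alpha> i"
proof -
  obtain c where c: "\<mu> \<bullet> \<alpha> i = real_of_int c"
    using lattice_inner_int[OF assms] by (auto elim: Ints_cases)
  have "\<s> i \<mu> = \<mu> + real_of_int (- c) *\<^sub>R \<alpha> i"
    by (simp add: s_eq c)
  moreover have "real_of_int (- c) *\<^sub>R \<alpha> i \<in> \<Lambda>"
    by (rule lattice_scale) simp
  ultimately have "root_coords \<alpha> (\<s> i \<mu>) j = root_coords \<alpha> \<mu> j + (if j = i then - c else 0)" for j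
    using assms root_coords_scale[OF simple_lattice[of i], of "- c" j]
      root_coords_add[of \<mu> "real_of_int (- c) *\<^sub>R \<alpha> i" j]
    by (simp add: root_coords_simple)
  then show ?thesis
    by (simp add: root_height_def sum.distrib c)
qed

text \<open>A positive root has positive inner product with some simple root, and reflecting in that
  simple root lowers its height; so every reflection is conjugate to a simple one.\<close>

lemma positive_reflection_word_prod: "\<beta> \<in> P \<Longrightarrow> \<exists>is. root_reflection \<beta> = word_prod is"
proof (induction "nat (root_height \<alpha> \<beta>)" arbitrary: \<beta> rule: less_induct)
  case less
  show ?case
  proof (cases "\<beta> \<in> range \<alpha>")
    case True
    then obtain i where "\<beta> = \<alpha> i" by auto
    then have "root_reflection \<beta> = word_prod [i]"
      by (simp add: word_prod_Cons)
    then show ?thesis by blast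
  next
    case False
    have \<beta>: "\<beta> \<in> \<Phi>" "\<beta> \<in> \<Lambda>" and pos: "\<And>i. 0 \<le> root_coords \<alpha> \<beta> i"
      using less.prems root_lattice by (auto simp: positive_root_iff)
    have "\<exists>i. 0 < \<beta> \<bullet> \<alpha> i"
    proof (rule ccontr)
      assume "\<not> ?thesis"
      then have "(\<Sum>i\<in>UNIV. real_of_int (root_coords \<alpha> \<beta> i) * (\<beta> \<bullet> \<alpha> i)) \<le> 0"
        using pos by (intro sum_nonpos) (simp add: mult_nonneg_nonpos not_less)
      also have "(\<Sum>i\<in>UNIV. real_of_int (root_coords \<alpha> \<beta> i) * (\<beta> \<bullet> \<alpha> i))
          = \<beta> \<bullet> (\<Sum>i\<in>UNIV. real_of_int (root_coords \<alpha> \<beta> i) *\<^sub>R \<alpha> i)"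
        by (simp add: inner_sum_right)
      also have "\<dots> = \<beta> \<bullet> \<beta>"
        using lattice_expansion[OF \<beta>(2)] by simp
      finally show False
        using norm_2 \<beta> by simp
    qed
    then obtain i where i: "0 < \<beta> \<bullet> \<alpha> i" by blast
    have s: "\<s> i \<beta> \<in> P"
      using s_positive less.prems False by blast
    have "0 \<le> root_height \<alpha> (\<s> i \<beta>)" "0 \<le> root_height \<alpha> \<beta>"
      using s less.prems by (auto simp: root_height_def positive_root_iff intro: sum_nonneg)
    then have "nat (root_height \<alpha> (\<s> i \<beta>)) < nat (root_height \<alpha> \<beta>)"
      using root_height_s[OF \<beta>(2), of i] i by linarith
    from less.hyps[OF this s] obtain "is" where "root_reflection (\<s> i \<beta>) = word_prod is"
      by blast
    then have "root_reflection \<beta> = word_prod (i # is @ [i])"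
      using reflection_conjugate[of "\<s> i \<beta>" i] \<beta> by (simp add: word_prod_Cons word_prod_snoc comp_assoc)
    then show ?thesis by blast
  qed
qed

lemma weyl_group_eq_words: "weyl_group \<Phi> = range word_prod"
proof safe
  fix w assume "w \<in> weyl_group \<Phi>"
  then show "w \<in> range word_prod"
  proof induction
    case 1
    show ?case by (metis word_prod_Nil rangeI)
  next
    case (2 \<beta> w)
    then obtain "is" where "w = word_prod is" by auto
    moreover obtain js where "root_reflection \<beta> = word_prod js"
      using positive_reflection_word_prod root_positive_or_negative[OF 2(1)]
      by (metis root_reflection_uminus)
    ultimately have "root_reflection \<beta> \<circ> w = word_prod (js @ is)"
      by (simp add: word_prod_append)
    then show ?case by blast
  qed
qed (rule word_prod_weyl)

lemma word_prod_word_of: "w \<in> weyl_group \<Phi> \<Longrightarrow> word_prod (word_of \<alpha> w) = w"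
proof -
  assume "w \<in> weyl_group \<Phi>"
  then have "\<exists>is. word_prod is = w"
    by (auto simp: weyl_group_eq_words)
  then show ?thesis
    unfolding word_of_def word_prod_def by (rule someI_ex)
qed

lemma positive_add: "\<beta> \<in> P \<Longrightarrow> \<gamma> \<in> P \<Longrightarrow> \<beta> + \<gamma> \<in> \<Phi> \<Longrightarrow> \<beta> + \<gamma> \<in> P"
  using root_lattice by (simp add: positive_root_iff root_coords_add)

lemma not_positive_iff: "\<beta> \<in> \<Phi> \<Longrightarrow> \<beta> \<notin> P \<longleftrightarrow> - \<beta> \<in> P"
  using not_positive_and_negative root_positive_or_negative by blast

section \<open>Reduced words\<close>

text \<open>Applying the letters of the word to \<open>\<alpha>\<^sub>i\<close> from the right, some letter \<open>\<sigma>\<^sub>j\<close> makes a positive root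
  negative. That root is \<open>\<alpha>\<^sub>j\<close>, and commuting \<open>\<sigma>\<^sub>i\<close> past the letters to the right of \<open>\<sigma>\<^sub>j\<close> turns it into
  \<open>\<sigma>\<^sub>j\<close>, so this letter can be deleted.\<close>

lemma exchange:
  assumes "word_prod is (\<alpha> i) \<notin> P"
  shows "\<exists>js. Suc (length js) = length is \<and> word_prod js = word_prod is \<circ> \<s> i"
  using assms
proof (induction "is")
  case (Cons j "is")
  show ?case
  proof (cases "word_prod is (\<alpha> i) \<in> P")
    case True
    with Cons.prems have "word_prod is (\<alpha> i) = \<alpha> j"
      using s_positive by (auto simp: word_prod_Cons)
    then have "word_prod (j # is) \<circ> \<s> i = word_prod is"
      using word_prod_s_commute[of "is" i j] by (simp add: word_prod_Cons fun_eq_iff)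
    then show ?thesis
      by (intro exI[of _ "is"]) simp
  next
    case False
    from Cons.IH[OF this] obtain js where "Suc (length js) = length is" "word_prod js = word_prod is \<circ> \<s> i"
      by blast
    then show ?thesis
      by (intro exI[of _ "j # js"]) (simp add: word_prod_Cons comp_assoc)
  qed
qed simp

text \<open>Each letter of the word increases the number of inversions, which characterises the words of
  minimal length without counting inversions.\<close>

definition reduced_word :: "'n list \<Rightarrow> bool" where
  "reduced_word is \<longleftrightarrow> (\<forall>k<length is. word_prod (take k is) (\<alpha> (is ! k)) \<in> P)"

lemma reduced_word_Nil [simp]: "reduced_word []"
  by (simp add: reduced_word_def)

lemma reduced_word_snoc: "reduced_word (is @ [i]) \<longleftrightarrow> reduced_word is \<and> word_prod is (\<alpha> i) \<in> P"
  by (auto simp: reduced_word_def nth_append less_Suc_eq)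

text \<open>A word of minimal length is reduced, because the exchange property shortens any other word.\<close>

lemma obtain_reduced_word:
  obtains js where "reduced_word js" "word_prod js = word_prod is"
proof -
  obtain js where js: "word_prod js = word_prod is" and min: "\<And>ks. word_prod ks = word_prod is \<Longrightarrow> length js \<le> length ks"
    using arg_min_natI[of "\<lambda>js. word_prod js = word_prod is" "is" length]
      arg_min_nat_le[of "\<lambda>js. word_prod js = word_prod is" _ length] by metis
  have "word_prod (take k js) (\<alpha> (js ! k)) \<in> P" if k: "k < length js" for k
  proof (rule ccontr)
    assume "\<not> ?thesis"
    then obtain ks where ks: "Suc (length ks) = k" "word_prod ks = word_prod (take k js) \<circ> \<s> (js ! k)"
      using exchange[of "take k js" "js ! k"] k by auto
    have "js = take k js @ js ! k # drop (Suc k) js"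
      using k by (rule id_take_nth_drop)
    then have "word_prod js = word_prod (take k js) \<circ> (\<s> (js ! k) \<circ> word_prod (drop (Suc k) js))"
      by (metis word_prod_append word_prod_Cons)
    then have "word_prod (ks @ drop (Suc k) js) = word_prod is"
      using ks js by (simp add: word_prod_append comp_assoc)
    from min[OF this] ks k show False by simp
  qed
  with js that show thesis
    by (auto simp: reduced_word_def)
qed

text \<open>
  Matsumoto's theorem: if \<open>w\<close> sends two simple roots \<open>\<alpha>\<^sub>i\<close> and \<open>\<alpha>\<^sub>j\<close> to negative roots, then \<open>w\<close> is a
  reduced product \<open>v w\<^sub>0\<close> with \<open>w\<^sub>0\<close> the longest element generated by \<open>\<sigma>\<^sub>i\<close> and \<open>\<sigma>\<^sub>j\<close>, so that two
  reduced words ending in different letters are connected through a braid move.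
\<close>

lemma reduced_words_act_equally:
  fixes T :: "'b \<Rightarrow> 'n \<Rightarrow> 'b"
  assumes comm: "\<And>f i j. i \<noteq> j \<Longrightarrow> \<not> adjacent \<alpha> i j \<Longrightarrow> T (T f i) j = T (T f j) i"
    and braid: "\<And>f i j. adjacent \<alpha> i j \<Longrightarrow> T (T (T f i) j) i = T (T (T f j) i) j"
    and "reduced_word is" "reduced_word js" "word_prod is = word_prod js"
  shows "length is = length js \<and> foldl T f is = foldl T f js"
  using assms(3-)
proof (induction "length is" arbitrary: "is" js f rule: less_induct)
  case less
  show ?case
  proof (cases "is" rule: rev_cases)
    case Nil
    have "js = []"
    proof (cases js rule: rev_cases)
      case (snoc js' j)
      with Nil less.prems have "word_prod js' \<circ> \<s> j = id" "word_prod js' (\<alpha> j) \<in> P"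
        by (simp_all add: word_prod_snoc reduced_word_snoc)
      then have "\<alpha> j = - word_prod js' (\<alpha> j)"
        by (metis comp_apply id_apply word_prod_linear(3) s_simps(6))
      with \<open>word_prod js' (\<alpha> j) \<in> P\<close> show ?thesis
        using not_positive_and_negative simple_positive by metis
    qed
    with Nil show ?thesis by simp
  next
    case is': (snoc is' i)
    have is'_red: "reduced_word is'" "word_prod is' (\<alpha> i) \<in> P"
      using less.prems is' by (simp_all add: reduced_word_snoc)
    show ?thesis
    proof (cases js rule: rev_cases)
      case Nil
      with is' less.prems have "word_prod is' \<circ> \<s> i = id"
        by (simp add: word_prod_snoc)
      then have "\<alpha> i = - word_prod is' (\<alpha> i)"
        by (metis comp_apply id_apply word_prod_linear(3) s_simps(6))
      with is'_red show ?thesis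
        using not_positive_and_negative simple_positive by metis
    next
      case js': (snoc js' j)
      have js'_red: "reduced_word js'" "word_prod js' (\<alpha> j) \<in> P"
        using less.prems js' by (simp_all add: reduced_word_snoc)
      have w: "word_prod is' \<circ> \<s> i = word_prod js' \<circ> \<s> j"
        using less.prems is' js' by (simp add: word_prod_snoc)
      then have w': "word_prod is' (\<s> i v) = word_prod js' (\<s> j v)" for v
        by (metis comp_apply)
      have is'_j: "word_prod is' v = word_prod js' (\<s> j (\<s> i v))" for v
        by (metis w' s_simps(7))
      have js'_i: "word_prod js' v = word_prod is' (\<s> i (\<s> j v))" for v
        by (metis w' s_simps(7))
      consider (same) "i = j" | (comm) "i \<noteq> j" "\<not> adjacent \<alpha> i j" | (braid) "i \<noteq> j" "adjacent \<alpha> i j"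
        by blast
      then show ?thesis
      proof cases
        case same
        with w' have "word_prod is' = word_prod js'"
          by (metis ext s_simps(7))
        with less.hyps[of is' js'] is' js' is'_red js'_red same show ?thesis
          by simp
      next
        case comm
        obtain ks where ks: "reduced_word ks" "word_prod ks = word_prod (is' @ [j])"
          using obtain_reduced_word by metis
        then have ks': "word_prod ks v = word_prod is' (\<s> j v)" for v
          by (simp add: word_prod_snoc)
        have orth: "\<s> i (\<alpha> j) = \<alpha> j" "\<s> j (\<alpha> i) = \<alpha> i"
          using comm nonadjacent_inner[of i j] by (simp_all add: s_eq inner_commute)
        have st: "\<s> i (\<s> j v) = \<s> j (\<s> i v)" for v
          using comm nonadjacent_inner[of i j]
          by (simp add: s_eq inner_diff_left inner_commute algebra_simps)
        have red_j: "reduced_word (ks @ [j])"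
          using ks(1) js'_red(2) by (simp add: reduced_word_snoc ks' is'_j orth)
        have red_i: "reduced_word (ks @ [i])"
          using ks(1) is'_red(2) by (simp add: reduced_word_snoc ks' orth)
        have pj: "word_prod is' = word_prod (ks @ [j])"
          by (simp add: word_prod_snoc fun_eq_iff ks')
        have pi: "word_prod (ks @ [i]) = word_prod js'"
          by (simp add: word_prod_snoc fun_eq_iff ks' js'_i st)
        have 1: "length is' = length (ks @ [j]) \<and> foldl T f is' = foldl T f (ks @ [j])"
          using less.hyps[of is' "ks @ [j]" f] is' is'_red(1) red_j pj by simp
        moreover have "length (ks @ [i]) = length js' \<and> foldl T f (ks @ [i]) = foldl T f js'"
          using less.hyps[of "ks @ [i]" js' f] 1 is' js'_red(1) red_i pi by simp
        ultimately show ?thesis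
          using assms(1)[OF comm, of "foldl T f ks"] is' js' by auto
      next
        case braid
        obtain ks where ks: "reduced_word ks" "word_prod ks = word_prod (is' @ [j, i])"
          using obtain_reduced_word by metis
        then have ks': "word_prod ks v = word_prod is' (\<s> j (\<s> i v))" for v
          by (simp add: word_prod_append word_prod_Cons)
        have ij: "\<s> i (\<alpha> j) = \<alpha> i + \<alpha> j" "\<s> j (\<alpha> i) = \<alpha> i + \<alpha> j"
          using adjacent_inner[OF braid(2)] by (simp_all add: s_eq inner_commute)
        have sts: "\<s> i (\<s> j (\<s> i v)) = \<s> j (\<s> i (\<s> j v))" for v
          using adjacent_inner[OF braid(2)]
          by (simp add: s_eq inner_diff_left inner_commute algebra_simps)
        have sum: "\<s> j (\<alpha> i + \<alpha> j) = \<alpha> i" "\<s> i (\<alpha> i + \<alpha> j) = \<alpha> j"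
          by (simp_all add: ij)
        have "word_prod ks (\<alpha> i) = word_prod js' (\<alpha> j)" "word_prod ks (\<alpha> j) = word_prod is' (\<alpha> i)"
          by (simp_all only: ks' is'_j sts sum ij s_simps(7))
        then have pos: "word_prod ks (\<alpha> i) \<in> P" "word_prod ks (\<alpha> j) \<in> P"
          using is'_red js'_red by simp_all
        moreover have "word_prod ks (\<alpha> i) + word_prod ks (\<alpha> j) \<in> \<Phi>"
          using ij(1) s_root[of i "\<alpha> j"] by (simp flip: word_prod_linear)
        ultimately have "word_prod ks (\<alpha> i) + word_prod ks (\<alpha> j) \<in> P"
          by (rule positive_add)
        then have red: "reduced_word ((ks @ [i]) @ [j])" "reduced_word ((ks @ [j]) @ [i])"
          unfolding reduced_word_snoc using ks(1) pos by (simp_all add: word_prod_snoc ij)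
        then have red_j: "reduced_word (ks @ [i, j])" and red_i: "reduced_word (ks @ [j, i])"
          by simp_all
        have pj: "word_prod is' = word_prod (ks @ [i, j])"
          by (simp add: word_prod_append word_prod_Cons fun_eq_iff ks')
        have pi: "word_prod (ks @ [j, i]) = word_prod js'"
          by (simp add: word_prod_append word_prod_Cons fun_eq_iff ks' js'_i sts[symmetric])
        have 1: "length is' = length (ks @ [i, j]) \<and> foldl T f is' = foldl T f (ks @ [i, j])"
          using less.hyps[of is' "ks @ [i, j]" f] is' is'_red(1) red_j pj by simp
        moreover have "length (ks @ [j, i]) = length js' \<and> foldl T f (ks @ [j, i]) = foldl T f js'"
          using less.hyps[of "ks @ [j, i]" js' f] 1 is' js'_red(1) red_i pi by simp
        ultimately show ?thesis
          using assms(2)[OF braid(2), of "foldl T f ks"] is' js' by auto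
      qed
    qed
  qed
qed

text \<open>Since the operators are involutions, every word acts like some reduced word for the same element.\<close>

lemma words_act_equally:
  fixes T :: "'b \<Rightarrow> 'n \<Rightarrow> 'b"
  assumes inv: "\<And>f i. T (T f i) i = f"
    and comm: "\<And>f i j. i \<noteq> j \<Longrightarrow> \<not> adjacent \<alpha> i j \<Longrightarrow> T (T f i) j = T (T f j) i"
    and braid: "\<And>f i j. adjacent \<alpha> i j \<Longrightarrow> T (T (T f i) j) i = T (T (T f j) i) j"
    and "word_prod is = word_prod js"
  shows "foldl T f is = foldl T f js"
proof -
  have unique: "foldl T f is = foldl T f js"
    if "reduced_word is" "reduced_word js" "word_prod is = word_prod js" for f "is" js
    using reduced_words_act_equally[of T "is" js f, OF comm braid that] by simp
  have *: "foldl T f is = foldl T f js" if "reduced_word js" "word_prod is = word_prod js" for "is" js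
    using that
  proof (induction "is" arbitrary: js rule: rev_induct)
    case Nil
    then show ?case
      using unique[of "[]" js f] by (metis foldl_Nil reduced_word_Nil)
  next
    case (snoc i "is")
    obtain ks where ks: "reduced_word ks" "word_prod ks = word_prod is"
      using obtain_reduced_word by metis
    note IH = snoc.IH[OF ks(1) ks(2)[symmetric]]
    show ?case
    proof (cases "word_prod is (\<alpha> i) \<in> P")
      case True
      then have "reduced_word (ks @ [i])"
        using ks by (simp add: reduced_word_snoc)
      moreover have "word_prod (ks @ [i]) = word_prod js"
        using ks(2) snoc.prems(2) by (simp only: word_prod_snoc)
      ultimately show ?thesis
        using unique[of "ks @ [i]" js f] snoc.prems(1) IH by simp
    next
      case False
      then have "word_prod js (\<alpha> i) \<in> P"
        using not_positive_iff[of "word_prod is (\<alpha> i)"] by (simp add: snoc.prems(2)[symmetric] word_prod_snoc)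
      then have "reduced_word (js @ [i])"
        using snoc.prems by (simp add: reduced_word_snoc)
      moreover have "word_prod (js @ [i]) = word_prod ks"
        unfolding ks(2) word_prod_snoc snoc.prems(2)[symmetric] by (simp add: fun_eq_iff)
      ultimately have "foldl T f ks = T (foldl T f js) i"
        using unique[of "js @ [i]" ks f] ks(1) by simp
      then show ?thesis
        using IH inv by simp
    qed
  qed
  obtain ks where "reduced_word ks" "word_prod ks = word_prod is"
    using obtain_reduced_word by metis
  then show ?thesis
    using *[of ks "is"] *[of ks js] assms(4) by simp
qed

end

section \<open>Laurent monomials\<close>

lemma power_int_prod: "(\<Prod>x\<in>A. f x) powi k = (\<Prod>x\<in>A. f x powi k)"
  for f :: "'b \<Rightarrow> 'c::field"
  by (induction A rule: infinite_finite_induct) (simp_all add: power_int_mult_distrib)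

lemma power_int_sum: "x \<noteq> 0 \<Longrightarrow> x powi (\<Sum>i\<in>A. k i) = (\<Prod>i\<in>A. x powi k i)"
  for x :: "'c::field"
  by (induction A rule: infinite_finite_induct) (simp_all add: power_int_add)

locale simply_laced_slash = simply_laced_base \<Phi> \<alpha>
  for \<Phi> :: "'a::euclidean_space set" and \<alpha> :: "'n::{finite,linorder} \<Rightarrow> 'a" +
  fixes q :: nat and l :: "'n \<Rightarrow> nat"
  assumes q_ge_2: "2 \<le> q"
begin

abbreviation "\<t> \<equiv> (rf_sqrt q :: 'n ratfun)"

text \<open>In the normalised variables \<open>\<surd>q x\<^sub>i\<close> the action of \<open>W\<close> on points becomes the linear action on
  exponents.\<close>

definition Y :: "'a \<Rightarrow> 'n ratfun" where
  "Y = monomial_at \<alpha> (\<lambda>i. \<t> * rf_var i)"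

lemma t_squared: "\<t> * \<t> = of_nat q"
  by (rule rf_sqrt_squared)

lemma q_pos [simp]: "0 < q" "q \<noteq> 0"
  using q_ge_2 by auto

lemma t_neq_0 [simp]: "\<t> \<noteq> 0"
  by (simp add: rf_sqrt_def)

lemma Y_neq_0 [simp]: "Y \<mu> \<noteq> 0"
  by (simp add: Y_def monomial_at_def power_int_eq_0_iff)

lemma Y_0 [simp]: "Y 0 = 1"
  by (simp add: Y_def monomial_at_def)

lemma Y_simple: "Y (\<alpha> i) = \<t> * rf_var i"
proof -
  have "Y (\<alpha> i) = (\<Prod>j\<in>UNIV. if j = i then \<t> * rf_var j else 1)"
    unfolding Y_def monomial_at_def by (rule prod.cong) (auto simp: root_coords_simple)
  then show ?thesis by simp
qed

lemma Y_add: "\<mu> \<in> \<Lambda> \<Longrightarrow> \<nu> \<in> \<Lambda> \<Longrightarrow> Y (\<mu> + \<nu>) = Y \<mu> * Y \<nu>"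
  by (simp add: Y_def monomial_at_def root_coords_add power_int_add prod.distrib)

lemma Y_scale: "\<mu> \<in> \<Lambda> \<Longrightarrow> Y (real_of_int k *\<^sub>R \<mu>) = Y \<mu> powi k"
  by (simp add: Y_def monomial_at_def root_coords_scale power_int_mult mult.commute[of k]
      power_int_prod)

lemma Y_uminus: "\<mu> \<in> \<Lambda> \<Longrightarrow> Y (- \<mu>) = inverse (Y \<mu>)"
  using Y_scale[of \<mu> "-1"] by (simp add: power_int_minus)

lemma Y_scale_nat: "\<mu> \<in> \<Lambda> \<Longrightarrow> Y (real n *\<^sub>R \<mu>) = Y \<mu> ^ n"
  using Y_scale[of \<mu> "int n"] by simp

lemma Y_double: "\<mu> \<in> \<Lambda> \<Longrightarrow> Y (2 *\<^sub>R \<mu>) = Y \<mu> ^ 2"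
  using Y_scale_nat[of \<mu> 2] by simp

lemma Y_sum: "(\<And>x. x \<in> A \<Longrightarrow> F x \<in> \<Lambda>) \<Longrightarrow> Y (sum F A) = (\<Prod>x\<in>A. Y (F x))"
  by (induction A rule: infinite_finite_induct) (simp_all add: Y_add lattice_sum)

lemma Y_eq_monomial:
  "Y \<mu> = \<t> powi root_height \<alpha> \<mu> * monomial_at \<alpha> rf_var \<mu>"
  by (simp add: Y_def monomial_at_def power_int_mult_distrib prod.distrib root_height_def
      power_int_sum)

lemma Y_independent:
  assumes "finite K" "K \<subseteq> \<Lambda>" "(\<Sum>\<mu>\<in>K. rf_const (c \<mu>) * Y \<mu>) = 0" "\<mu> \<in> K"
  shows "c \<mu> = 0"
proof -
  let ?s = "complex_of_real (sqrt (real q))"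
  let ?f = "\<lambda>k. \<Sum>i\<in>UNIV. real_of_int (k i) *\<^sub>R \<alpha> i"
  define K' where "K' = root_coords \<alpha> ` K"
  have inj: "inj_on (root_coords \<alpha>) K"
    using assms(2) lattice_expansion by (intro inj_onI) (metis subsetD)
  have f: "?f (root_coords \<alpha> \<mu>) = \<mu>" if "\<mu> \<in> K" for \<mu>
    using assms(2) that lattice_expansion[of \<mu>] by auto
  have "(\<Sum>k\<in>K'. rf_const (c (?f k) * ?s powi root_height \<alpha> (?f k)) * (\<Prod>i\<in>UNIV. rf_var i powi k i))
      = (\<Sum>\<mu>\<in>K. rf_const (c \<mu>) * Y \<mu>)"
    unfolding K'_def sum.reindex[OF inj]
    by (intro sum.cong refl)
       (simp add: f Y_eq_monomial monomial_at_def rf_const_mult rf_const_powi rf_sqrt_def del: mult_cancel_left)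
  then have "c (?f (root_coords \<alpha> \<mu>)) * ?s powi root_height \<alpha> (?f (root_coords \<alpha> \<mu>)) = 0"
    using laurent_monomials_independent[of K' "\<lambda>k. c (?f k) * ?s powi root_height \<alpha> (?f k)"]
      assms by (auto simp: K'_def)
  then show ?thesis
    by (simp add: f assms(4) power_int_eq_0_iff)
qed

lemma binomial_neq_0:
  assumes "\<beta> \<in> \<Lambda>" "\<beta> \<noteq> 0" "a \<noteq> 0 \<or> b \<noteq> 0"
  shows "rf_const a + rf_const b * Y \<beta> \<noteq> 0"
proof
  assume "rf_const a + rf_const b * Y \<beta> = 0"
  then have "(\<Sum>\<mu>\<in>{0, \<beta>}. rf_const (if \<mu> = 0 then a else b) * Y \<mu>) = 0"
    using assms by simp
  from Y_independent[OF _ _ this, of 0] Y_independent[OF _ _ this, of \<beta>] assms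
  show False by auto
qed

section \<open>Reflections and sign changes as field automorphisms\<close>

text \<open>Different monomials in the entries of \<open>y\<close> have different exponents as monomials in \<open>x\<close>, so nothing
  cancels when a polynomial is evaluated at \<open>y\<close>.\<close>

lemma monomial_point_independent:
  assumes y: "\<And>j. y j = rf_const (c j) * Y (\<nu> j)" and c: "\<And>j. c j \<noteq> 0"
    and \<nu>: "\<And>j. \<nu> j \<in> \<Lambda>"
    and inj: "inj (\<lambda>k::'n \<Rightarrow> nat. \<Sum>j\<in>UNIV. real (k j) *\<^sub>R \<nu> j)"
  shows "alg_independent_point y"
  unfolding alg_independent_point_def
proof safe
  fix p assume p: "poly_at y p = 0"
  define e where "e m = (\<Sum>j\<in>UNIV. real (Poly_Mapping.lookup m j) *\<^sub>R \<nu> j)" for m :: "'n \<Rightarrow>\<^sub>0 nat"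
  define d where "d m = Poly_Mapping.lookup p m * (\<Prod>j\<in>UNIV. c j ^ Poly_Mapping.lookup m j)" for m
  have nat_scale: "real n *\<^sub>R \<nu> j \<in> \<Lambda>" for n j
    using lattice_scale[OF \<nu>, of "int n" j] by simp
  have e_lattice: "e m \<in> \<Lambda>" for m
    unfolding e_def by (rule lattice_sum) (simp add: nat_scale)
  have Ye: "Y (e m) = (\<Prod>j\<in>UNIV. Y (\<nu> j) ^ Poly_Mapping.lookup m j)" for m
    unfolding e_def by (subst Y_sum) (simp_all add: Y_scale_nat \<nu> nat_scale)
  have inj_e: "inj e"
  proof (rule injI)
    fix m m' assume "e m = e m'"
    then have "Poly_Mapping.lookup m = Poly_Mapping.lookup m'"
      unfolding e_def by (rule injD[OF inj, of "Poly_Mapping.lookup m" "Poly_Mapping.lookup m'"])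
    then show "m = m'"
      by (intro poly_mapping_eqI) (rule fun_cong)
  qed
  have "(\<Sum>\<mu>\<in>e ` Poly_Mapping.keys p. rf_const (d (inv e \<mu>)) * Y \<mu>)
      = (\<Sum>m\<in>Poly_Mapping.keys p. rf_const (d m) * Y (e m))"
    by (subst sum.reindex[OF inj_on_subset[OF inj_e subset_UNIV]]) (simp add: inj_e)
  also have "\<dots> = poly_at y p"
    unfolding poly_at_def
    by (intro sum.cong refl) (simp add: d_def Ye y rf_const_mult rf_const_prod rf_const_power
        power_mult_distrib prod.distrib mult.assoc)
  finally have *: "(\<Sum>\<mu>\<in>e ` Poly_Mapping.keys p. rf_const (d (inv e \<mu>)) * Y \<mu>) = 0"
    using p by simp
  have "Poly_Mapping.lookup p m = 0" if "m \<in> Poly_Mapping.keys p" for m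
  proof -
    have "d (inv e (e m)) = 0"
      by (rule Y_independent[OF _ _ *]) (use that e_lattice in auto)
    then show ?thesis
      using inj_e c by (simp add: d_def)
  qed
  then show "p = 0"
    by (intro poly_mapping_eqI) (metis in_keys_iff lookup_zero)
qed

definition S :: "'n \<Rightarrow> 'n ratfun \<Rightarrow> 'n ratfun" where
  "S i = rf_at (sigma_point \<alpha> q i rf_var)"

definition E :: "'n \<Rightarrow> 'n ratfun \<Rightarrow> 'n ratfun" where
  "E i = rf_at (eps_point \<alpha> i rf_var)"

lemma simple_nat_combination_inj:
  "inj (\<lambda>k::'n \<Rightarrow> nat. \<Sum>j\<in>UNIV. real (k j) *\<^sub>R \<alpha> j)"
proof (rule injI)
  fix k k' :: "'n \<Rightarrow> nat"
  assume "(\<Sum>j\<in>UNIV. real (k j) *\<^sub>R \<alpha> j) = (\<Sum>j\<in>UNIV. real (k' j) *\<^sub>R \<alpha> j)"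
  from simple_combination_unique[OF this] show "k = k'"
    by (simp add: fun_eq_iff)
qed

lemma s_sum: "\<s> i (sum F A) = (\<Sum>x\<in>A. \<s> i (F x))"
  by (induction A rule: infinite_finite_induct) simp_all

lemma sigma_point_eq: "sigma_point \<alpha> q i rf_var j = inverse \<t> * Y (\<s> i (\<alpha> j))"
proof -
  consider "j = i" | "adjacent \<alpha> i j" | "j \<noteq> i" "\<not> adjacent \<alpha> i j" by blast
  then show ?thesis
  proof cases
    case 1
    then have "\<not> adjacent \<alpha> i j" by (simp add: adjacent_def)
    with 1 show ?thesis
      by (simp add: sigma_point_def Y_uminus Y_simple t_squared[symmetric] divide_inverse mult.assoc)
  next
    case 2
    then have "\<s> i (\<alpha> j) = \<alpha> i + \<alpha> j"
      using adjacent_inner[of i j] by (simp add: s_eq inner_commute)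
    with 2 show ?thesis
      by (simp add: sigma_point_def Y_add Y_simple field_simps)
  next
    case 3
    then have "\<s> i (\<alpha> j) = \<alpha> j"
      using nonadjacent_inner[of i j] by (simp add: s_eq inner_commute)
    with 3 show ?thesis
      by (simp add: sigma_point_def Y_simple)
  qed
qed

lemma inverse_t: "inverse \<t> = rf_const (inverse (complex_of_real (sqrt (real q))))"
  by (simp add: rf_sqrt_def rf_const_inverse)

lemma rf_var_eq: "rf_var j = inverse \<t> * Y (\<alpha> j)"
  by (simp add: Y_simple)

lemma sigma_point_independent: "alg_independent_point (sigma_point \<alpha> q i rf_var)"
proof (rule monomial_point_independent)
  show "inj (\<lambda>k. \<Sum>j\<in>UNIV. real (k j) *\<^sub>R \<s> i (\<alpha> j))"
  proof (rule injI)
    fix k k' :: "'n \<Rightarrow> nat"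
    assume "(\<Sum>j\<in>UNIV. real (k j) *\<^sub>R \<s> i (\<alpha> j)) = (\<Sum>j\<in>UNIV. real (k' j) *\<^sub>R \<s> i (\<alpha> j))"
    then have "\<s> i (\<Sum>j\<in>UNIV. real (k j) *\<^sub>R \<alpha> j) = \<s> i (\<Sum>j\<in>UNIV. real (k' j) *\<^sub>R \<alpha> j)"
      by (simp add: s_sum)
    then show "k = k'"
      by (metis injD[OF simple_nat_combination_inj] s_simps(7))
  qed
qed (auto simp: sigma_point_eq inverse_t)

lemma eps_point_eq: "eps_point \<alpha> i rf_var j = rf_const ((-1) powi \<lfloor>\<alpha> j \<bullet> \<alpha> i\<rfloor>) * rf_var j"
proof -
  have [simp]: "\<lfloor>- 1 :: real\<rfloor> = - 1"
    by (simp add: floor_eq_iff)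
  show ?thesis
    using adjacent_inner[of i j] nonadjacent_inner[of i j]
    by (cases "i = j") (auto simp: eps_point_def adjacent_def inner_commute rf_const_uminus power_int_minus)
qed

lemma eps_point_independent: "alg_independent_point (eps_point \<alpha> i rf_var)"
  by (rule monomial_point_independent[of _
        "\<lambda>j. (-1) powi \<lfloor>\<alpha> j \<bullet> \<alpha> i\<rfloor> * inverse (complex_of_real (sqrt (real q)))" \<alpha>])
     (auto simp: eps_point_eq rf_const_mult inverse_t[symmetric] rf_var_eq power_int_eq_0_iff
        simple_nat_combination_inj)

lemmas S_hom = rf_at_hom[OF sigma_point_independent, folded S_def]
lemmas E_hom = rf_at_hom[OF eps_point_independent, folded E_def]

lemma S_var: "S i (rf_var j) = sigma_point \<alpha> q i rf_var j"
  by (simp add: S_def rf_at_var sigma_point_independent)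

lemma S_Y:
  assumes "\<mu> \<in> \<Lambda>" shows "S i (Y \<mu>) = Y (\<s> i \<mu>)"
proof -
  let ?k = "root_coords \<alpha> \<mu>"
  have "S i (Y \<mu>) = (\<Prod>j\<in>UNIV. Y (\<s> i (\<alpha> j)) powi ?k j)"
    by (simp add: Y_def[THEN fun_cong, of \<mu>] monomial_at_def hom_simps[OF S_hom] S_var sigma_point_eq
        flip: mult.assoc)
  also have "\<dots> = Y (\<Sum>j\<in>UNIV. real_of_int (?k j) *\<^sub>R \<s> i (\<alpha> j))"
    by (subst Y_sum) (simp_all add: Y_scale lattice_scale)
  also have "(\<Sum>j\<in>UNIV. real_of_int (?k j) *\<^sub>R \<s> i (\<alpha> j)) = \<s> i \<mu>"
    by (subst (2) lattice_expansion[OF assms]) (simp add: s_sum)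
  finally show ?thesis .
qed

lemma of_int_floor_inner: "\<mu> \<in> \<Lambda> \<Longrightarrow> real_of_int \<lfloor>\<mu> \<bullet> \<alpha> i\<rfloor> = \<mu> \<bullet> \<alpha> i"
  using lattice_inner_int by (metis Ints_cases floor_of_int)

lemma floor_uminus_inner: "\<mu> \<in> \<Lambda> \<Longrightarrow> \<lfloor>- (\<mu> \<bullet> \<alpha> i)\<rfloor> = - \<lfloor>\<mu> \<bullet> \<alpha> i\<rfloor>"
  by (metis floor_of_int of_int_floor_inner of_int_minus)

lemma E_Y:
  assumes "\<mu> \<in> \<Lambda>" shows "E i (Y \<mu>) = (-1) powi \<lfloor>\<mu> \<bullet> \<alpha> i\<rfloor> * Y \<mu>"
proof -
  let ?k = "root_coords \<alpha> \<mu>"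
  have "\<mu> \<bullet> \<alpha> i = (\<Sum>j\<in>UNIV. real_of_int (?k j) * (\<alpha> j \<bullet> \<alpha> i))"
    by (subst lattice_expansion[OF assms]) (simp add: inner_sum_left)
  also have "\<dots> = real_of_int (\<Sum>j\<in>UNIV. ?k j * \<lfloor>\<alpha> j \<bullet> \<alpha> i\<rfloor>)"
    by (simp add: of_int_floor_inner)
  finally have *: "\<lfloor>\<mu> \<bullet> \<alpha> i\<rfloor> = (\<Sum>j\<in>UNIV. \<lfloor>\<alpha> j \<bullet> \<alpha> i\<rfloor> * ?k j)"
    by (metis (no_types, lifting) floor_of_int mult.commute sum.cong)
  have "E i (\<t> * rf_var j) = (-1) powi \<lfloor>\<alpha> j \<bullet> \<alpha> i\<rfloor> * (\<t> * rf_var j)" for j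
    by (simp add: E_def rf_at_var rf_at_hom hom_simps eps_point_independent eps_point_eq
        rf_const_powi rf_const_uminus)
  then show ?thesis
    by (simp add: Y_def monomial_at_def hom_simps[OF E_hom] * power_int_mult_distrib prod.distrib
        power_int_mult power_int_sum del: hom_mult)
qed

lemma hom_eqI:
  assumes "substitution_hom h" "substitution_hom g" "\<And>j. h (Y (\<alpha> j)) = g (Y (\<alpha> j))"
  shows "h f = g f"
proof (rule substitution_hom_eqI[OF assms(1,2)])
  fix j
  show "h (rf_var j) = g (rf_var j)"
    unfolding rf_var_eq by (simp add: hom_mult hom_inverse hom_sqrt assms)
qed

lemmas SE_hom2 = substitution_hom_comp[OF S_hom S_hom] substitution_hom_comp[OF S_hom E_hom]
  substitution_hom_comp[OF E_hom S_hom] substitution_hom_comp[OF E_hom E_hom]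

lemmas SE_hom = SE_hom2 substitution_hom_comp[OF S_hom SE_hom2(1)]
  substitution_hom_comp[OF S_hom SE_hom2(4)] substitution_hom_id

lemma SE_relations:
  "S i (S i f) = f"
  "E i (E i f) = f"
  "E i (S i f) = S i (E i f)"
  "E i (E j f) = E j (E i f)"
proof -
  show "S i (S i f) = f"
    by (rule hom_eqI[of "\<lambda>f. S i (S i f)" "\<lambda>f. f"]) (simp_all add: SE_hom S_Y)
  show "E i (E i f) = f"
    by (rule hom_eqI[of "\<lambda>f. E i (E i f)" "\<lambda>f. f"]) (simp_all add: SE_hom E_Y hom_simps[OF E_hom] flip: power_int_mult_distrib)
  show "E i (S i f) = S i (E i f)"
    by (rule hom_eqI[of "\<lambda>f. E i (S i f)" "\<lambda>f. S i (E i f)"]) (simp_all add: SE_hom S_Y E_Y hom_simps[OF S_hom] s_inner floor_uminus_inner power_int_minus_one_minus)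
  show "E i (E j f) = E j (E i f)"
    by (rule hom_eqI[of "\<lambda>f. E i (E j f)" "\<lambda>f. E j (E i f)"]) (simp_all add: SE_hom E_Y hom_simps[OF E_hom] mult.left_commute)
qed

lemma SE_nonadjacent:
  assumes "i \<noteq> j" "\<not> adjacent \<alpha> i j"
  shows "S i (S j f) = S j (S i f)" "E i (S j f) = S j (E i f)"
proof -
  have "\<s> i (\<s> j v) = \<s> j (\<s> i v)" for v
    using nonadjacent_inner[OF assms]
    by (simp add: s_eq inner_diff_left inner_commute algebra_simps)
  then show "S i (S j f) = S j (S i f)"
    by - (rule hom_eqI[of "\<lambda>f. S i (S j f)" "\<lambda>f. S j (S i f)"], simp_all add: SE_hom S_Y)
  have "\<s> j (\<alpha> i) = \<alpha> i"
    using nonadjacent_inner[OF assms] by (simp add: s_eq)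
  then show "E i (S j f) = S j (E i f)"
    by - (rule hom_eqI[of "\<lambda>f. E i (S j f)" "\<lambda>f. S j (E i f)"], simp_all add: SE_hom S_Y E_Y hom_simps[OF S_hom] s_inner)
qed

lemma s_adjacent: "adjacent \<alpha> i j \<Longrightarrow> \<s> j (\<alpha> i) = \<alpha> i + \<alpha> j"
  using adjacent_inner[of i j] by (simp add: s_eq)

lemma SE_adjacent:
  assumes "adjacent \<alpha> i j"
  shows "S i (S j (S i f)) = S j (S i (S j f))" "E i (S j f) = S j (E i (E j f))"
proof -
  have "\<s> i (\<s> j (\<s> i v)) = \<s> j (\<s> i (\<s> j v))" for v
    using adjacent_inner[OF assms]
    by (simp add: s_eq inner_diff_left inner_commute algebra_simps)
  then show "S i (S j (S i f)) = S j (S i (S j f))"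
    by - (rule hom_eqI[of "\<lambda>f. S i (S j (S i f))" "\<lambda>f. S j (S i (S j f))"], simp_all add: SE_hom S_Y)
  have "\<lfloor>\<s> j (\<alpha> k) \<bullet> \<alpha> i\<rfloor> = \<lfloor>\<alpha> k \<bullet> \<alpha> i\<rfloor> + \<lfloor>\<alpha> k \<bullet> \<alpha> j\<rfloor>" for k
    using lattice_inner_int[OF simple_lattice, of k i] lattice_inner_int[OF simple_lattice, of k j]
    by (auto simp: s_inner s_adjacent[OF assms] inner_add_right elim!: Ints_cases simp flip: of_int_add)
  then show "E i (S j f) = S j (E i (E j f))"
    by - (rule hom_eqI[of "\<lambda>f. E i (S j f)" "\<lambda>f. S j (E i (E j f))"], simp_all add: SE_hom S_Y E_Y hom_simps[OF S_hom] hom_simps[OF E_hom]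
        power_int_add mult.assoc)
qed

end

section \<open>The slash operators satisfy the relations of the Weyl group\<close>

text \<open>With \<open>t = \<surd>q\<close> and \<open>y = \<surd>q x\<^sub>i\<close>, \<open>f | \<sigma>\<^sub>i\<close> is
  \<open>y\<^bsup>l\<^esup> (slash_plus t y f(\<sigma>\<^sub>i x) + (-1)\<^bsup>l\<^esup> slash_minus t y f(\<epsilon>\<^sub>i \<sigma>\<^sub>i x))\<close>, where \<open>l = l\<^sub>i\<close> (\<open>slash_simple_eq\<close>).\<close>

definition slash_plus :: "'c::field \<Rightarrow> 'c \<Rightarrow> 'c" where
  "slash_plus t y = (t - 1) * (y + 1) / (2 * y * (t - y))"

definition slash_minus :: "'c::field \<Rightarrow> 'c \<Rightarrow> 'c" where
  "slash_minus t y = (t + 1) * (y - 1) / (2 * y * (t - y))"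

lemma slash_involution_identities:
  fixes t y :: "'c::field"
  assumes "(2::'c) \<noteq> 0" "y \<noteq> 0" "t - y \<noteq> 0" "t * y - 1 \<noteq> 0"
  shows "slash_plus t y * slash_plus t (inverse y) + slash_minus t y * slash_minus t (inverse y) = 1"
    and "slash_plus t y * slash_minus t (inverse y) + slash_minus t y * slash_plus t (inverse y) = 0"
proof -
  have eq: "slash_plus t (inverse y) = (t - 1) * (y + 1) * y / (2 * (t * y - 1))"
    "slash_minus t (inverse y) = (t + 1) * (1 - y) * y / (2 * (t * y - 1))"
    using assms by (simp_all add: slash_plus_def slash_minus_def field_simps)
  have 4: "(4::'c) \<noteq> 0"
    using assms(1) by (metis mult_2 mult_eq_0_iff numeral_Bit0)
  show "slash_plus t y * slash_plus t (inverse y) + slash_minus t y * slash_minus t (inverse y) = 1"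
    unfolding eq slash_plus_def[of t y] slash_minus_def[of t y] using assms 4
    by (simp add: divide_simps) algebra
  show "slash_plus t y * slash_minus t (inverse y) + slash_minus t y * slash_plus t (inverse y) = 0"
    unfolding eq slash_plus_def[of t y] slash_minus_def[of t y] using assms
    by (simp add: divide_simps) algebra
qed

lemma add_fractions_cancel:
  fixes a b c d :: "'c::field"
  assumes "a \<noteq> 0" "b \<noteq> 0" "c \<noteq> 0" "n1 * b + n2 * a = c * m"
  shows "n1 / (a * c * d) + n2 / (b * c * d) = m / (a * b * d)"
proof -
  have "n1 / (a * c * d) + n2 / (b * c * d) = (n1 * b + n2 * a) / (a * b * c * d)"
    using assms(1-3) by (cases "d = 0") (simp_all add: divide_simps)
  then show ?thesis
    using assms by (simp add: divide_simps)
qed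

lemma slash_plus_uminus: "slash_plus t (- y) = (t - 1) * (y - 1) / (2 * y * (t + y))"
  and slash_minus_uminus: "slash_minus t (- y) = (t + 1) * (y + 1) / (2 * y * (t + y))"
proof -
  have "(t - 1) * (- y + 1) = - ((t - 1) * (y - 1))" "(t + 1) * (- y - 1) = - ((t + 1) * (y + 1))"
    "2 * - y * (t - - y) = - (2 * y * (t + y))"
    by algebra+
  then show "slash_plus t (- y) = (t - 1) * (y - 1) / (2 * y * (t + y))"
    "slash_minus t (- y) = (t + 1) * (y + 1) / (2 * y * (t + y))"
    unfolding slash_plus_def slash_minus_def by (simp_all only: minus_divide_divide)
qed

text \<open>
  Each side is a sum of two fractions whose combined numerator is divisible by the factors of the
  denominator that are not symmetric in \<open>y\<close> and \<open>z\<close>; for instance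
  \<open>(t - 1) (y + 1) (z - 1) (t + y z) + (t + 1) (y - 1) (z + 1) (t - y z) = 2 (y z - 1) (t - y) (t + z)\<close>.
\<close>

lemma slash_braid_identities:
  fixes t y z :: "'c::field"
  assumes "t - y \<noteq> 0" "t - z \<noteq> 0" "t - y * z \<noteq> 0" "t + y \<noteq> 0" "t + z \<noteq> 0" "t + y * z \<noteq> 0"
  shows "slash_plus t y * slash_plus t (y * z) * slash_minus t z
           + slash_minus t y * slash_minus t (- (y * z)) * slash_plus t z
       = slash_plus t z * slash_minus t (y * z) * slash_minus t (- y)
           + slash_minus t z * slash_plus t (- (y * z)) * slash_plus t (- y)" (is "?L1 = ?R1")
    and "slash_plus t y * slash_minus t (y * z) * slash_plus t (- z)
           + slash_minus t y * slash_plus t (- (y * z)) * slash_minus t (- z)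
       = slash_plus t z * slash_minus t (y * z) * slash_plus t (- y)
           + slash_minus t z * slash_plus t (- (y * z)) * slash_minus t (- y)" (is "?L2 = ?R2")
proof -
  let ?d = "(2 * y) * (2 * (y * z)) * (2 * z)"
  note uminus = slash_plus_uminus slash_minus_uminus
  note simps = slash_plus_def slash_minus_def times_divide_times_eq
  have L1: "?L1 = (t - 1) * (y + 1) * ((t - 1) * (y * z + 1)) * ((t + 1) * (z - 1))
                    / ((t - y * z) * (t - y) * (?d * (t - z)))
      + (t + 1) * (y - 1) * ((t + 1) * (y * z + 1)) * ((t - 1) * (z + 1))
          / ((t + y * z) * (t - y) * (?d * (t - z)))"
    by (simp only: uminus, simp only: simps, simp only: mult_ac)
  have R1: "?R1 = (t - 1) * (z + 1) * ((t + 1) * (y * z - 1)) * ((t + 1) * (y + 1))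
                    / ((t - y * z) * (t + y) * (?d * (t - z)))
      + (t + 1) * (z - 1) * ((t - 1) * (y * z - 1)) * ((t - 1) * (y - 1))
          / ((t + y * z) * (t + y) * (?d * (t - z)))"
    by (simp only: uminus, simp only: simps, simp only: mult_ac)
  have L2: "?L2 = (t - 1) * (y + 1) * ((t + 1) * (y * z - 1)) * ((t - 1) * (z - 1))
                    / ((t - y * z) * ((t - y) * (t + z)) * ?d)
      + (t + 1) * (y - 1) * ((t - 1) * (y * z - 1)) * ((t + 1) * (z + 1))
          / ((t + y * z) * ((t - y) * (t + z)) * ?d)"
    by (simp only: uminus, simp only: simps, simp only: mult_ac)
  have R2: "?R2 = (t - 1) * (z + 1) * ((t + 1) * (y * z - 1)) * ((t - 1) * (y - 1))
                    / ((t - y * z) * ((t - z) * (t + y)) * ?d)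
      + (t + 1) * (z - 1) * ((t - 1) * (y * z - 1)) * ((t + 1) * (y + 1))
          / ((t + y * z) * ((t - z) * (t + y)) * ?d)"
    by (simp only: uminus, simp only: simps, simp only: mult_ac)
  let ?m1 = "2 * (t - 1) * (t + 1) * (y * z + 1) * (y * z - 1) * (t + z)"
  let ?m2 = "2 * (t - 1) * (t + 1) * (y * z - 1) * (y * z - 1)"
  have c: "(t - y) * (t + z) \<noteq> 0" "(t - z) * (t + y) \<noteq> 0"
    using assms by simp_all
  have "?L1 = ?m1 / ((t - y * z) * (t + y * z) * (?d * (t - z)))"
    unfolding L1 by (rule add_fractions_cancel[OF assms(3,6) assms(1)]) algebra
  moreover have "?R1 = ?m1 / ((t - y * z) * (t + y * z) * (?d * (t - z)))"
    unfolding R1 by (rule add_fractions_cancel[OF assms(3,6) assms(4)]) algebra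
  ultimately show "?L1 = ?R1" by simp
  have "?L2 = ?m2 / ((t - y * z) * (t + y * z) * ?d)"
    unfolding L2 by (rule add_fractions_cancel[OF assms(3,6) c(1)]) algebra
  moreover have "?R2 = ?m2 / ((t - y * z) * (t + y * z) * ?d)"
    unfolding R2 by (rule add_fractions_cancel[OF assms(3,6) c(2)]) algebra
  ultimately show "?L2 = ?R2" by simp
qed

context simply_laced_slash
begin

abbreviation "T \<equiv> slash_simple \<alpha> q l"
abbreviation "U \<equiv> slash_plus \<t>"
abbreviation "V \<equiv> slash_minus \<t>"

lemma t_minus_Y:
  assumes "\<beta> \<in> \<Lambda>" "\<beta> \<noteq> 0"
  shows "\<t> - Y \<beta> \<noteq> 0" "\<t> + Y \<beta> \<noteq> 0" "\<t> * Y \<beta> - 1 \<noteq> 0"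
  using binomial_neq_0[OF assms, of "complex_of_real (sqrt (real q))" "-1"]
    binomial_neq_0[OF assms, of "complex_of_real (sqrt (real q))" 1]
    binomial_neq_0[OF assms, of "-1" "complex_of_real (sqrt (real q))"]
  by (simp_all add: rf_sqrt_def rf_const_uminus)

lemma simple_neq_0 [simp]: "\<alpha> i \<noteq> 0"
  using zero_not_root by (metis simple_root)

lemma slash_simple_eq:
  "T f i = Y (\<alpha> i) ^ l i * (U (Y (\<alpha> i)) * S i f + (-1) ^ l i * V (Y (\<alpha> i)) * S i (E i f))"
proof -
  define y where "y = Y (\<alpha> i)"
  have x: "rf_var i = y / \<t>"
    by (simp add: y_def Y_simple)
  have y: "y \<noteq> 0" "\<t> - y \<noteq> 0"
    using t_minus_Y(1)[of "\<alpha> i"] by (simp_all add: y_def)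
  have ne: "1 - y / \<t> \<noteq> 0"
    using y by (simp add: divide_simps)
  have p: "(y / \<t> * \<t>) ^ l i = y ^ l i"
    by simp
  have c: "(1 - of_nat q * (y / \<t>)) / (of_nat q * (y / \<t>) * (1 - y / \<t>)) = (1 - \<t> * y) / (y * (\<t> - y))"
    using y ne by (simp add: t_squared[symmetric] divide_simps)
  have U: "U y = ((\<t> * y - 1) / (y * (\<t> - y)) + 1 / y) / 2"
    and V: "V y = ((\<t> * y - 1) / (y * (\<t> - y)) - 1 / y) / 2"
    using y by (simp_all add: slash_plus_def slash_minus_def divide_simps) algebra+
  have m: "- ((1 - \<t> * y) / (y * (\<t> - y))) = (\<t> * y - 1) / (y * (\<t> - y))"
    by (simp add: minus_divide_left)
  show ?thesis
    unfolding slash_simple_def plus_part_def minus_part_def S_def[symmetric] E_def[symmetric]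
      y_def[symmetric] x p c m U V
    by (simp add: hom_simps[OF S_hom] algebra_simps add_divide_distrib diff_divide_distrib)
qed

lemma S_Y_simple: "S i (Y (\<alpha> i)) = inverse (Y (\<alpha> i))"
  by (simp add: S_Y Y_uminus)

lemma E_Y_simple: "E i (Y (\<alpha> i)) = Y (\<alpha> i)"
  by (simp add: E_Y)

lemma hom_UV:
  assumes "substitution_hom h"
  shows "h (U y) = U (h y)" "h (V y) = V (h y)"
  by (simp_all add: slash_plus_def slash_minus_def hom_simps[OF assms])

lemmas SE_simps = hom_simps[OF S_hom] hom_simps[OF E_hom] hom_UV[OF S_hom] hom_UV[OF E_hom]

lemma slash_simple_involution: "T (T f i) i = f"
proof -
  define y where "y = Y (\<alpha> i)"
  define e where "e = ((-1) ^ l i :: 'n ratfun)"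
  have y: "y \<noteq> 0" "\<t> - y \<noteq> 0" "\<t> * y - 1 \<noteq> 0"
    using t_minus_Y[of "\<alpha> i"] by (simp_all add: y_def)
  have [simp]: "S i y = inverse y" "E i y = y" "S i e = e" "E i e = e" "e * e = 1"
    by (simp_all add: y_def e_def S_Y_simple E_Y_simple SE_simps flip: power_mult_distrib)
  have T: "T f i = y ^ l i * (U y * S i f + e * V y * S i (E i f))" for f
    by (simp add: slash_simple_eq y_def e_def)
  have "T (T f i) i = y ^ l i * inverse y ^ l i *
      ((U y * U (inverse y) + e * e * (V y * V (inverse y))) * f
        + e * (U y * V (inverse y) + V y * U (inverse y)) * E i f)"
    unfolding T by (simp add: SE_simps SE_relations algebra_simps)
  also have "\<dots> = f"
    using y slash_involution_identities[of y \<t>] by (simp flip: power_mult_distrib)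
  finally show ?thesis .
qed

lemma slash_simple_commute:
  assumes ij: "i \<noteq> j" "\<not> adjacent \<alpha> i j"
  shows "T (T f i) j = T (T f j) i"
proof -
  define y where "y = Y (\<alpha> i)"
  define z where "z = Y (\<alpha> j)"
  define e where "e = ((-1) ^ l i :: 'n ratfun)"
  define d where "d = ((-1) ^ l j :: 'n ratfun)"
  have ji: "j \<noteq> i" "\<not> adjacent \<alpha> j i"
    using ij by (auto simp: adjacent_sym)
  have s: "\<s> i (\<alpha> j) = \<alpha> j" "\<s> j (\<alpha> i) = \<alpha> i"
    using nonadjacent_inner[OF ij] by (simp_all add: s_eq inner_commute)
  have [simp]: "S j y = y" "E j y = y" "S j e = e" "E j e = e"
     "S i z = z" "E i z = z" "S i d = d" "E i d = d"
    using nonadjacent_inner[OF ij]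
    by (simp_all add: y_def z_def e_def d_def S_Y E_Y s inner_commute SE_simps)
  have Ti: "T f i = y ^ l i * (U y * S i f + e * V y * S i (E i f))"
    and Tj: "T f j = z ^ l j * (U z * S j f + d * V z * S j (E j f))" for f
    by (simp_all add: slash_simple_eq y_def e_def z_def d_def)
  have rel: "S j (S i g) = S i (S j g)" "E j (S i g) = S i (E j g)" "E i (S j g) = S j (E i g)"
      "E j (E i g) = E i (E j g)" for g
    using SE_nonadjacent[OF ij] SE_nonadjacent[OF ji] SE_relations by metis+
  show ?thesis
    unfolding Ti Tj by (simp add: SE_simps rel algebra_simps)
qed

lemma E_Y_adjacent: "adjacent \<alpha> i j \<Longrightarrow> E j (Y (\<alpha> i)) = - Y (\<alpha> i)"
proof -
  have "\<lfloor>- 1 :: real\<rfloor> = - 1"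
    by (simp add: floor_eq_iff)
  then show "adjacent \<alpha> i j \<Longrightarrow> E j (Y (\<alpha> i)) = - Y (\<alpha> i)"
    using adjacent_inner[of i j] by (simp add: E_Y power_int_minus)
qed

text \<open>The sign changes \<open>E i\<close> and \<open>E j\<close> can be moved to the right of the reflections, at the cost of replacing
  \<open>E j\<close> by \<open>E i E j\<close> when it passes \<open>S i\<close>. So an iterated slash operator is a combination of the four
  functions \<open>f\<close>, \<open>E i f\<close>, \<open>E j f\<close>, \<open>E i (E j f)\<close>, reflected; the braid relation compares their
  coefficients for the two orders of three factors.\<close>

lemma slash_simple_twice:
  assumes "adjacent \<alpha> i j"
  defines "y \<equiv> Y (\<alpha> i)" and "z \<equiv> Y (\<alpha> j)"
    and "e \<equiv> ((-1) ^ l i :: 'n ratfun)" and "d \<equiv> ((-1) ^ l j :: 'n ratfun)"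
  shows "T (T f i) j = z ^ l j * (y * z) ^ l i *
     (U z * U (y * z) * S j (S i f) + e * U z * V (y * z) * S j (S i (E i f))
      + d * e * V z * U (- (y * z)) * S j (S i (E i (E j f)))
      + d * V z * V (- (y * z)) * S j (S i (E j f)))"
proof -
  have E_minus: "E j y = - y"
    using E_Y_adjacent[OF assms(1)] by (simp add: y_def)
  have ji: "adjacent \<alpha> j i"
    using assms(1) by (simp add: adjacent_sym)
  have [simp]: "S j y = y * z" "S j e = e" "E j e = e" "e * e = 1"
    using s_adjacent[OF assms(1)]
    by (simp_all add: y_def z_def e_def S_Y Y_add SE_simps flip: power_mult_distrib)
  have [simp]: "e * (e * g) = g" for g
    by (simp flip: mult.assoc)
  have m: "(- (y * z)) ^ l i = e * (y * z) ^ l i"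
    by (simp add: e_def flip: power_mult_distrib)
  have Ti: "T f i = y ^ l i * (U y * S i f + e * V y * S i (E i f))"
    and Tj: "T f j = z ^ l j * (U z * S j f + d * V z * S j (E j f))" for f
    by (simp_all add: slash_simple_eq y_def e_def z_def d_def)
  have rel: "E j (S i g) = S i (E j (E i g))" "E j (E i g) = E i (E j g)" "E i (E i g) = g" for g
    using SE_adjacent(2)[OF ji] SE_relations by auto
  show ?thesis
    unfolding Ti Tj
    by (simp add: SE_simps E_minus m rel algebra_simps)
qed

lemma slash_simple_thrice:
  assumes "adjacent \<alpha> i j"
  defines "y \<equiv> Y (\<alpha> i)" and "z \<equiv> Y (\<alpha> j)"
    and "e \<equiv> ((-1) ^ l i :: 'n ratfun)" and "d \<equiv> ((-1) ^ l j :: 'n ratfun)"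
  shows "T (T (T f i) j) i = (y * z) ^ (l i + l j) *
     ((U y * U (y * z) * U z + V y * V (- (y * z)) * V z) * S i (S j (S i f))
      + e * (U y * U (y * z) * V z + V y * V (- (y * z)) * U z) * S i (S j (S i (E i f)))
      + d * (U y * V (y * z) * V (- z) + V y * U (- (y * z)) * U (- z)) * S i (S j (S i (E j f)))
      + d * e * (U y * V (y * z) * U (- z) + V y * U (- (y * z)) * V (- z))
          * S i (S j (S i (E i (E j f)))))"
proof -
  have ji: "adjacent \<alpha> j i"
    using assms(1) by (simp add: adjacent_sym)
  have y0: "y \<noteq> 0"
    by (simp add: y_def)
  have Sy: "S i y = inverse y" "S i z = y * z" "E i y = y" "E i z = - z"
    using s_adjacent[OF ji] E_Y_adjacent[OF ji] ji
    by (simp_all add: y_def z_def S_Y_simple E_Y_simple S_Y Y_add mult.commute)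
  have Syz: "inverse y * (y * z) = z"
    using y0 by simp
  have signs: "S i e = e" "E i e = e" "S i d = d" "E i d = d"
    by (simp_all add: e_def d_def SE_simps)
  have ed: "e * e = 1" "d * d = 1" "e * (e * g) = g" "d * (d * g) = g" for g
    by (simp_all add: e_def d_def flip: power_mult_distrib mult.assoc)
  have m: "(- g) ^ l i = e * g ^ l i" "(- g) ^ l j = d * g ^ l j" for g
    by (simp_all add: e_def d_def flip: power_mult_distrib)
  have rel: "E i (S j g) = S j (E i (E j g))" "E i (S i g) = S i (E i g)"
    "E j (S i g) = S i (E j (E i g))" "E j (E i g) = E i (E j g)" "E i (E i g) = g" "E j (E j g) = g"
    "E i (E j (E i g)) = E j g" for g
    using SE_adjacent(2)[OF ji] SE_adjacent(2)[OF assms(1)] SE_relations by simp_all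
  define h where "h = T (T f i) j"
  note h = slash_simple_twice[OF assms(1), of f, folded y_def z_def e_def d_def h_def]
  have Sh: "S i h = (y * z) ^ l j * z ^ l i *
     (U (y * z) * U z * S i (S j (S i f)) + e * U (y * z) * V z * S i (S j (S i (E i f)))
      + d * e * V (y * z) * U (- z) * S i (S j (S i (E i (E j f))))
      + d * V (y * z) * V (- z) * S i (S j (S i (E j f))))"
    unfolding h by (simp only: SE_simps Sy signs Syz mult_minus_left mult_minus_right)
  have Eh: "E i h = d * e * (z ^ l j * (y * z) ^ l i) *
     (U (- z) * U (- (y * z)) * S j (S i (E j f)) + e * U (- z) * V (- (y * z)) * S j (S i (E i (E j f)))
      + d * e * V (- z) * U (y * z) * S j (S i (E i f))
      + d * V (- z) * V (y * z) * S j (S i f))"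
    unfolding h by (simp add: SE_simps Sy signs m rel algebra_simps)
  have SEh: "S i (E i h) = d * e * ((y * z) ^ l j * z ^ l i) *
     (U (- (y * z)) * U (- z) * S i (S j (S i (E j f))) + e * U (- (y * z)) * V (- z) * S i (S j (S i (E i (E j f))))
      + d * e * V (- (y * z)) * U z * S i (S j (S i (E i f)))
      + d * V (- (y * z)) * V z * S i (S j (S i f)))"
    unfolding Eh by (simp only: SE_simps Sy signs Syz mult_minus_left mult_minus_right)
  have "T h i = y ^ l i * (U y * S i h + e * V y * S i (E i h))"
    by (simp add: slash_simple_eq y_def e_def)
  then show ?thesis
    unfolding Sh SEh unfolding h_def by (simp add: algebra_simps power_add ed)
qed

text \<open>The coefficients of \<open>f\<close> agree by inspection, those of \<open>E i f\<close> and \<open>E j f\<close> by the first braid identity,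
  used for \<open>(y, z)\<close> and for \<open>(z, y)\<close>, and those of \<open>E i (E j f)\<close> by the second.\<close>

lemma slash_simple_braid:
  assumes ij: "adjacent \<alpha> i j"
  shows "T (T (T f i) j) i = T (T (T f j) i) j"
proof -
  define y where "y = Y (\<alpha> i)"
  define z where "z = Y (\<alpha> j)"
  have ji: "adjacent \<alpha> j i"
    using ij by (simp add: adjacent_sym)
  have sum: "\<alpha> i + \<alpha> j \<noteq> 0"
    using s_adjacent[OF ij] by (metis s_simps(5,7) simple_neq_0)
  have yz: "y * z = Y (\<alpha> i + \<alpha> j)"
    by (simp add: y_def z_def Y_add)
  have ne: "\<t> - y \<noteq> 0" "\<t> - z \<noteq> 0" "\<t> - y * z \<noteq> 0" "\<t> + y \<noteq> 0" "\<t> + z \<noteq> 0" "\<t> + y * z \<noteq> 0"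
    using t_minus_Y[of "\<alpha> i"] t_minus_Y[of "\<alpha> j"] t_minus_Y[of "\<alpha> i + \<alpha> j"] sum
    unfolding yz by (simp_all add: y_def z_def lattice_add)
  have ne': "\<t> - z * y \<noteq> 0" "\<t> + z * y \<noteq> 0"
    using ne by (simp_all add: mult.commute)
  note ids = slash_braid_identities[OF ne]
  note ids' = slash_braid_identities[OF ne(2,1) ne'(1) ne(5,4) ne'(2)]
  show ?thesis
    unfolding slash_simple_thrice[OF ij] slash_simple_thrice[OF ji] y_def[symmetric] z_def[symmetric]
      SE_adjacent(1)[OF ij] ids ids'(1) SE_relations(4)[of i j]
    by (simp add: mult_ac add_ac)
qed

section \<open>Invariance of the averaged function\<close>

lemma slash_simple_add: "T (f + g) i = T f i + T g i"
  by (simp add: slash_simple_eq SE_simps algebra_simps)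

lemma slash_simple_sum: "T (sum F A) i = (\<Sum>x\<in>A. T (F x) i)"
proof -
  have "T 0 i = 0"
    by (simp add: slash_simple_eq SE_simps)
  then show ?thesis
    by (induction A rule: infinite_finite_induct) (simp_all add: slash_simple_add)
qed

text \<open>The slash operators are linear over functions that do not change under \<open>\<epsilon>\<^sub>i\<close>, up to reflecting them.\<close>

lemma slash_simple_mult: "E i g = g \<Longrightarrow> T (g * f) i = S i g * T f i"
  by (simp add: slash_simple_eq SE_simps algebra_simps)

definition S_word :: "'n list \<Rightarrow> 'n ratfun \<Rightarrow> 'n ratfun" where
  "S_word is f = foldl (\<lambda>g i. S i g) f is"

lemma S_word_snoc: "S_word (is @ [i]) f = S i (S_word is f)"
  by (simp add: S_word_def)

lemma S_word_Cons: "S_word (i # is) f = S_word is (S i f)"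
  by (simp add: S_word_def)

lemma S_word_hom: "substitution_hom (S_word is)"
  by (induction "is" rule: rev_induct)
     (simp_all add: S_word_snoc substitution_hom_comp[OF S_hom] S_word_def substitution_hom_id
        substitution_hom_def hom_simps[OF S_hom])

lemma S_word_Y: "\<mu> \<in> \<Lambda> \<Longrightarrow> S_word is (Y \<mu>) = Y (word_prod (rev is) \<mu>)"
  by (induction "is" rule: rev_induct) (simp_all add: S_word_snoc word_prod_Cons S_Y, simp add: S_word_def)

lemma S_word_cong: "word_prod is = word_prod js \<Longrightarrow> S_word is f = S_word js f"
proof (rule hom_eqI[OF S_word_hom S_word_hom])
  fix j assume "word_prod is = word_prod js"
  then have "word_prod (rev is) = word_prod (rev js)"
    by (metis inv_word_prod)
  then show "S_word is (Y (\<alpha> j)) = S_word js (Y (\<alpha> j))"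
    by (simp add: S_word_Y)
qed

lemma sigma_point_hom:
  assumes "substitution_hom h"
  shows "sigma_point \<alpha> q i (\<lambda>j. h (rf_var j)) j = h (S i (rf_var j))"
  by (simp add: S_var sigma_point_def hom_simps[OF assms])

lemma foldr_sigma_point: "foldr (sigma_point \<alpha> q) is rf_var = (\<lambda>j. S_word is (rf_var j))"
proof (induction "is")
  case (Cons i "is")
  show ?case
    by (simp add: Cons.IH S_word_Cons fun_eq_iff sigma_point_hom[OF S_word_hom])
qed (simp add: S_word_def)

abbreviation \<Delta> :: "'n ratfun" where
  "\<Delta> \<equiv> Delta_at \<Phi> \<alpha> q rf_var"

lemma Delta_at_hom: "substitution_hom h \<Longrightarrow> Delta_at \<Phi> \<alpha> q (\<lambda>j. h (rf_var j)) = h \<Delta>"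
  by (simp add: Delta_at_def monomial_at_def hom_simps)

lemma Delta_at_weyl_point: "Delta_at \<Phi> \<alpha> q (weyl_point \<alpha> q w rf_var) = S_word (word_of \<alpha> w) \<Delta>"
  by (simp add: weyl_point_def foldr_sigma_point Delta_at_hom[OF S_word_hom])

lemma root_height_double: "\<beta> \<in> \<Lambda> \<Longrightarrow> root_height \<alpha> (2 *\<^sub>R \<beta>) = 2 * root_height \<alpha> \<beta>"
  using root_coords_scale[of \<beta> 2] by (simp add: root_height_def sum_distrib_left)

lemma Y_double_eq:
  assumes "\<beta> \<in> \<Lambda>"
  shows "Y (2 *\<^sub>R \<beta>) = of_nat q powi root_height \<alpha> \<beta> * monomial_at \<alpha> rf_var (2 *\<^sub>R \<beta>)"
  by (simp add: Y_eq_monomial root_height_double assms power_int_mult power2_eq_square t_squared)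

lemma positive_lattice: "\<beta> \<in> P \<Longrightarrow> \<beta> \<in> \<Lambda>"
  by (simp add: positive_root root_lattice)

lemma Delta_eq: "\<Delta> = (\<Prod>\<beta>\<in>P. 1 - Y (2 *\<^sub>R \<beta>))"
  unfolding Delta_at_def by (rule prod.cong) (simp_all add: Y_double_eq positive_lattice)

lemma one_minus_Y_neq_0:
  assumes "\<mu> \<in> \<Phi>" shows "1 - Y (2 *\<^sub>R \<mu>) \<noteq> 0"
  using binomial_neq_0[of "2 *\<^sub>R \<mu>" 1 "-1"] lattice_scale2[OF root_lattice[OF assms]]
    zero_not_root assms by (auto simp: rf_const_uminus)

lemma S_word_Delta: "S_word is \<Delta> = (\<Prod>\<beta>\<in>P. 1 - Y (2 *\<^sub>R word_prod (rev is) \<beta>))"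
  by (simp add: Delta_eq hom_simps[OF S_word_hom] S_word_Y positive_lattice lattice_scale2)

lemma Delta_neq_0 [simp]: "\<Delta> \<noteq> 0"
  unfolding Delta_eq prod_zero_iff[OF finite_positive]
  using one_minus_Y_neq_0 positive_root by blast

lemma E_Y_double: "\<mu> \<in> \<Lambda> \<Longrightarrow> E i (Y (2 *\<^sub>R \<mu>)) = Y (2 *\<^sub>R \<mu>)"
  by (simp add: Y_double hom_simps[OF E_hom] E_Y power_mult_distrib power2_eq_square[of "(-1) powi _"]
      flip: power_int_mult_distrib)

lemma E_S_word_Delta: "E i (S_word is \<Delta>) = S_word is \<Delta>"
  by (simp add: S_word_Delta hom_simps[OF E_hom] E_Y_double positive_lattice)

text \<open>Along a word for \<open>w\<close> this is the summand \<open>j(w, x) (1 | w)(x) / \<Delta>(x)\<close> of the average, since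
  \<open>j(w, x) / \<Delta>(x) = 1 / \<Delta>(w x)\<close>.\<close>

definition average_term :: "'n list \<Rightarrow> 'n ratfun" where
  "average_term is = inverse (S_word is \<Delta>) * foldl T 1 is"

lemma average_term_snoc: "average_term (is @ [i]) = T (average_term is) i"
proof -
  have "E i (inverse (S_word is \<Delta>)) = inverse (S_word is \<Delta>)"
    by (simp add: hom_inverse[OF E_hom] E_S_word_Delta)
  from slash_simple_mult[OF this, of "foldl T 1 is"] show ?thesis
    by (simp add: average_term_def S_word_snoc hom_inverse[OF S_hom])
qed

lemma average_term_cong: "word_prod is = word_prod js \<Longrightarrow> average_term is = average_term js"
proof -
  assume eq: "word_prod is = word_prod js"
  have "foldl T 1 is = foldl T 1 js"
  proof (rule words_act_equally)
    show "T (T f i) i = f" for f i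
      by (rule slash_simple_involution)
    show "T (T f i) j = T (T f j) i" if "i \<noteq> j" "\<not> adjacent \<alpha> i j" for f i j
      using that by (rule slash_simple_commute)
    show "T (T (T f i) j) i = T (T (T f j) i) j" if "adjacent \<alpha> i j" for f i j
      using that by (rule slash_simple_braid)
  qed (fact eq)
  then show ?thesis
    by (simp add: average_term_def S_word_cong[OF eq])
qed

lemma f_fun_eq: "f_fun \<Phi> \<alpha> q l = (\<Sum>w\<in>weyl_group \<Phi>. average_term (word_of \<alpha> w))"
  unfolding f_fun_def sum_distrib_left
  by (intro sum.cong refl)
     (simp add: j_factor_def Delta_at_weyl_point slash_def average_term_def divide_inverse
        flip: mult.assoc)

text \<open>The operator \<open>| \<sigma>\<^sub>i\<close> turns the summand of \<open>w\<close> into that of \<open>w \<sigma>\<^sub>i\<close>.\<close>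

lemma f_fun_invariant: "T (f_fun \<Phi> \<alpha> q l) i = f_fun \<Phi> \<alpha> q l"
proof -
  have closed: "w \<circ> \<s> i \<in> weyl_group \<Phi>" if w: "w \<in> weyl_group \<Phi>" for w
  proof -
    obtain "is" where "w = word_prod is"
      using w by (auto simp: weyl_group_eq_words)
    then have "w \<circ> \<s> i = word_prod (is @ [i])"
      by (simp only: word_prod_snoc)
    then show ?thesis
      by (simp only: word_prod_weyl)
  qed
  have term_s: "T (average_term (word_of \<alpha> w)) i = average_term (word_of \<alpha> (w \<circ> \<s> i))"
    if "w \<in> weyl_group \<Phi>" for w
    unfolding average_term_snoc[symmetric]
    by (rule average_term_cong) (simp only: word_prod_snoc word_prod_word_of that closed)
  have "bij_betw (\<lambda>w. w \<circ> \<s> i) (weyl_group \<Phi>) (weyl_group \<Phi>)"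
    by (rule bij_betw_byWitness[of _ "\<lambda>w. w \<circ> \<s> i"]) (use closed in \<open>auto simp: fun_eq_iff\<close>)
  then show ?thesis
    unfolding f_fun_eq slash_simple_sum
    by (simp add: term_s sum.reindex_bij_betw[of _ _ _ "\<lambda>w. average_term (word_of \<alpha> w)", symmetric]
        cong: sum.cong)
qed

section \<open>Laurent expansions\<close>

text \<open>The coefficient function is defined on all of the Euclidean space, so that it can be composed with
  translations and reflections.\<close>

definition has_laurent :: "'n ratfun \<Rightarrow> ('a \<Rightarrow> complex) \<Rightarrow> bool" where
  "has_laurent f b \<longleftrightarrow> (\<exists>A. finite A \<and> A \<subseteq> \<Lambda> \<and> (\<forall>\<mu>. \<mu> \<notin> A \<longrightarrow> b \<mu> = 0)
      \<and> f = (\<Sum>\<mu>\<in>A. rf_const (b \<mu>) * Y \<mu>))"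

lemma has_laurent_on:
  assumes "has_laurent f b" "finite B" "B \<subseteq> \<Lambda>"
  shows "\<exists>A. finite A \<and> B \<subseteq> A \<and> A \<subseteq> \<Lambda> \<and> (\<forall>\<mu>. \<mu> \<notin> A \<longrightarrow> b \<mu> = 0)
    \<and> f = (\<Sum>\<mu>\<in>A. rf_const (b \<mu>) * Y \<mu>)"
proof -
  obtain A where A: "finite A" "A \<subseteq> \<Lambda>" "\<forall>\<mu>. \<mu> \<notin> A \<longrightarrow> b \<mu> = 0" "f = (\<Sum>\<mu>\<in>A. rf_const (b \<mu>) * Y \<mu>)"
    using assms(1) unfolding has_laurent_def by blast
  moreover have "(\<Sum>\<mu>\<in>A. rf_const (b \<mu>) * Y \<mu>) = (\<Sum>\<mu>\<in>A \<union> B. rf_const (b \<mu>) * Y \<mu>)"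
    by (rule sum.mono_neutral_left) (use A assms in auto)
  ultimately show ?thesis
    using assms(2,3) by (intro exI[of _ "A \<union> B"]) auto
qed

lemma has_laurent_common:
  assumes "has_laurent f b" "has_laurent g c"
  obtains A where "finite A" "A \<subseteq> \<Lambda>" "\<forall>\<mu>. \<mu> \<notin> A \<longrightarrow> b \<mu> = 0" "\<forall>\<mu>. \<mu> \<notin> A \<longrightarrow> c \<mu> = 0"
    "f = (\<Sum>\<mu>\<in>A. rf_const (b \<mu>) * Y \<mu>)" "g = (\<Sum>\<mu>\<in>A. rf_const (c \<mu>) * Y \<mu>)"
proof -
  obtain A where A: "finite A" "A \<subseteq> \<Lambda>" "\<forall>\<mu>. \<mu> \<notin> A \<longrightarrow> c \<mu> = 0"
    "g = (\<Sum>\<mu>\<in>A. rf_const (c \<mu>) * Y \<mu>)"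
    using assms(2) unfolding has_laurent_def by blast
  obtain C where C: "finite C" "A \<subseteq> C" "C \<subseteq> \<Lambda>" "\<forall>\<mu>. \<mu> \<notin> C \<longrightarrow> b \<mu> = 0"
    "f = (\<Sum>\<mu>\<in>C. rf_const (b \<mu>) * Y \<mu>)"
    using has_laurent_on[OF assms(1) A(1,2)] by blast
  have "g = (\<Sum>\<mu>\<in>C. rf_const (c \<mu>) * Y \<mu>)"
    unfolding A(4) by (rule sum.mono_neutral_left) (use A C in auto)
  moreover have "\<forall>\<mu>. \<mu> \<notin> C \<longrightarrow> c \<mu> = 0"
    using A(3) C(2) by blast
  ultimately show thesis
    using C that by blast
qed

lemma has_laurent_unique:
  assumes "has_laurent f b" "has_laurent f c"
  shows "b = c"
proof
  fix \<mu>
  obtain A where A: "finite A" "A \<subseteq> \<Lambda>" "\<forall>\<mu>. \<mu> \<notin> A \<longrightarrow> b \<mu> = 0" "\<forall>\<mu>. \<mu> \<notin> A \<longrightarrow> c \<mu> = 0"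
    "f = (\<Sum>\<mu>\<in>A. rf_const (b \<mu>) * Y \<mu>)" "f = (\<Sum>\<mu>\<in>A. rf_const (c \<mu>) * Y \<mu>)"
    by (rule has_laurent_common[OF assms]) (rule that)
  then have "(\<Sum>\<mu>\<in>A. rf_const (b \<mu> - c \<mu>) * Y \<mu>) = 0"
    by (simp add: rf_const_diff left_diff_distrib sum_subtractf)
  from Y_independent[OF A(1,2) this, of \<mu>] A(3,4) show "b \<mu> = c \<mu>"
    by (cases "\<mu> \<in> A") auto
qed

lemma has_laurent_0: "has_laurent 0 (\<lambda>_. 0)"
  by (auto simp: has_laurent_def)

lemma has_laurent_add:
  assumes "has_laurent f b" "has_laurent g c"
  shows "has_laurent (f + g) (\<lambda>\<mu>. b \<mu> + c \<mu>)"
proof -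
  obtain A where "finite A" "A \<subseteq> \<Lambda>" "\<forall>\<mu>. \<mu> \<notin> A \<longrightarrow> b \<mu> = 0" "\<forall>\<mu>. \<mu> \<notin> A \<longrightarrow> c \<mu> = 0"
    "f = (\<Sum>\<mu>\<in>A. rf_const (b \<mu>) * Y \<mu>)" "g = (\<Sum>\<mu>\<in>A. rf_const (c \<mu>) * Y \<mu>)"
    by (rule has_laurent_common[OF assms]) (rule that)
  then show ?thesis
    unfolding has_laurent_def
    by (intro exI[of _ A]) (simp add: rf_const_add distrib_right sum.distrib)
qed

lemma has_laurent_scale:
  assumes "has_laurent f b"
  shows "has_laurent (rf_const c * f) (\<lambda>\<mu>. c * b \<mu>)"
proof -
  obtain A where "finite A" "A \<subseteq> \<Lambda>" "\<forall>\<mu>. \<mu> \<notin> A \<longrightarrow> b \<mu> = 0" "f = (\<Sum>\<mu>\<in>A. rf_const (b \<mu>) * Y \<mu>)"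
    using assms unfolding has_laurent_def by blast
  then show ?thesis
    unfolding has_laurent_def
    by (intro exI[of _ A]) (simp add: rf_const_mult sum_distrib_left mult.assoc)
qed

lemma has_laurent_reindex:
  assumes b: "has_laurent f b" and "\<And>\<mu>. g (h \<mu>) = \<mu>" "\<And>\<mu>. h (g \<mu>) = \<mu>"
    "\<And>\<mu>. \<mu> \<in> \<Lambda> \<Longrightarrow> g \<mu> \<in> \<Lambda>"
    and F: "\<And>A. finite A \<Longrightarrow> A \<subseteq> \<Lambda> \<Longrightarrow>
        F (\<Sum>\<mu>\<in>A. rf_const (b \<mu>) * Y \<mu>) = (\<Sum>\<mu>\<in>A. rf_const (c (g \<mu>)) * Y (g \<mu>))"
    and c: "\<And>\<mu>. b (h \<mu>) = 0 \<Longrightarrow> c \<mu> = 0"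
  shows "has_laurent (F f) c"
proof -
  obtain A where A: "finite A" "A \<subseteq> \<Lambda>" "\<forall>\<mu>. \<mu> \<notin> A \<longrightarrow> b \<mu> = 0" "f = (\<Sum>\<mu>\<in>A. rf_const (b \<mu>) * Y \<mu>)"
    using b unfolding has_laurent_def by blast
  have "F f = (\<Sum>\<mu>\<in>g ` A. rf_const (c \<mu>) * Y \<mu>)"
    unfolding A(4) F[OF A(1,2)] by (subst sum.reindex) (auto intro: inj_on_inverseI[of _ h] assms(3))
  moreover have "c \<mu> = 0" if "\<mu> \<notin> g ` A" for \<mu>
    using that A(3) c assms(2) by (metis imageI)
  ultimately show ?thesis
    unfolding has_laurent_def using A assms(4) by (intro exI[of _ "g ` A"]) auto
qed

lemma has_laurent_shift:
  assumes "has_laurent f b" "\<nu> \<in> \<Lambda>"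
  shows "has_laurent (Y \<nu> * f) (\<lambda>\<mu>. b (\<mu> - \<nu>))"
  by (rule has_laurent_reindex[OF assms(1), of "\<lambda>\<mu>. \<mu> + \<nu>" "\<lambda>\<mu>. \<mu> - \<nu>" "\<lambda>f. Y \<nu> * f"])
     (use assms(2) in \<open>auto simp: sum_distrib_left Y_add subset_iff intro!: sum.cong\<close>)

lemma has_laurent_S:
  assumes "has_laurent f b"
  shows "has_laurent (S i f) (\<lambda>\<mu>. b (\<s> i \<mu>))"
  by (rule has_laurent_reindex[OF assms, of "\<s> i" "\<s> i" "S i"])
     (auto simp: hom_simps[OF S_hom] S_Y subset_iff intro!: sum.cong)

lemma has_laurent_E:
  assumes "has_laurent f b"
  shows "has_laurent (E i f) (\<lambda>\<mu>. (-1) powi \<lfloor>\<mu> \<bullet> \<alpha> i\<rfloor> * b \<mu>)"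
  by (rule has_laurent_reindex[OF assms, of "\<lambda>\<mu>. \<mu>" "\<lambda>\<mu>. \<mu>" "E i"])
     (auto simp: hom_simps[OF E_hom] E_Y subset_iff rf_const_mult rf_const_powi rf_const_uminus
        intro!: sum.cong)

lemma has_laurent_monomial: "\<mu> \<in> \<Lambda> \<Longrightarrow> has_laurent (rf_const c * Y \<mu>) (\<lambda>\<nu>. if \<nu> = \<mu> then c else 0)"
  unfolding has_laurent_def by (rule exI[of _ "{\<mu>}"]) auto

definition laurent_supported :: "'a set \<Rightarrow> 'n ratfun set" where
  "laurent_supported A = {f. \<exists>b. has_laurent f b \<and> (\<forall>\<mu>. b \<mu> \<noteq> 0 \<longrightarrow> \<mu> \<in> A)}"

lemma supported_0: "0 \<in> laurent_supported A"
  unfolding laurent_supported_def using has_laurent_0 by blast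

lemma supported_add:
  "f \<in> laurent_supported A \<Longrightarrow> g \<in> laurent_supported A \<Longrightarrow> f + g \<in> laurent_supported A"
proof -
  assume "f \<in> laurent_supported A" "g \<in> laurent_supported A"
  then obtain b c where "has_laurent f b" "\<And>\<mu>. b \<mu> \<noteq> 0 \<Longrightarrow> \<mu> \<in> A"
    "has_laurent g c" "\<And>\<mu>. c \<mu> \<noteq> 0 \<Longrightarrow> \<mu> \<in> A"
    by (auto simp: laurent_supported_def)
  then have "has_laurent (f + g) (\<lambda>\<mu>. b \<mu> + c \<mu>)" "\<And>\<mu>. b \<mu> + c \<mu> \<noteq> 0 \<Longrightarrow> \<mu> \<in> A"
    using has_laurent_add by (blast, metis add.right_neutral)
  then show ?thesis
    by (auto simp: laurent_supported_def)
qed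

lemma supported_sum:
  "(\<And>x. x \<in> X \<Longrightarrow> F x \<in> laurent_supported A) \<Longrightarrow> sum F X \<in> laurent_supported A"
  by (induction X rule: infinite_finite_induct) (auto intro: supported_0 supported_add)

lemma supported_monomial:
  "\<mu> \<in> \<Lambda> \<Longrightarrow> \<mu> \<in> A \<Longrightarrow> rf_const c * Y \<mu> \<in> laurent_supported A"
  unfolding laurent_supported_def
  by (auto intro!: exI[of _ "\<lambda>\<nu>. if \<nu> = \<mu> then c else 0"] has_laurent_monomial split: if_splits)

lemma supported_mult:
  assumes "f \<in> laurent_supported A" "g \<in> laurent_supported B"
    and C: "\<And>\<mu> \<nu>. \<mu> \<in> A \<Longrightarrow> \<nu> \<in> B \<Longrightarrow> \<mu> + \<nu> \<in> C"
  shows "f * g \<in> laurent_supported C"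
proof -
  obtain b c where b: "has_laurent f b" "\<And>\<mu>. b \<mu> \<noteq> 0 \<Longrightarrow> \<mu> \<in> A"
    and c: "has_laurent g c" "\<And>\<mu>. c \<mu> \<noteq> 0 \<Longrightarrow> \<mu> \<in> B"
    using assms(1,2) by (auto simp: laurent_supported_def)
  obtain X where X: "finite X" "X \<subseteq> \<Lambda>" "f = (\<Sum>\<mu>\<in>X. rf_const (b \<mu>) * Y \<mu>)"
    using b(1) unfolding has_laurent_def by blast
  obtain Z where Z: "finite Z" "Z \<subseteq> \<Lambda>" "g = (\<Sum>\<mu>\<in>Z. rf_const (c \<mu>) * Y \<mu>)"
    using c(1) unfolding has_laurent_def by blast
  have "f * g = (\<Sum>\<mu>\<in>X. \<Sum>\<nu>\<in>Z. rf_const (b \<mu> * c \<nu>) * Y (\<mu> + \<nu>))"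
    unfolding X(3) Z(3) sum_product
    by (intro sum.cong refl) (use X Z in \<open>auto simp: Y_add rf_const_mult subset_iff\<close>)
  also have "\<dots> \<in> laurent_supported C"
  proof (intro supported_sum)
    fix \<mu> \<nu> assume "\<mu> \<in> X" "\<nu> \<in> Z"
    with X Z have "\<mu> + \<nu> \<in> \<Lambda>" by auto
    then show "rf_const (b \<mu> * c \<nu>) * Y (\<mu> + \<nu>) \<in> laurent_supported C"
      using b(2)[of \<mu>] c(2)[of \<nu>] C supported_0 supported_monomial
      by (cases "b \<mu> = 0 \<or> c \<nu> = 0") auto
  qed
  finally show ?thesis .
qed

lemma supported_mono: "f \<in> laurent_supported A \<Longrightarrow> A \<subseteq> B \<Longrightarrow> f \<in> laurent_supported B"
  unfolding laurent_supported_def by blast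

lemma supported_disjoint:
  assumes "f \<in> laurent_supported A" "f \<in> laurent_supported B" "A \<inter> B = {}"
  shows "f = 0"
proof -
  obtain b c where "has_laurent f b" "\<And>\<mu>. b \<mu> \<noteq> 0 \<Longrightarrow> \<mu> \<in> A"
    "has_laurent f c" "\<And>\<mu>. c \<mu> \<noteq> 0 \<Longrightarrow> \<mu> \<in> B"
    using assms(1,2) by (auto simp: laurent_supported_def)
  then have "b = (\<lambda>_. 0)" "has_laurent f b"
    using has_laurent_unique assms(3) by (blast, blast)
  then show ?thesis
    by (auto simp: has_laurent_def)
qed

lemma supported_uminus: "f \<in> laurent_supported A \<Longrightarrow> - f \<in> laurent_supported A"
  using supported_mult[of "rf_const (-1) * Y 0" "{0}" f A A] supported_monomial[of 0 "{0}" "-1"]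
  by (simp add: rf_const_uminus)

lemma supported_S:
  "f \<in> laurent_supported A \<Longrightarrow> S i f \<in> laurent_supported {\<mu>. \<s> i \<mu> \<in> A}"
  unfolding laurent_supported_def using has_laurent_S by blast

lemma supported_E: "f \<in> laurent_supported A \<Longrightarrow> E i f \<in> laurent_supported A"
  unfolding laurent_supported_def using has_laurent_E by fastforce

section \<open>The shifted highest weight\<close>

lemma weyl_vector_inner: "weyl_vector \<Phi> \<alpha> \<bullet> \<alpha> i = 1"
proof -
  let ?v = "\<Sum>\<beta>\<in>P. \<beta>"
  have split: "?v = \<alpha> i + (\<Sum>\<beta>\<in>P - {\<alpha> i}. \<beta>)"
    by (rule sum.remove) simp_all
  have "\<s> i ?v = - \<alpha> i + (\<Sum>\<beta>\<in>P - {\<alpha> i}. \<s> i \<beta>)"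
    unfolding split by (simp add: s_sum)
  also have "(\<Sum>\<beta>\<in>P - {\<alpha> i}. \<s> i \<beta>) = (\<Sum>\<beta>\<in>P - {\<alpha> i}. \<beta>)"
    by (rule sum.reindex_bij_betw[OF s_permutes_positive])
  finally have "\<s> i ?v = ?v - 2 *\<^sub>R \<alpha> i"
    unfolding split by (simp add: scaleR_2)
  then have "(?v \<bullet> \<alpha> i) *\<^sub>R \<alpha> i = 2 *\<^sub>R \<alpha> i"
    by (simp add: s_eq)
  then show ?thesis
    by (simp add: weyl_vector_def)
qed

lemma fundamental_weight_inner: "fundamental_weight \<alpha> i \<bullet> \<alpha> j = (if i = j then 1 else 0)"
proof -
  obtain g :: "'a \<Rightarrow> real" where g: "linear g"
    "\<forall>x\<in>range \<alpha>. g x = (if x = \<alpha> i then 1 else 0)"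
    using linear_independent_extend[OF indep_simple, of "\<lambda>x. if x = \<alpha> i then 1 else 0"] by blast
  have "\<forall>j. adjoint g 1 \<bullet> \<alpha> j = (if i = j then 1 else 0)"
    using g(2) adjoint_works[OF g(1), of _ 1] inj_simple by (auto simp: inner_commute inj_eq)
  moreover have "v = adjoint g 1" if "\<forall>j. v \<bullet> \<alpha> j = (if i = j then 1 else 0)" for v
    using that calculation eq_0_if_inner_simple_0[of "v - adjoint g 1"]
    by (simp add: inner_diff_left)
  ultimately have "\<forall>j. fundamental_weight \<alpha> i \<bullet> \<alpha> j = (if i = j then 1 else 0)"
    unfolding fundamental_weight_def by (rule theI)
  then show ?thesis by blast
qed

definition \<theta> :: 'a where
  "\<theta> = weyl_vector \<Phi> \<alpha> + (\<Sum>k\<in>UNIV. real (l k) *\<^sub>R fundamental_weight \<alpha> k)"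

lemma theta_inner_simple: "\<theta> \<bullet> \<alpha> i = real (l i) + 1"
  by (simp add: \<theta>_def inner_add_left inner_sum_left weyl_vector_inner fundamental_weight_inner
      if_distrib[of "\<lambda>c. _ * c"] cong: if_cong)

lemma s_theta: "\<s> i \<theta> = \<theta> - (real (l i) + 1) *\<^sub>R \<alpha> i"
  by (simp add: s_eq theta_inner_simple)

lemma theta_inner_positive:
  assumes "\<beta> \<in> P"
  shows "0 < \<theta> \<bullet> \<beta>"
proof -
  have \<beta>: "\<beta> = (\<Sum>i\<in>UNIV. real_of_int (root_coords \<alpha> \<beta> i) *\<^sub>R \<alpha> i)"
    using assms positive_lattice lattice_expansion by blast
  have nonneg: "0 \<le> root_coords \<alpha> \<beta> i" for i
    using assms by (simp add: positive_root_iff)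
  have "\<exists>i. root_coords \<alpha> \<beta> i \<noteq> 0"
  proof (rule ccontr)
    assume "\<not> ?thesis"
    with \<beta> have "\<beta> = 0" by simp
    with assms zero_not_root positive_root show False by blast
  qed
  then obtain i where i: "0 < root_coords \<alpha> \<beta> i"
    using nonneg by (metis less_le)
  have "\<theta> \<bullet> \<beta> = (\<Sum>i\<in>UNIV. real_of_int (root_coords \<alpha> \<beta> i) * (real (l i) + 1))"
    by (subst \<beta>) (simp add: inner_sum_right theta_inner_simple)
  also have "\<dots> > 0"
    by (rule sum_pos2[of _ i]) (use i nonneg in auto)
  finally show ?thesis .
qed

lemma theta_diff_lattice: "\<theta> - word_prod is \<theta> \<in> \<Lambda>"
  and word_prod_theta_inner_int: "word_prod is \<theta> \<bullet> \<alpha> i \<in> \<int>"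
proof -
  have int: "word_prod is \<theta> \<bullet> \<alpha> i \<in> \<int>" if "\<theta> - word_prod is \<theta> \<in> \<Lambda>" for "is" i
  proof -
    have "word_prod is \<theta> \<bullet> \<alpha> i = real (l i) + 1 - (\<theta> - word_prod is \<theta>) \<bullet> \<alpha> i"
      by (simp add: inner_diff_left theta_inner_simple)
    then show ?thesis
      using lattice_inner_int[OF that, of i] by simp
  qed
  show lattice: "\<theta> - word_prod is \<theta> \<in> \<Lambda>" for "is"
  proof (induction "is")
    case (Cons j "is")
    obtain c where "word_prod is \<theta> \<bullet> \<alpha> j = real_of_int c"
      using int[OF Cons] by (auto elim: Ints_cases)
    then have "\<theta> - word_prod (j # is) \<theta> = (\<theta> - word_prod is \<theta>) + real_of_int c *\<^sub>R \<alpha> j"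
      by (simp add: word_prod_Cons s_eq)
    then show ?case
      using lattice_add[OF Cons lattice_scale[OF simple_lattice, of c j]] by (simp only:)
  qed simp
  show "word_prod is \<theta> \<bullet> \<alpha> i \<in> \<int>"
    by (rule int[OF lattice])
qed

section \<open>Weighted order of vanishing\<close>

text \<open>
  \<open>order_ge x c f\<close> says that \<open>f\<close> has order at least \<open>c\<close> when \<open>Y \<mu>\<close> is given the weight \<open>\<langle>x, \<mu>\<rangle>\<close>: up to
  a denominator whose part of lowest weight \<open>m\<close> does not vanish, \<open>f\<close> only involves weights from
  \<open>c + m\<close> on.
\<close>

definition order_ge :: "'a \<Rightarrow> real \<Rightarrow> 'n ratfun \<Rightarrow> bool" where
  "order_ge x c f \<longleftrightarrow> (\<exists>p g h m. p \<in> laurent_supported {\<mu>. c + m \<le> x \<bullet> \<mu>}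
     \<and> g \<in> laurent_supported {\<mu>. x \<bullet> \<mu> = m} \<and> h \<in> laurent_supported {\<mu>. m < x \<bullet> \<mu>}
     \<and> g \<noteq> 0 \<and> f * (g + h) = p)"

lemma order_geI:
  assumes "p \<in> laurent_supported {\<mu>. c + m \<le> x \<bullet> \<mu>}" "g \<in> laurent_supported {\<mu>. x \<bullet> \<mu> = m}"
    "h \<in> laurent_supported {\<mu>. m < x \<bullet> \<mu>}" "g \<noteq> 0" "f * (g + h) = p"
  shows "order_ge x c f"
  using assms unfolding order_ge_def by blast

lemma order_ge_denominator:
  assumes "g \<in> laurent_supported {\<mu>. x \<bullet> \<mu> = m}" "h \<in> laurent_supported {\<mu>. m < x \<bullet> \<mu>}" "g \<noteq> 0"
    "g' \<in> laurent_supported {\<mu>. x \<bullet> \<mu> = m'}" "h' \<in> laurent_supported {\<mu>. m' < x \<bullet> \<mu>}" "g' \<noteq> 0"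
  shows "g * g' \<in> laurent_supported {\<mu>. x \<bullet> \<mu> = m + m'}"
    "g * h' + h * g' + h * h' \<in> laurent_supported {\<mu>. m + m' < x \<bullet> \<mu>}" "g * g' \<noteq> 0"
  using assms by (auto intro!: supported_add supported_mult[of g _ g'] supported_mult[of g _ h']
      supported_mult[of h _ g'] supported_mult[of h _ h'] simp: inner_add_right add_strict_mono)

lemma order_ge_add:
  assumes "order_ge x c f" "order_ge x c f'"
  shows "order_ge x c (f + f')"
proof -
  obtain p g h m where f: "p \<in> laurent_supported {\<mu>. c + m \<le> x \<bullet> \<mu>}"
    "g \<in> laurent_supported {\<mu>. x \<bullet> \<mu> = m}" "h \<in> laurent_supported {\<mu>. m < x \<bullet> \<mu>}" "g \<noteq> 0"
    "f * (g + h) = p"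
    using assms(1) unfolding order_ge_def by blast
  obtain p' g' h' m' where f': "p' \<in> laurent_supported {\<mu>. c + m' \<le> x \<bullet> \<mu>}"
    "g' \<in> laurent_supported {\<mu>. x \<bullet> \<mu> = m'}" "h' \<in> laurent_supported {\<mu>. m' < x \<bullet> \<mu>}" "g' \<noteq> 0"
    "f' * (g' + h') = p'"
    using assms(2) unfolding order_ge_def by blast
  have d: "g + h \<in> laurent_supported {\<mu>. m \<le> x \<bullet> \<mu>}" "g' + h' \<in> laurent_supported {\<mu>. m' \<le> x \<bullet> \<mu>}"
    by (auto intro!: supported_add intro: supported_mono[OF f(2)] supported_mono[OF f(3)]
        supported_mono[OF f'(2)] supported_mono[OF f'(3)])
  show ?thesis
  proof (rule order_geI)
    show "p * (g' + h') + p' * (g + h) \<in> laurent_supported {\<mu>. c + (m + m') \<le> x \<bullet> \<mu>}"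
      by (rule supported_add; rule supported_mult) (use f(1) f'(1) d in \<open>auto simp: inner_add_right\<close>)
    show "(f + f') * (g * g' + (g * h' + h * g' + h * h')) = p * (g' + h') + p' * (g + h)"
      unfolding f(5)[symmetric] f'(5)[symmetric] by (simp add: algebra_simps)
  qed (use order_ge_denominator[OF f(2-4) f'(2-4)] in auto)
qed

lemma order_ge_mult:
  assumes "order_ge x c f" "order_ge x c' f'"
  shows "order_ge x (c + c') (f * f')"
proof -
  obtain p g h m where f: "p \<in> laurent_supported {\<mu>. c + m \<le> x \<bullet> \<mu>}"
    "g \<in> laurent_supported {\<mu>. x \<bullet> \<mu> = m}" "h \<in> laurent_supported {\<mu>. m < x \<bullet> \<mu>}" "g \<noteq> 0"
    "f * (g + h) = p"
    using assms(1) unfolding order_ge_def by blast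
  obtain p' g' h' m' where f': "p' \<in> laurent_supported {\<mu>. c' + m' \<le> x \<bullet> \<mu>}"
    "g' \<in> laurent_supported {\<mu>. x \<bullet> \<mu> = m'}" "h' \<in> laurent_supported {\<mu>. m' < x \<bullet> \<mu>}" "g' \<noteq> 0"
    "f' * (g' + h') = p'"
    using assms(2) unfolding order_ge_def by blast
  show ?thesis
  proof (rule order_geI)
    show "p * p' \<in> laurent_supported {\<mu>. (c + c') + (m + m') \<le> x \<bullet> \<mu>}"
      by (rule supported_mult[OF f(1) f'(1)]) (auto simp: inner_add_right)
    show "(f * f') * (g * g' + (g * h' + h * g' + h * h')) = p * p'"
      unfolding f(5)[symmetric] f'(5)[symmetric] by (simp add: algebra_simps)
  qed (use order_ge_denominator[OF f(2-4) f'(2-4)] in auto)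
qed

lemma order_ge_mono: "order_ge x c f \<Longrightarrow> d \<le> c \<Longrightarrow> order_ge x d f"
proof -
  assume "order_ge x c f" "d \<le> c"
  then obtain p g h m where f: "p \<in> laurent_supported {\<mu>. c + m \<le> x \<bullet> \<mu>}"
    "g \<in> laurent_supported {\<mu>. x \<bullet> \<mu> = m}" "h \<in> laurent_supported {\<mu>. m < x \<bullet> \<mu>}" "g \<noteq> 0"
    "f * (g + h) = p"
    unfolding order_ge_def by blast
  have "p \<in> laurent_supported {\<mu>. d + m \<le> x \<bullet> \<mu>}"
    by (rule supported_mono[OF f(1)]) (use \<open>d \<le> c\<close> in auto)
  then show ?thesis
    using f by (intro order_geI)
qed

lemma order_ge_supported:
  assumes "f \<in> laurent_supported {\<mu>. c \<le> x \<bullet> \<mu>}"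
  shows "order_ge x c f"
proof (rule order_geI)
  show "f \<in> laurent_supported {\<mu>. c + 0 \<le> x \<bullet> \<mu>}"
    using assms by simp
  show "1 \<in> laurent_supported {\<mu>. x \<bullet> \<mu> = 0}"
    using supported_monomial[of 0 "{\<mu>. x \<bullet> \<mu> = 0}" 1] by simp
qed (auto intro: supported_0)

lemma order_ge_monomial: "\<mu> \<in> \<Lambda> \<Longrightarrow> order_ge x (x \<bullet> \<mu>) (rf_const c * Y \<mu>)"
  by (intro order_ge_supported supported_monomial) auto

lemma order_ge_const: "order_ge x 0 (rf_const c)"
  using order_ge_monomial[of 0 x c] by simp

lemma order_ge_sum: "(\<And>y. y \<in> A \<Longrightarrow> order_ge x c (F y)) \<Longrightarrow> order_ge x c (sum F A)"
  by (induction A rule: infinite_finite_induct)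
     (auto intro: order_ge_add order_ge_supported supported_0)

lemma order_ge_prod: "(\<And>y. y \<in> A \<Longrightarrow> order_ge x 0 (F y)) \<Longrightarrow> order_ge x 0 (prod F A)"
proof (induction A rule: infinite_finite_induct)
  case (insert y A)
  then have "order_ge x (0 + 0) (F y * prod F A)"
    by (intro order_ge_mult) auto
  with insert show ?case by simp
qed (use order_ge_const[of x 1] in simp_all)

text \<open>Whichever of its two terms has the lower weight, the lowest part of the denominator has weight
  \<open>min 0 \<langle>x, \<beta>\<rangle>\<close>, and the numerator contains no lower weight.\<close>

lemma order_ge_quotient:
  assumes \<beta>: "\<beta> \<in> \<Lambda>" "\<beta> \<noteq> 0" and "c \<noteq> 0" "d \<noteq> 0"
  shows "order_ge x 0 ((rf_const a + rf_const b * Y \<beta>) / (rf_const c + rf_const d * Y \<beta>))"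
proof -
  let ?den = "rf_const c + rf_const d * Y \<beta>" and ?num = "rf_const a + rf_const b * Y \<beta>"
  have den: "?den \<noteq> 0"
    using binomial_neq_0[OF \<beta>] assms by blast
  have const: "rf_const a' \<in> laurent_supported A" if "0 \<in> A" for a' A
    using supported_monomial[of 0 A a'] that by simp
  have num: "?num \<in> laurent_supported {\<mu>. 0 + min 0 (x \<bullet> \<beta>) \<le> x \<bullet> \<mu>}"
    by (intro supported_add const supported_monomial \<beta>) auto
  consider "x \<bullet> \<beta> = 0" | "0 < x \<bullet> \<beta>" | "x \<bullet> \<beta> < 0" by linarith
  then show ?thesis
  proof cases
    case 1
    show ?thesis
    proof (rule order_geI[OF num])
      show "?den \<in> laurent_supported {\<mu>. x \<bullet> \<mu> = min 0 (x \<bullet> \<beta>)}"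
        by (intro supported_add const supported_monomial \<beta>) (use 1 in auto)
      show "0 \<in> laurent_supported {\<mu>. min 0 (x \<bullet> \<beta>) < x \<bullet> \<mu>}"
        by (rule supported_0)
    qed (use den in auto)
  next
    case 2
    show ?thesis
    proof (rule order_geI[OF num])
      show "rf_const c \<in> laurent_supported {\<mu>. x \<bullet> \<mu> = min 0 (x \<bullet> \<beta>)}"
        by (rule const) (use 2 in auto)
      show "rf_const d * Y \<beta> \<in> laurent_supported {\<mu>. min 0 (x \<bullet> \<beta>) < x \<bullet> \<mu>}"
        by (rule supported_monomial[OF \<beta>(1)]) (use 2 in auto)
    qed (use den assms in auto)
  next
    case 3
    show ?thesis
    proof (rule order_geI[OF num])
      show "rf_const d * Y \<beta> \<in> laurent_supported {\<mu>. x \<bullet> \<mu> = min 0 (x \<bullet> \<beta>)}"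
        by (rule supported_monomial[OF \<beta>(1)]) (use 3 in auto)
      show "rf_const c \<in> laurent_supported {\<mu>. min 0 (x \<bullet> \<beta>) < x \<bullet> \<mu>}"
        by (rule const) (use 3 in auto)
    qed (use den assms in \<open>auto simp: add.commute\<close>)
  qed
qed

lemma order_ge_S:
  assumes "order_ge (\<s> i x) c f"
  shows "order_ge x c (S i f)"
proof -
  obtain p g h m where f: "p \<in> laurent_supported {\<mu>. c + m \<le> \<s> i x \<bullet> \<mu>}"
    "g \<in> laurent_supported {\<mu>. \<s> i x \<bullet> \<mu> = m}" "h \<in> laurent_supported {\<mu>. m < \<s> i x \<bullet> \<mu>}" "g \<noteq> 0"
    "f * (g + h) = p"
    using assms unfolding order_ge_def by blast
  have "S i g \<noteq> 0" "S i f * (S i g + S i h) = S i p"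
    using f by (auto simp: hom_eq_0_iff[OF S_hom] simp flip: hom_add[OF S_hom] hom_mult[OF S_hom])
  with supported_S[OF f(1), of i] supported_S[OF f(2), of i] supported_S[OF f(3), of i] show ?thesis
    by (intro order_geI) (simp_all add: s_isometry)
qed

lemma order_ge_E:
  assumes "order_ge x c f"
  shows "order_ge x c (E i f)"
proof -
  obtain p g h m where f: "p \<in> laurent_supported {\<mu>. c + m \<le> x \<bullet> \<mu>}"
    "g \<in> laurent_supported {\<mu>. x \<bullet> \<mu> = m}" "h \<in> laurent_supported {\<mu>. m < x \<bullet> \<mu>}" "g \<noteq> 0"
    "f * (g + h) = p"
    using assms unfolding order_ge_def by blast
  have "E i g \<noteq> 0" "E i f * (E i g + E i h) = E i p"
    using f by (auto simp: hom_eq_0_iff[OF E_hom] simp flip: hom_add[OF E_hom] hom_mult[OF E_hom])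
  then show ?thesis
    using supported_E[OF f(1), of i] supported_E[OF f(2), of i] supported_E[OF f(3), of i]
    by (intro order_geI)
qed

text \<open>For a Laurent polynomial the order is governed by its support, because the product of two
  non-zero parts of lowest weight does not vanish.\<close>

lemma order_ge_laurent:
  assumes b: "has_laurent f b" and "order_ge x c f" and "b \<mu> \<noteq> 0"
  shows "c \<le> x \<bullet> \<mu>"
proof (rule ccontr)
  assume less: "\<not> ?thesis"
  obtain p g h m where f: "p \<in> laurent_supported {\<mu>. c + m \<le> x \<bullet> \<mu>}"
    "g \<in> laurent_supported {\<mu>. x \<bullet> \<mu> = m}" "h \<in> laurent_supported {\<mu>. m < x \<bullet> \<mu>}" "g \<noteq> 0"
    "f * (g + h) = p"
    using assms(2) unfolding order_ge_def by blast
  obtain A where A: "finite A" "A \<subseteq> \<Lambda>" "\<forall>\<mu>. \<mu> \<notin> A \<longrightarrow> b \<mu> = 0" "f = (\<Sum>\<mu>\<in>A. rf_const (b \<mu>) * Y \<mu>)"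
    using b unfolding has_laurent_def by blast
  define B where "B = {\<mu> \<in> A. b \<mu> \<noteq> 0}"
  have B: "finite B" "\<mu> \<in> B" "B \<subseteq> \<Lambda>"
    using A assms(3) by (auto simp: B_def)
  obtain \<nu> where \<nu>: "\<nu> \<in> B" "\<And>\<kappa>. \<kappa> \<in> B \<Longrightarrow> x \<bullet> \<nu> \<le> x \<bullet> \<kappa>"
    using ex_is_arg_min_if_finite[OF B(1), of "\<lambda>\<kappa>. x \<bullet> \<kappa>"] B(2)
    by (auto simp: is_arg_min_linorder)
  define C where "C = {\<kappa> \<in> B. x \<bullet> \<kappa> = x \<bullet> \<nu>}"
  define f0 where "f0 = (\<Sum>\<kappa>\<in>C. rf_const (b \<kappa>) * Y \<kappa>)"
  define f1 where "f1 = (\<Sum>\<kappa>\<in>B - C. rf_const (b \<kappa>) * Y \<kappa>)"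
  have C: "finite C" "C \<subseteq> B"
    using B by (auto simp: C_def)
  have "f = (\<Sum>\<mu>\<in>B. rf_const (b \<mu>) * Y \<mu>)"
    unfolding A(4) by (rule sum.mono_neutral_right) (use A(1) in \<open>auto simp: B_def\<close>)
  also have "\<dots> = f1 + f0"
    unfolding f0_def f1_def using sum.subset_diff[OF C(2) B(1)] by blast
  finally have f_split: "f = f1 + f0" .
  have f0: "f0 \<in> laurent_supported {\<kappa>. x \<bullet> \<kappa> = x \<bullet> \<nu>}"
    unfolding f0_def by (intro supported_sum supported_monomial) (use B C in \<open>auto simp: C_def\<close>)
  have f1: "f1 \<in> laurent_supported {\<kappa>. x \<bullet> \<nu> < x \<bullet> \<kappa>}"
    unfolding f1_def
    by (intro supported_sum supported_monomial) (use B \<nu>(2) in \<open>force simp: C_def less_le\<close>)+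
  have "f0 \<noteq> 0"
  proof
    assume "f0 = 0"
    then have "b \<nu> = 0"
      by (intro Y_independent[OF C(1), of b \<nu>]) (use B C \<nu> in \<open>auto simp: f0_def C_def\<close>)
    with \<nu>(1) show False by (simp add: B_def)
  qed
  have "x \<bullet> \<nu> < c"
    using less \<nu>(2)[OF B(2)] by simp
  then have p: "p \<in> laurent_supported {\<kappa>. x \<bullet> \<nu> + m < x \<bullet> \<kappa>}"
    by (intro supported_mono[OF f(1)]) auto
  have "f0 * h \<in> laurent_supported {\<kappa>. x \<bullet> \<nu> + m < x \<bullet> \<kappa>}"
    by (rule supported_mult[OF f0 f(3)]) (auto simp: inner_add_right)
  moreover have "g + h \<in> laurent_supported {\<mu>. m \<le> x \<bullet> \<mu>}"
    by (auto intro!: supported_add intro: supported_mono[OF f(2)] supported_mono[OF f(3)])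
  then have "f1 * (g + h) \<in> laurent_supported {\<kappa>. x \<bullet> \<nu> + m < x \<bullet> \<kappa>}"
    by (rule supported_mult[OF f1]) (auto simp: inner_add_right)
  moreover have "f0 * g = p + (- (f0 * h) + - (f1 * (g + h)))"
    unfolding f(5)[symmetric] f_split by (simp add: algebra_simps)
  ultimately have "f0 * g \<in> laurent_supported {\<kappa>. x \<bullet> \<nu> + m < x \<bullet> \<kappa>}"
    using p by (simp only: supported_add supported_uminus)
  moreover have "f0 * g \<in> laurent_supported {\<kappa>. x \<bullet> \<kappa> = x \<bullet> \<nu> + m}"
    by (rule supported_mult[OF f0 f(2)]) (auto simp: inner_add_right)
  ultimately have "f0 * g = 0"
    by (rule supported_disjoint) auto
  with \<open>f0 \<noteq> 0\<close> f(4) show False by simp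
qed

section \<open>The support of the numerator\<close>

text \<open>Both coefficients of the slash operator are \<open>1 / y\<close> times a quotient of order at least \<open>0\<close>, where
  \<open>y = Y \<alpha>\<^sub>i\<close>; together with the factor \<open>y\<^bsup>l\<^esup>\<close> this gives the shift by \<open>l\<^sub>i - 1\<close>.\<close>

lemma order_ge_slash:
  assumes "order_ge (\<s> i x) c f"
  shows "order_ge x (c + (real (l i) - 1) * (x \<bullet> \<alpha> i)) (T f i)"
proof -
  let ?y = "Y (\<alpha> i)" and ?s = "complex_of_real (sqrt (real q))"
  have pow: "order_ge x ((real (l i) - 1) * (x \<bullet> \<alpha> i)) (?y ^ l i * inverse ?y)"
  proof -
    have *: "real_of_int (int (l i) - 1) *\<^sub>R \<alpha> i \<in> \<Lambda>"
      by (rule lattice_scale) simp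
    have "?y ^ l i * inverse ?y = Y (real_of_int (int (l i) - 1) *\<^sub>R \<alpha> i)"
      by (simp only: Y_scale[OF simple_lattice]) (simp add: power_int_diff divide_inverse)
    with order_ge_monomial[OF *, of x 1] show ?thesis
      by simp
  qed
  let ?d = "rf_const (2 * ?s) + rf_const (- 2) * ?y"
  let ?u = "(rf_const (?s - 1) + rf_const (?s - 1) * ?y) / ?d"
  let ?v = "(rf_const (- (?s + 1)) + rf_const (?s + 1) * ?y) / ?d"
  have UV: "U ?y = inverse ?y * ?u" "V ?y = inverse ?y * ?v"
  proof -
    have "rf_const 2 = (2 :: 'n ratfun)"
      by (metis of_nat_numeral rf_const_of_nat)
    then have d: "2 * ?y * (\<t> - ?y) = ?y * ?d"
      by (simp add: rf_sqrt_def rf_const_mult rf_const_uminus algebra_simps)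
    have u: "(\<t> - 1) * (?y + 1) = rf_const (?s - 1) + rf_const (?s - 1) * ?y"
      and v: "(\<t> + 1) * (?y - 1) = rf_const (- (?s + 1)) + rf_const (?s + 1) * ?y"
      by (simp_all add: rf_sqrt_def rf_const_diff rf_const_add rf_const_uminus algebra_simps)
    show "U ?y = inverse ?y * ?u" "V ?y = inverse ?y * ?v"
      unfolding slash_plus_def slash_minus_def d u v by (simp_all add: divide_inverse mult_ac)
  qed
  have "order_ge x (0 + c) (?u * S i f)"
    by (intro order_ge_mult order_ge_quotient order_ge_S assms) auto
  moreover have "order_ge x (0 + (0 + c)) (?v * (rf_const ((-1) ^ l i) * S i (E i f)))"
    by (intro order_ge_mult order_ge_const order_ge_quotient order_ge_S order_ge_E assms) auto
  ultimately have "order_ge x c (?u * S i f + ?v * (rf_const ((-1) ^ l i) * S i (E i f)))"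
    using order_ge_add by simp
  from order_ge_mult[OF pow this] show ?thesis
    unfolding slash_simple_eq UV by (simp add: rf_const_power rf_const_uminus distrib_left mult_ac add_ac)
qed

text \<open>The reflection \<open>\<sigma>\<^sub>i\<close> permutes the positive roots other than \<open>\<alpha>\<^sub>i\<close>, so only one factor of \<open>\<Delta>\<close> changes.\<close>

lemma S_Delta: "S i \<Delta> * Y (2 *\<^sub>R \<alpha> i) = - \<Delta>"
proof -
  let ?F = "\<lambda>\<beta>. 1 - Y (2 *\<^sub>R \<beta>)"
  have \<Delta>: "\<Delta> = ?F (\<alpha> i) * prod ?F (P - {\<alpha> i})"
    unfolding Delta_eq by (rule prod.remove) simp_all
  have \<alpha>: "Y (- (2 *\<^sub>R \<alpha> i)) = inverse (Y (2 *\<^sub>R \<alpha> i))"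
    by (simp add: Y_uminus lattice_scale2)
  have "S i \<Delta> = ?F (- \<alpha> i) * (\<Prod>\<beta>\<in>P - {\<alpha> i}. ?F (\<s> i \<beta>))"
    unfolding \<Delta> by (simp add: hom_simps[OF S_hom] S_Y lattice_scale2 positive_lattice)
  also have "(\<Prod>\<beta>\<in>P - {\<alpha> i}. ?F (\<s> i \<beta>)) = prod ?F (P - {\<alpha> i})"
    by (rule prod.reindex_bij_betw[OF s_permutes_positive])
  finally have S\<Delta>: "S i \<Delta> = ?F (- \<alpha> i) * prod ?F (P - {\<alpha> i})" .
  show ?thesis
    unfolding S\<Delta> by (simp add: \<Delta> \<alpha> algebra_simps)
qed

text \<open>Each letter \<open>i\<close> shifts the order by \<open>(l\<^sub>i - 1) \<langle>x, \<alpha>\<^sub>i\<rangle>\<close> through the slash operator and by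
  \<open>2 \<langle>x, \<alpha>\<^sub>i\<rangle>\<close> through \<open>\<Delta>(x) / \<Delta>(\<sigma>\<^sub>i x) = - Y (2 \<alpha>\<^sub>i)\<close>; the sum matches
  \<open>\<sigma>\<^sub>i \<theta> = \<theta> - (l\<^sub>i + 1) \<alpha>\<^sub>i\<close>.\<close>

lemma order_ge_average_term:
  "order_ge x (x \<bullet> (\<theta> - word_prod (rev is) \<theta>)) (\<Delta> * average_term is)"
proof (induction "is" arbitrary: x rule: rev_induct)
  case Nil
  show ?case
    using order_ge_const[of x 1] by (simp add: average_term_def S_word_def)
next
  case (snoc i "is")
  let ?\<mu> = "\<theta> - word_prod (rev is) \<theta>"
  have "\<Delta> * average_term (is @ [i]) = - (Y (2 *\<^sub>R \<alpha> i) * (S i \<Delta> * T (average_term is) i))"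
    using arg_cong[OF S_Delta[of i], of "\<lambda>g. - (g * T (average_term is) i)"]
    by (simp add: average_term_snoc mult_ac)
  also have "S i \<Delta> * T (average_term is) i = T (\<Delta> * average_term is) i"
    by (rule slash_simple_mult[symmetric]) (use E_S_word_Delta[of i "[]"] in \<open>simp add: S_word_def\<close>)
  finally have eq: "\<Delta> * average_term (is @ [i])
      = rf_const (-1) * Y (2 *\<^sub>R \<alpha> i) * T (\<Delta> * average_term is) i"
    by (simp add: rf_const_uminus)
  have "order_ge x (x \<bullet> (2 *\<^sub>R \<alpha> i) + (\<s> i x \<bullet> ?\<mu> + (real (l i) - 1) * (x \<bullet> \<alpha> i)))
      (\<Delta> * average_term (is @ [i]))"
    unfolding eq by (intro order_ge_mult order_ge_monomial order_ge_slash snoc lattice_scale2) simp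
  moreover have "x \<bullet> (2 *\<^sub>R \<alpha> i) + (\<s> i x \<bullet> ?\<mu> + (real (l i) - 1) * (x \<bullet> \<alpha> i))
      = x \<bullet> (\<theta> - word_prod (rev (is @ [i])) \<theta>)"
    by (simp add: s_inner s_theta word_prod_Cons inner_diff_right algebra_simps)
  ultimately show ?case
    by simp
qed

abbreviation "D \<equiv> D_fun \<Phi> \<alpha> q"
abbreviation "N \<equiv> N_fun \<Phi> \<alpha> q l"

lemma D_eq: "D = (\<Prod>\<beta>\<in>P. 1 - Y (2 *\<^sub>R \<beta>) / of_nat q)"
  unfolding D_fun_def
  by (rule prod.cong) (simp_all add: Y_double_eq positive_lattice power_int_diff field_simps)

lemma order_ge_D_over_Delta: "order_ge x 0 (D / \<Delta>)"
proof -
  have "order_ge x 0 ((1 - Y (2 *\<^sub>R \<beta>) / of_nat q) / (1 - Y (2 *\<^sub>R \<beta>)))" if "\<beta> \<in> P" for \<beta>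
    using order_ge_quotient[of "2 *\<^sub>R \<beta>" 1 "-1" x 1 "- inverse (of_nat q)"] that positive_root zero_not_root
    by (auto simp: rf_const_uminus rf_const_inverse rf_const_of_nat lattice_scale2 positive_lattice
        divide_inverse mult.commute)
  then show ?thesis
    unfolding D_eq Delta_eq prod_dividef[symmetric] by (rule order_ge_prod)
qed

text \<open>Here \<open>\<langle>x, w \<theta>\<rangle> \<le> \<bar>x\<bar> \<bar>\<theta>\<bar>\<close> makes the bounds for the individual summands uniform in \<open>w\<close>.\<close>

lemma N_order: "order_ge x (x \<bullet> \<theta> - norm x * norm \<theta>) N"
proof -
  have "N = D / \<Delta> * (\<Sum>w\<in>weyl_group \<Phi>. \<Delta> * average_term (word_of \<alpha> w))"
    by (simp add: N_fun_def f_fun_eq flip: sum_distrib_left)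
  moreover have "order_ge x (x \<bullet> \<theta> - norm x * norm \<theta>) (\<Delta> * average_term is)" for "is"
  proof (rule order_ge_mono[OF order_ge_average_term])
    have "norm (word_prod (rev is) \<theta>) = norm \<theta>"
      by (simp add: norm_eq_sqrt_inner word_prod_isometry)
    then show "x \<bullet> \<theta> - norm x * norm \<theta> \<le> x \<bullet> (\<theta> - word_prod (rev is) \<theta>)"
      using norm_cauchy_schwarz[of x "word_prod (rev is) \<theta>"] by (simp add: inner_diff_right)
  qed
  ultimately show ?thesis
    using order_ge_mult[OF order_ge_D_over_Delta, of x "x \<bullet> \<theta> - norm x * norm \<theta>"]
    by (simp only: order_ge_sum add_0)
qed

text \<open>This is the bound on the order for the weight given by \<open>x = \<theta> - \<mu>\<close> itself.\<close>

lemma N_support: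
  assumes "has_laurent N b" "b \<mu> \<noteq> 0"
  shows "norm (\<theta> - \<mu>) \<le> norm \<theta>"
proof -
  let ?x = "\<theta> - \<mu>"
  have "?x \<bullet> \<theta> - norm ?x * norm \<theta> \<le> ?x \<bullet> \<mu>"
    by (rule order_ge_laurent[OF assms(1) N_order assms(2)])
  then have "?x \<bullet> ?x \<le> norm ?x * norm \<theta>"
    by (simp only: inner_diff_right)
  then have "norm ?x * norm ?x \<le> norm ?x * norm \<theta>"
    by (simp only: power2_norm_eq_inner[symmetric] power2_eq_square)
  then show ?thesis
    by (cases "norm ?x = 0") (simp_all add: mult_le_cancel_left)
qed

section \<open>The functional equation on coefficients\<close>

text \<open>Since \<open>f = N / D\<close> is invariant, \<open>N | \<sigma>\<^sub>i\<close> is \<open>N\<close> times \<open>D(\<sigma>\<^sub>i x) / D(x)\<close>, in which all factors but the one for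
  \<open>\<alpha>\<^sub>i\<close> cancel.\<close>

lemma slash_N:
  "(1 - Y (2 *\<^sub>R \<alpha> i) / of_nat q) * T N i = (1 - inverse (Y (2 *\<^sub>R \<alpha> i)) / of_nat q) * N"
proof -
  let ?F = "\<lambda>\<beta>. 1 - Y (2 *\<^sub>R \<beta>) / of_nat q"
  let ?f = "f_fun \<Phi> \<alpha> q l"
  have D: "D = ?F (\<alpha> i) * prod ?F (P - {\<alpha> i})"
    unfolding D_eq by (rule prod.remove) simp_all
  have \<alpha>: "Y (- (2 *\<^sub>R \<alpha> i)) = inverse (Y (2 *\<^sub>R \<alpha> i))"
    by (simp add: Y_uminus lattice_scale2)
  have "S i D = ?F (- \<alpha> i) * (\<Prod>\<beta>\<in>P - {\<alpha> i}. ?F (\<s> i \<beta>))"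
    unfolding D by (simp add: hom_simps[OF S_hom] S_Y lattice_scale2 positive_lattice)
  also have "(\<Prod>\<beta>\<in>P - {\<alpha> i}. ?F (\<s> i \<beta>)) = prod ?F (P - {\<alpha> i})"
    by (rule prod.reindex_bij_betw[OF s_permutes_positive])
  finally have SD: "S i D = (1 - inverse (Y (2 *\<^sub>R \<alpha> i)) / of_nat q) * prod ?F (P - {\<alpha> i})"
    by (simp add: \<alpha>)
  have "E i D = D"
    by (simp add: D_eq hom_simps[OF E_hom] E_Y_double positive_lattice)
  then have TN: "T N i = S i D * ?f"
    unfolding N_fun_def by (simp add: slash_simple_mult f_fun_invariant)
  have N: "N = ?F (\<alpha> i) * prod ?F (P - {\<alpha> i}) * ?f"
    by (simp only: N_fun_def D)
  show ?thesis
    unfolding TN SD unfolding N by (simp only: mult_ac)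
qed

lemma N_functional_equation:
  fixes i
  defines "y \<equiv> Y (\<alpha> i)"
  shows "2 * (of_nat q * y ^ 2 - 1) * N = y ^ (l i + 1) * (\<t> + y) *
    ((\<t> - 1) * (y + 1) * S i N + (-1) ^ l i * ((\<t> + 1) * (y - 1) * S i (E i N)))"
proof -
  have y: "y \<noteq> 0" "\<t> - y \<noteq> 0"
    using t_minus_Y(1)[of "\<alpha> i"] by (simp_all add: y_def)
  have "(1 - y ^ 2 / of_nat q) * T N i = (1 - inverse (y ^ 2) / of_nat q) * N"
    using slash_N[of i] by (simp add: Y_double y_def)
  then have "of_nat q * y ^ 2 * (1 - y ^ 2 / of_nat q) * T N i
      = of_nat q * y ^ 2 * (1 - inverse (y ^ 2) / of_nat q) * N"
    by (simp only: mult.assoc)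
  moreover have "of_nat q * y ^ 2 * (1 - y ^ 2 / of_nat q) = y ^ 2 * (of_nat q - y ^ 2)"
    "of_nat q * y ^ 2 * (1 - inverse (y ^ 2) / of_nat q) = of_nat q * y ^ 2 - 1"
    using y by (simp_all add: right_diff_distrib divide_inverse mult_ac)
  ultimately have eq: "y ^ 2 * (of_nat q - y ^ 2) * T N i = (of_nat q * y ^ 2 - 1) * N"
    by simp
  have sq: "of_nat q - y ^ 2 = (\<t> - y) * (\<t> + y)"
    by (simp add: t_squared[symmetric] power2_eq_square algebra_simps)
  have TN: "T N i = y ^ l i * (U y * S i N + (-1) ^ l i * V y * S i (E i N))"
    by (simp add: slash_simple_eq y_def)
  have "2 * (of_nat q * y ^ 2 - 1) * N = 2 * (y ^ 2 * (of_nat q - y ^ 2) * T N i)"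
    unfolding eq by (rule mult.assoc)
  also have "\<dots> = 2 * y ^ 2 * ((\<t> - y) * (\<t> + y)) * (y ^ l i * (U y * S i N + (-1) ^ l i * V y * S i (E i N)))"
    unfolding sq TN by (simp only: mult.assoc)
  also have "\<dots> = y ^ (l i + 1) * (\<t> + y) *
      ((2 * y * (\<t> - y) * U y) * S i N + (-1) ^ l i * ((2 * y * (\<t> - y) * V y) * S i (E i N)))"
    by (simp add: power2_eq_square algebra_simps)
  also have "2 * y * (\<t> - y) * U y = (\<t> - 1) * (y + 1)"
    using y by (simp add: slash_plus_def)
  also have "2 * y * (\<t> - y) * V y = (\<t> + 1) * (y - 1)"
    using y by (simp add: slash_minus_def)
  finally show ?thesis .
qed

text \<open>This compares the coefficients at \<open>\<eta>\<close> in the functional equation. The coefficient of \<open>y\<^sup>m (S i N)\<close>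
  at \<open>\<eta>\<close> is the one of \<open>N\<close> at \<open>\<sigma>\<^sub>i (\<eta> - m \<alpha>\<^sub>i) = \<sigma>\<^sub>i \<eta> + m \<alpha>\<^sub>i\<close>, and \<open>m = l\<^sub>i + 1 + k\<close> with \<open>k = 0, 1, 2\<close> occurs.\<close>

lemma N_coefficient_relation:
  fixes b \<eta> i
  defines "s \<equiv> complex_of_real (sqrt (real q))"
    and "\<kappa> \<equiv> \<lambda>k::nat. \<s> i \<eta> + (real (l i) + 1 + real k) *\<^sub>R \<alpha> i"
  assumes b: "has_laurent N b"
  shows "2 * s ^ 2 * b (\<eta> - 2 *\<^sub>R \<alpha> i) - 2 * b \<eta> =
    (s - 1) * (s * b (\<kappa> 0) + (s + 1) * b (\<kappa> 1) + b (\<kappa> 2))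
    + (-1) ^ l i * (s + 1) * (- s * (-1) powi \<lfloor>\<kappa> 0 \<bullet> \<alpha> i\<rfloor> * b (\<kappa> 0)
        + (s - 1) * (-1) powi \<lfloor>\<kappa> 1 \<bullet> \<alpha> i\<rfloor> * b (\<kappa> 1) + (-1) powi \<lfloor>\<kappa> 2 \<bullet> \<alpha> i\<rfloor> * b (\<kappa> 2))"
proof -
  let ?y = "Y (\<alpha> i)"
  define \<nu> where "\<nu> k = (real (l i) + 1 + real k) *\<^sub>R \<alpha> i" for k
  define c where "c = (\<lambda>\<mu>. (-1) powi \<lfloor>\<mu> \<bullet> \<alpha> i\<rfloor> * b \<mu>)"
  have \<nu>_scale: "\<nu> k = real (l i + 1 + k) *\<^sub>R \<alpha> i" for k
    by (simp add: \<nu>_def)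
  have \<nu>: "\<nu> k \<in> \<Lambda>" "Y (\<nu> k) = ?y ^ (l i + 1) * ?y ^ k" for k
    unfolding \<nu>_scale using lattice_scale[OF simple_lattice, of "int (l i + 1 + k)" i]
    by (simp_all only: Y_scale_nat[OF simple_lattice] power_add of_int_of_nat_eq)
  have SN: "has_laurent (S i N) (\<lambda>\<mu>. b (\<s> i \<mu>))"
    by (rule has_laurent_S[OF b])
  have "has_laurent (E i N) c"
    unfolding c_def by (rule has_laurent_E[OF b])
  then have SEN: "has_laurent (S i (E i N)) (\<lambda>\<mu>. c (\<s> i \<mu>))"
    by (rule has_laurent_S)
  have monomial_times: "has_laurent (rf_const d * (Y \<mu> * f)) (\<lambda>\<kappa>. d * b' (\<kappa> - \<mu>))"
    if "has_laurent f b'" "\<mu> \<in> \<Lambda>" for d f b' \<mu>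
    by (intro has_laurent_scale has_laurent_shift that)
  have \<kappa>: "\<s> i (\<eta> - \<nu> k) = \<kappa> k" for k
    by (simp add: \<nu>_def \<kappa>_def)
  have 2: "rf_const 2 = (2 :: 'n ratfun)"
    by (metis of_nat_numeral rf_const_of_nat)
  have t: "rf_const s = \<t>"
    by (simp add: s_def rf_sqrt_def)
  have "rf_const (2 * s ^ 2) * (Y (2 *\<^sub>R \<alpha> i) * N) + rf_const (- 2) * (Y 0 * N)
      = 2 * (of_nat q * ?y ^ 2 - 1) * N"
    by (simp add: rf_const_mult rf_const_uminus rf_const_power 2 t Y_double power2_eq_square
        t_squared[symmetric] algebra_simps)
  also have "\<dots> = ?y ^ (l i + 1) * (\<t> + ?y) *
    ((\<t> - 1) * (?y + 1) * S i N + (-1) ^ l i * ((\<t> + 1) * (?y - 1) * S i (E i N)))"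
    by (rule N_functional_equation)
  also have "\<dots> =
      rf_const ((s - 1) * s) * (Y (\<nu> 0) * S i N) + rf_const ((s - 1) * (s + 1)) * (Y (\<nu> 1) * S i N)
      + rf_const (s - 1) * (Y (\<nu> 2) * S i N)
      + (rf_const ((-1) ^ l i * (s + 1) * - s) * (Y (\<nu> 0) * S i (E i N))
      + rf_const ((-1) ^ l i * (s + 1) * (s - 1)) * (Y (\<nu> 1) * S i (E i N))
      + rf_const ((-1) ^ l i * (s + 1)) * (Y (\<nu> 2) * S i (E i N)))"
    by (simp add: rf_const_mult rf_const_uminus rf_const_diff rf_const_add rf_const_power t \<nu>
        power2_eq_square algebra_simps)
  finally have eq: "rf_const (2 * s ^ 2) * (Y (2 *\<^sub>R \<alpha> i) * N) + rf_const (- 2) * (Y 0 * N) = \<dots>" .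
  have "has_laurent (rf_const (2 * s ^ 2) * (Y (2 *\<^sub>R \<alpha> i) * N) + rf_const (- 2) * (Y 0 * N))
      (\<lambda>\<mu>. 2 * s ^ 2 * b (\<mu> - 2 *\<^sub>R \<alpha> i) + - 2 * b (\<mu> - 0))"
    by (intro has_laurent_add monomial_times b lattice_scale2) simp_all
  moreover have "has_laurent (rf_const (2 * s ^ 2) * (Y (2 *\<^sub>R \<alpha> i) * N) + rf_const (- 2) * (Y 0 * N))
      (\<lambda>\<mu>. (s - 1) * s * b (\<s> i (\<mu> - \<nu> 0)) + (s - 1) * (s + 1) * b (\<s> i (\<mu> - \<nu> 1))
         + (s - 1) * b (\<s> i (\<mu> - \<nu> 2))
         + ((-1) ^ l i * (s + 1) * - s * c (\<s> i (\<mu> - \<nu> 0))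
         + (-1) ^ l i * (s + 1) * (s - 1) * c (\<s> i (\<mu> - \<nu> 1))
         + (-1) ^ l i * (s + 1) * c (\<s> i (\<mu> - \<nu> 2))))"
    unfolding eq by (intro has_laurent_add monomial_times SN SEN \<nu>)
  ultimately have "(\<lambda>\<mu>. 2 * s ^ 2 * b (\<mu> - 2 *\<^sub>R \<alpha> i) + - 2 * b (\<mu> - 0))
     = (\<lambda>\<mu>. (s - 1) * s * b (\<s> i (\<mu> - \<nu> 0)) + (s - 1) * (s + 1) * b (\<s> i (\<mu> - \<nu> 1))
         + (s - 1) * b (\<s> i (\<mu> - \<nu> 2))
         + ((-1) ^ l i * (s + 1) * - s * c (\<s> i (\<mu> - \<nu> 0))
         + (-1) ^ l i * (s + 1) * (s - 1) * c (\<s> i (\<mu> - \<nu> 1))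
         + (-1) ^ l i * (s + 1) * c (\<s> i (\<mu> - \<nu> 2))))"
    by (rule has_laurent_unique)
  from fun_cong[OF this, of \<eta>] show ?thesis
    unfolding \<kappa> c_def by (simp add: algebra_simps)
qed

text \<open>
  For \<open>\<lambda> = \<theta> - w \<theta>\<close> with \<open>\<langle>w \<theta>, \<alpha>\<^sub>i\<rangle> > 0\<close>, of the exponents in the preceding relation only \<open>\<lambda>\<close> and
  \<open>\<theta> - \<sigma>\<^sub>i w \<theta>\<close> can lie in the support: the others differ from \<open>\<theta>\<close> by vectors longer than \<open>\<theta>\<close>.
\<close>

lemma N_extremal_coefficient:
  assumes b: "has_laurent N b" and n: "word_prod is \<theta> \<bullet> \<alpha> i = real n" "0 < n"
  shows "b (\<theta> - word_prod (i # is) \<theta>) =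
    (if odd n then 1 / complex_of_real (sqrt (real q)) else - 1 / of_nat q) * b (\<theta> - word_prod is \<theta>)"
proof -
  let ?v = "word_prod is \<theta>"
  define s where "s = complex_of_real (sqrt (real q))"
  define \<kappa> where "\<kappa> k = \<s> i (\<theta> - ?v) + (real (l i) + 1 + real k) *\<^sub>R \<alpha> i" for k
  have \<kappa>: "\<kappa> k = \<theta> - \<s> i (?v + real k *\<^sub>R \<alpha> i)" for k
    by (simp add: \<kappa>_def s_theta algebra_simps)
  have long: "norm \<theta> < norm (?v + real k *\<^sub>R \<alpha> i)" if "0 < k" for k :: nat
  proof -
    have "\<theta> \<bullet> \<theta> < ?v \<bullet> ?v + 2 * real k * real n + 2 * real k * real k"
      using that n(2) by (simp add: word_prod_isometry add_pos_pos)
    also have "\<dots> = (?v + real k *\<^sub>R \<alpha> i) \<bullet> (?v + real k *\<^sub>R \<alpha> i)"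
      by (simp add: inner_add_left inner_add_right n(1) inner_commute[of "\<alpha> i"] algebra_simps)
    finally show ?thesis
      by (simp add: norm_eq_sqrt_inner)
  qed
  have zero: "b \<mu> = 0" if "norm \<theta> < norm (\<theta> - \<mu>)" for \<mu>
    using N_support[OF b, of \<mu>] that by force
  have "norm (\<s> i v) = norm v" for v
    by (simp add: norm_eq_sqrt_inner s_isometry)
  then have \<kappa>0: "b (\<kappa> k) = 0" if "0 < k" for k
    using long[OF that] by (intro zero) (simp add: \<kappa> del: s_simps)
  have "b (\<theta> - ?v - 2 *\<^sub>R \<alpha> i) = 0"
    using long[of 2] by (intro zero) (simp add: algebra_simps)
  moreover have "\<lfloor>\<kappa> 0 \<bullet> \<alpha> i\<rfloor> = int (l i + 1 + n)"
  proof -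
    have "\<kappa> 0 \<bullet> \<alpha> i = real (l i + 1 + n)"
      by (simp add: \<kappa> inner_diff_left theta_inner_simple s_inner n(1))
    then show ?thesis
      by (metis floor_of_nat)
  qed
  then have "(-1 :: complex) ^ l i * (-1) powi \<lfloor>\<kappa> 0 \<bullet> \<alpha> i\<rfloor> = (-1) ^ (n + 1)"
    by (simp add: power_add del: of_nat_add of_nat_Suc flip: power_mult_distrib)
  ultimately have rel: "- 2 * b (\<theta> - ?v) = s * ((s - 1) - (s + 1) * (-1) ^ (n + 1)) * b (\<kappa> 0)"
    using N_coefficient_relation[OF b, of "\<theta> - ?v" i, folded s_def \<kappa>_def] \<kappa>0[of 1] \<kappa>0[of 2]
    by (simp add: algebra_simps)
  have "s \<noteq> 0" and s: "rf_const s * rf_const s = (of_nat q :: 'n ratfun)"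
    using rf_sqrt_squared[of q] by (simp_all add: s_def rf_sqrt_def)
  have ss: "s * s = of_nat q"
    using s by (metis rf_const_mult rf_const_of_nat rf_const_diff rf_const_eq_0_iff right_minus_eq)
  have "b (\<kappa> 0) = (if odd n then 1 / s else - 1 / of_nat q) * b (\<theta> - ?v)"
  proof (cases "odd n")
    case True
    with rel have "b (\<theta> - ?v) = s * b (\<kappa> 0)"
      by (simp add: algebra_simps)
    with True \<open>s \<noteq> 0\<close> show ?thesis by simp
  next
    case False
    then have "(-1 :: complex) ^ (n + 1) = - 1"
      by simp
    with rel have "2 * (s * s * b (\<kappa> 0) + b (\<theta> - ?v)) = 0"
      by (simp add: algebra_simps)
    then have "s * s * b (\<kappa> 0) + b (\<theta> - ?v) = 0"
      by (metis mult_eq_0_iff zero_neq_numeral)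
    then have "b (\<theta> - ?v) = - (of_nat q * b (\<kappa> 0))"
      unfolding ss by (simp only: add_eq_0_iff)
    with False show ?thesis by simp
  qed
  then show ?thesis
    by (simp add: \<kappa> word_prod_Cons s_def)
qed

section \<open>Inversions\<close>

text \<open>Only the roots \<open>\<plusminus> \<alpha>\<^sub>i\<close> change sign under \<open>\<sigma>\<^sub>i\<close>, and a positive root \<open>\<beta>\<close> with \<open>w \<beta> = - \<alpha>\<^sub>i\<close> is excluded by the
  assumption that \<open>w\<^sup>-\<^sup>1 \<alpha>\<^sub>i\<close> is positive.\<close>

lemma inversions_Cons:
  assumes pos: "word_prod (rev is) (\<alpha> i) \<in> P"
  shows "inversions \<Phi> \<alpha> (word_prod (i # is)) = insert (word_prod (rev is) (\<alpha> i)) (inversions \<Phi> \<alpha> (word_prod is))"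
    and "word_prod (rev is) (\<alpha> i) \<notin> inversions \<Phi> \<alpha> (word_prod is)"
proof -
  have "- \<s> i (word_prod is \<beta>) \<in> P \<longleftrightarrow> \<beta> = word_prod (rev is) (\<alpha> i) \<or> - word_prod is \<beta> \<in> P" if "\<beta> \<in> P" for \<beta>
  proof -
    consider "word_prod is \<beta> = \<alpha> i" | "word_prod is \<beta> = - \<alpha> i" | "word_prod is \<beta> \<noteq> \<alpha> i" "- word_prod is \<beta> \<noteq> \<alpha> i"
      by (metis minus_minus)
    then show ?thesis
    proof cases
      case 1
      then show ?thesis
        by (metis minus_minus word_prod_rev(1) s_simps(6) simple_positive)
    next
      case 2
      then have "\<beta> = - word_prod (rev is) (\<alpha> i)"
        by (metis word_prod_linear(3) word_prod_rev(1))
      with that pos not_positive_and_negative show ?thesis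
        by (metis minus_minus)
    next
      case 3
      have "word_prod is \<beta> \<in> \<Phi>"
        using that by (simp add: positive_root)
      then have "- \<s> i (word_prod is \<beta>) \<in> P \<longleftrightarrow> - word_prod is \<beta> \<in> P"
        using 3 s_positive[of "word_prod is \<beta>" i] s_positive[of "- word_prod is \<beta>" i] not_positive_iff[of "word_prod is \<beta>"]
          not_positive_and_negative[of "\<s> i (word_prod is \<beta>)"] by auto
      with 3(1) show ?thesis
        by (metis word_prod_rev(2))
    qed
  qed
  then show "inversions \<Phi> \<alpha> (word_prod (i # is)) = insert (word_prod (rev is) (\<alpha> i)) (inversions \<Phi> \<alpha> (word_prod is))"
    using pos by (auto simp: inversions_def negative_root_iff word_prod_Cons)
  show "word_prod (rev is) (\<alpha> i) \<notin> inversions \<Phi> \<alpha> (word_prod is)"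
    using not_positive_and_negative[of "\<alpha> i"] by (auto simp: inversions_def negative_root_iff)
qed

definition gauss_factor :: "'a \<Rightarrow> real" where
  "gauss_factor \<beta> = gauss_sum1 q (nat \<lfloor>\<theta> \<bullet> \<beta>\<rfloor>) / real q powr ((\<theta> \<bullet> \<beta>) / 2)"

lemma gauss_sum_normalised:
  assumes "0 < n"
  shows "gauss_sum1 q n / real q powr (real n / 2)
    = (if odd n then 1 / sqrt (real q) else - 1 / real q) * sqrt (real q) ^ n"
proof -
  define p where "p = sqrt (real q) ^ n"
  have p: "p = real q powr (real n / 2)" "p \<noteq> 0"
    by (simp_all add: p_def powr_half_sqrt[symmetric] powr_power)
  have pp: "p * p = real q powr real n"
    by (simp add: p(1) flip: powr_add)
  have odd: "real q powr (real n - 1 / 2) = p * p / sqrt (real q)"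
    by (simp only: powr_diff pp) (simp add: powr_half_sqrt)
  have even: "real q ^ (n - 1) = p * p / real q"
    using assms by (simp add: pp powr_realpow power_diff)
  show ?thesis
    unfolding gauss_sum1_def odd even p(1)[symmetric] p_def[symmetric] using p(2) by simp
qed

text \<open>The exponent grows by \<open>n \<alpha>\<^sub>i\<close> with \<open>n = \<langle>w \<theta>, \<alpha>\<^sub>i\<rangle> = \<langle>\<theta>, w\<^sup>-\<^sup>1 \<alpha>\<^sub>i\<rangle>\<close>. Going back from the monomials in
  \<open>\<surd>q x\<^sub>j\<close> to those in \<open>x\<^sub>j\<close> therefore multiplies the ratio of the coefficients by \<open>\<surd>q\<^sup>n\<close>, which makes
  it the Gauss factor.\<close>

lemma N_coefficient_step:
  assumes b: "has_laurent N b" and pos: "word_prod (rev is) (\<alpha> i) \<in> P"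
    and a: "\<forall>\<mu>\<in>\<Lambda>. a \<mu> = complex_of_real (sqrt (real q)) powi root_height \<alpha> \<mu> * b \<mu>"
  shows "a (\<theta> - word_prod (i # is) \<theta>) = of_real (gauss_factor (word_prod (rev is) (\<alpha> i))) * a (\<theta> - word_prod is \<theta>)"
    and "gauss_factor (word_prod (rev is) (\<alpha> i)) \<noteq> 0"
proof -
  let ?s = "complex_of_real (sqrt (real q))" and ?\<beta> = "word_prod (rev is) (\<alpha> i)"
  have "\<theta> \<bullet> ?\<beta> \<in> \<int>" "0 < \<theta> \<bullet> ?\<beta>"
    using word_prod_theta_inner_int[of "is" i] theta_inner_positive[OF pos] by (simp_all add: word_prod_inner)
  then obtain m where "\<theta> \<bullet> ?\<beta> = real_of_int m" "0 < m"
    by (auto elim!: Ints_cases)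
  then obtain n where n: "\<theta> \<bullet> ?\<beta> = real n" "0 < n"
    by (metis of_int_of_nat_eq of_nat_0_less_iff zero_less_imp_eq_int)
  have v: "word_prod is \<theta> \<bullet> \<alpha> i = real n"
    by (simp add: word_prod_inner n)
  have factor: "gauss_factor ?\<beta> = (if odd n then 1 / sqrt (real q) else - 1 / real q) * sqrt (real q) ^ n"
    using gauss_sum_normalised[OF n(2)] by (simp add: gauss_factor_def n(1))
  then show "gauss_factor ?\<beta> \<noteq> 0"
    by simp
  have "\<theta> - word_prod (i # is) \<theta> = (\<theta> - word_prod is \<theta>) + real_of_int (int n) *\<^sub>R \<alpha> i"
    by (simp add: word_prod_Cons s_eq v)
  then have "root_coords \<alpha> (\<theta> - word_prod (i # is) \<theta>) j
      = root_coords \<alpha> (\<theta> - word_prod is \<theta>) j + int n * (if j = i then 1 else 0)" for j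
    by (simp only: root_coords_add[OF theta_diff_lattice lattice_scale[OF simple_lattice]]
        root_coords_scale[OF simple_lattice] root_coords_simple)
  then have "root_height \<alpha> (\<theta> - word_prod (i # is) \<theta>) = root_height \<alpha> (\<theta> - word_prod is \<theta>) + int n"
    by (simp add: root_height_def sum.distrib flip: sum_distrib_left)
  then show "a (\<theta> - word_prod (i # is) \<theta>) = of_real (gauss_factor ?\<beta>) * a (\<theta> - word_prod is \<theta>)"
    unfolding bspec[OF a theta_diff_lattice] N_extremal_coefficient[OF b v n(2)] factor
    by (simp add: power_int_add)
qed

text \<open>A letter that removes an inversion is handled by reading the step backwards, which is possible because
  Gauss factors do not vanish.\<close>

lemma N_coefficient_formula:
  assumes b: "has_laurent N b" and "a 0 = 1"
    and a: "\<forall>\<mu>\<in>\<Lambda>. a \<mu> = complex_of_real (sqrt (real q)) powi root_height \<alpha> \<mu> * b \<mu>"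
  shows "a (\<theta> - word_prod is \<theta>) = of_real (\<Prod>\<beta>\<in>inversions \<Phi> \<alpha> (word_prod is). gauss_factor \<beta>)"
proof (induction "is")
  case Nil
  have "inversions \<Phi> \<alpha> id = {}"
    using not_positive_and_negative by (auto simp: inversions_def negative_root_iff)
  then show ?case
    unfolding word_prod_Nil using assms(2) by (metis diff_self id_apply of_real_1 prod.empty)
next
  case (Cons i "is")
  have fin: "finite (inversions \<Phi> \<alpha> w)" for w
    by (simp add: inversions_def)
  show ?case
  proof (cases "word_prod (rev is) (\<alpha> i) \<in> P")
    case True
    show ?thesis
      unfolding N_coefficient_step(1)[OF b True a] inversions_Cons(1)[OF True] Cons
      by (simp add: prod.insert[OF fin inversions_Cons(2)[OF True]])
  next
    case False
    then have pos: "word_prod (rev (i # is)) (\<alpha> i) \<in> P"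
      using not_positive_iff[of "word_prod (rev is) (\<alpha> i)"] by (simp add: word_prod_snoc)
    \<comment> \<open>Prepending \<open>i\<close> once more leads back to \<open>word_prod is\<close> and adds an inversion.\<close>
    have cancel: "word_prod (i # i # is) = word_prod is"
      by (simp add: word_prod_Cons fun_eq_iff)
    show ?thesis
      using N_coefficient_step[OF b pos a] Cons
      unfolding cancel inversions_Cons(1)[OF pos, unfolded cancel]
        prod.insert[OF fin inversions_Cons(2)[OF pos]]
      by simp
  qed
qed

end

theorem theorem4p2:
  fixes \<Phi> :: "'a::euclidean_space set"
    and \<alpha> :: "'n::{finite,linorder} \<Rightarrow> 'a"
    and q :: nat
    and l :: "'n \<Rightarrow> nat"
    and \<theta> :: 'a
    and a :: "'a \<Rightarrow> complex"
  assumes "reduced_root_system \<Phi>"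
    and "simply_laced \<Phi>"
    and "\<forall>\<beta>\<in>\<Phi>. \<beta> \<bullet> \<beta> = 2"
    and "simple_root_base \<Phi> \<alpha>"
    and "primepow q"
    and "\<theta> = weyl_vector \<Phi> \<alpha> + (\<Sum>k\<in>UNIV. real (l k) *\<^sub>R fundamental_weight \<alpha> k)"
    and "finite {\<mu> \<in> root_lattice \<alpha>. a \<mu> \<noteq> 0}"
    and "N_fun \<Phi> \<alpha> q l =
           (\<Sum>\<mu>\<in>{\<mu> \<in> root_lattice \<alpha>. a \<mu> \<noteq> 0}. rf_const (a \<mu>) * monomial_at \<alpha> rf_var \<mu>)"
    and "a 0 = 1"
  shows "\<forall>w\<in>weyl_group \<Phi>. \<forall>\<mu>. \<mu> = \<theta> - inv w \<theta> \<longrightarrow>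
           a \<mu> = complex_of_real
             (\<Prod>\<beta>\<in>inversions \<Phi> \<alpha> (inv w).
                gauss_sum1 q (nat \<lfloor>\<theta> \<bullet> \<beta>\<rfloor>) / real q powr ((\<theta> \<bullet> \<beta>) / 2))"
proof -
  have "2 \<le> q"
    using primepow_gt_Suc_0[OF assms(5)] by simp
  with assms(1-4) interpret simply_laced_slash \<Phi> \<alpha> q l
    by unfold_locales
  have \<theta>: "\<theta> = simply_laced_slash.\<theta> \<Phi> \<alpha> l"
    using assms(6) \<theta>_def by simp
  let ?s = "complex_of_real (sqrt (real q))"
  let ?A = "{\<mu> \<in> root_lattice \<alpha>. a \<mu> \<noteq> 0}"
  \<comment> \<open>The coefficients of \<open>N\<close> with respect to the monomials in \<open>\<surd>q x\<^sub>i\<close>.\<close>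
  define b where "b \<mu> = (if \<mu> \<in> ?A then ?s powi (- root_height \<alpha> \<mu>) * a \<mu> else 0)" for \<mu>
  have cancel: "?s powi root_height \<alpha> \<mu> * ?s powi (- root_height \<alpha> \<mu>) = 1" for \<mu>
    by (simp add: power_int_minus power_int_eq_0_iff)
  have a: "\<forall>\<mu>\<in>root_lattice \<alpha>. a \<mu> = ?s powi root_height \<alpha> \<mu> * b \<mu>"
    using cancel by (simp add: b_def flip: mult.assoc)
  have "N_fun \<Phi> \<alpha> q l = (\<Sum>\<mu>\<in>?A. rf_const (b \<mu>) * Y \<mu>)"
    unfolding assms(8)
    by (intro sum.cong refl)
       (subst bspec[OF a], simp, simp add: Y_eq_monomial rf_const_mult rf_const_powi rf_sqrt_def mult_ac)
  then have b: "has_laurent (N_fun \<Phi> \<alpha> q l) b"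
    unfolding has_laurent_def using assms(7) by (intro exI[of _ ?A]) (auto simp: b_def)
  show ?thesis
  proof (intro ballI allI impI)
    fix w \<mu> assume w: "w \<in> weyl_group \<Phi>" and \<mu>: "\<mu> = \<theta> - inv w \<theta>"
    obtain "is" where "w = word_prod is"
      using w by (auto simp: weyl_group_eq_words)
    then have "inv w = word_prod (rev is)"
      by (simp add: inv_word_prod)
    then show "a \<mu> = complex_of_real (\<Prod>\<beta>\<in>inversions \<Phi> \<alpha> (inv w).
        gauss_sum1 q (nat \<lfloor>\<theta> \<bullet> \<beta>\<rfloor>) / real q powr ((\<theta> \<bullet> \<beta>) / 2))"
      using N_coefficient_formula[OF b assms(9) a, of "rev is"]
      unfolding \<mu> \<theta> gauss_factor_def by simp
  qed
qed

end
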